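(* Let $\kappa$ be a positive definite kernel on $X$, $\mathbf A=(A_i)_{i\in I}$ an $(I^+,I^-)$-condenser, and $\mathbf f$, $\mathbf a$, $\mathbf g$ as in the context. If $\lambda$ and $\hat\lambda$ both belong to $\mathcal G_{\mathbf f}(\mathbf A,\mathbf a,\mathbf g)$, then $$\|\lambda-\hat\lambda\|_{\mathcal E(\mathbf A)}=0,\qquad \langle\mathbf f,\lambda\rangle=\langle\mathbf f,\hat\lambda\rangle,$$ $$\mathbf W_\lambda(x)=\mathbf W_{\hat\lambda}(x)\quad\text{n.e. in }X.$$
   Context: Let $X$ be a locally compact Hausdorff space and $\mathfrak M$ the space of real-valued (signed) Radon measures on $X$. For a locally compact space $Y$, $\Phi(Y)$ is the set of lower semicontinuous $\psi:Y\to(-\infty,\infty]$, with $\psi\ge0$ required unless $Y$ is compact. Write $\langle u,\nu\rangle:=\int u\,d\nu$. A kernel is an element $\kappa\in\Phi(X\times X)$; $\kappa(\nu,\nu_1):=\int\kappa\,d(\nu\otimes\nu_1)$ and $\kappa(x,\nu):=\int\kappa(x,y)\,d\nu(y)$ whenever well defined. $\kappa$ is positive definite if it is symmetric and $\kappa(\nu,\nu)\ge0$ for every $\nu\in\mathfrak M$ for which it is defined. Then $\mathcal E:=\{\nu\in\mathfrak M:-\infty<\kappa(\nu,\nu)<\infty\}$ is a pre-Hilbert space with scalar product $\kappa(\nu,\nu_1)$ and seminorm $\|\nu\|:=\sqrt{\kappa(\nu,\nu)}$. $\mathfrak M^+(E)$ is the set of nonnegative measures supported by the closed set $E$; $\mathcal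 E^+:=\mathfrak M^+(X)\cap\mathcal E$. The interior capacity of $E\subset X$ is $C(E):=[\inf\|\nu\|^2]^{-1}$, the infimum over $\nu\in\mathcal E^+$ with $\nu(X)=1$ and compact support contained in $E$ ($\inf\varnothing=\infty$, $1/\infty=0$, $1/0=\infty$). A property holds nearly everywhere (n.e.) in $E$ if the set of $x\in E$ where it fails has interior capacity zero; a vector-valued property indexed by $i\in I$ holds n.e. if each of its components does. $I^+$, $I^-$ are disjoint countable (finite or infinite) sets of indices in $\mathbb N$, $I^-$ possibly empty, $I=I^+\cup I^-$; $\alpha_i=+1$ for $i\in I^+$ and $\alpha_i=-1$ for $i\in I^-$. An $(I^+,I^-)$-condenser is a family $\mathbf A=(A_i)_{i\in I}$ of nonempty closed sets in $X$ such that every compact set meets at most finitely many $A_i$ and $A_i\cap A_j=\varnothing$ for $i\in I^+$, $j\in I^-$. $\mathfrak M(\mathbf A):=\prod_{i\in I}\mathfrak M^+(A_i)$ consists of vector measures $\mu=(\mu^i)_{i\in I}$. Put $\kappa(\mu,\mu_1):=\sum_{i,j\in I}\alpha_i\alpha_j\kappa(\mu^i,\mu_1^j)$ and $\kappa_\mu=(\kappa^i_\mu)_{i\in I}$ with $\kappa_\mu^i(x):=\sum_{j\in I}\alpha_i\alpha_j\kappa(x,\mu^j)$. $\mathcal E(\mathbf A)$ is the set of $\mu\in\mathfrak M(\mathbf A)$ with $\kappa(\mu,\mu)$ finite (absolute convergence), with the semimetric $\|\mu_1-\mu_2\|_{\mathcal E(\mathbf A)}:=\bigl[\sum_{i,j\in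 I}\alpha_i\alpha_j\kappa(\mu_1^i-\mu_2^i,\mu_1^j-\mu_2^j)\bigr]^{1/2}$. External field: $\mathbf f=(f_i)_{i\in I}$, where for each $i$ there are $f_{i1},f_{i2}\in\Phi(X)$ with $f_{i2}\ne\infty$ n.e. in $X$ and $f_i=f_{i1}-f_{i2}$ (defined exactly where the right side is). $\mathbf g=(g_i)_{i\in I}$ with $g_i:A_i\to(0,\infty)$ continuous; $\mathbf a=(a_i)_{i\in I}$ with $a_i>0$. $\langle\mathbf f,\mu\rangle:=\sum_{i\in I}\langle f_i,\mu^i\rangle$ (finite iff the series converges absolutely). $\mathbf W_\mu=(W^i_\mu)_{i\in I}:=\kappa_\mu+\mathbf f$ (for $\mu\in\mathcal E(\mathbf A)$ it is defined and $\ne-\infty$ n.e. in $X$) and $G_{\mathbf f}(\mu):=\kappa(\mu,\mu)+2\langle\mathbf f,\mu\rangle$. $\mathcal E_{\mathbf f}(\mathbf A,\mathbf a,\mathbf g)$ is the set of $\mu\in\mathcal E(\mathbf A)$ with $\langle g_i,\mu^i\rangle=a_i$ for all $i\in I$ and $\langle\mathbf f,\mu\rangle$ finite. $G_{\mathbf f}(\mathbf A,\mathbf a,\mathbf g):=\inf_{\mu\in\mathcal E_{\mathbf f}(\mathbf A,\mathbf a,\mathbf g)}G_{\mathbf f}(\mu)$ ($\inf\varnothing=+\infty$). $\mathcal G_{\mathbf f}(\mathbf A,\mathbf a,\mathbf g)$ is the set of $\lambda\in\mathcal E_{\mathbf f}(\mathbf A,\mathbf a,\mathbf g)$ with $G_{\mathbf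 f}(\lambda)=G_{\mathbf f}(\mathbf A,\mathbf a,\mathbf g)$ (equilibrium measures). *)

theory Defs
  imports "HOL-Analysis.Analysis"
begin

text \<open>
  The integral of an extended real valued function is the integral of its positive part minus that
  of its negative part; it is well defined unless both are infinite. Since
  \<open>\<infinity> - \<infinity> = \<infinity>\<close> in \<^typ>\<open>ereal\<close>, an undefined integral has the
  value \<open>\<infinity>\<close>; in particular a finite value is always a well-defined one. With
  \<open>count_space I\<close> as the measure this is the sum of a family over \<open>I\<close>, and it is finite
  if and only if the family is absolutely summable.
\<close>

definition int_defined :: "'b measure \<Rightarrow> ('b \<Rightarrow> ereal) \<Rightarrow> bool" where
  "int_defined M f \<longleftrightarrow>
     \<not> ((\<integral>\<^sup>+x. e2ennreal (f x) \<partial>M) = \<infinity> \<and> (\<integral>\<^sup>+x. e2ennreal (- f x) \<partial>M) = \<infinity>)"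

definition eint :: "'b measure \<Rightarrow> ('b \<Rightarrow> ereal) \<Rightarrow> ereal" where
  "eint M f =
     enn2ereal (\<integral>\<^sup>+x. e2ennreal (f x) \<partial>M) - enn2ereal (\<integral>\<^sup>+x. e2ennreal (- f x) \<partial>M)"

abbreviation esum_defined :: "'i set \<Rightarrow> ('i \<Rightarrow> ereal) \<Rightarrow> bool" where
  "esum_defined I t \<equiv> int_defined (count_space I) t"

abbreviation esum :: "'i set \<Rightarrow> ('i \<Rightarrow> ereal) \<Rightarrow> ereal" where
  "esum I t \<equiv> eint (count_space I) t"

text \<open>Infinite values are kept, so that \<open>esqrt s = 0\<close> only for \<open>s = 0\<close>.\<close>

definition esqrt :: "ereal \<Rightarrow> ereal" where
  "esqrt s = (case s of ereal r \<Rightarrow> ereal (sqrt r) | PInfty \<Rightarrow> \<infinity> | MInfty \<Rightarrow> -\<infinity>)"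

definition lsc :: "('b::topological_space \<Rightarrow> ereal) \<Rightarrow> bool" where
  "lsc \<psi> \<longleftrightarrow> (\<forall>c. open {x. c < \<psi> x})"

definition Phi :: "('b::topological_space \<Rightarrow> ereal) set" where
  "Phi = {\<psi>. lsc \<psi> \<and> (\<forall>x. \<psi> x \<noteq> -\<infinity>) \<and> (compact (UNIV :: 'b set) \<or> (\<forall>x. 0 \<le> \<psi> x))}"

text \<open>
  Positive Radon measures on a locally compact Hausdorff space, as Borel measures. By the Riesz
  representation theorem they correspond to the positive linear functionals on the continuous
  functions with compact support.
\<close>

definition radon :: "'b::topological_space measure \<Rightarrow> bool" where
  "radon M \<longleftrightarrow>
     sets M = sets borel \<and>
     (\<forall>K. compact K \<longrightarrow> emeasure M K < \<infinity>) \<and>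
     (\<forall>E\<in>sets borel. emeasure M E = (INF U\<in>{U. open U \<and> E \<subseteq> U}. emeasure M U)) \<and>
     (\<forall>U. open U \<longrightarrow> emeasure M U = (SUP K\<in>{K. compact K \<and> K \<subseteq> U}. emeasure M K))"

definition msupp :: "'b::topological_space measure \<Rightarrow> 'b set" where
  "msupp M = - \<Union>{U. open U \<and> emeasure M U = 0}"

definition Mplus :: "'b::topological_space set \<Rightarrow> 'b measure set" where
  "Mplus E = {M. radon M \<and> msupp M \<subseteq> E}"

text \<open>
  The tensor product of two Radon measures is the unique Radon measure on the product space with
  the prescribed values on open rectangles. (When the spaces are not second countable, the product
  measure \<open>M \<Otimes>\<^sub>M N\<close> of the library lives on a \<open>\<sigma>\<close>-algebra which may be
  too small to make a lower semicontinuous kernel measurable.)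
\<close>

definition radon_prod ::
    "'b::topological_space measure \<Rightarrow> 'c::topological_space measure \<Rightarrow> ('b \<times> 'c) measure" where
  "radon_prod M N =
     (THE P. radon P \<and>
        (\<forall>U V. open U \<longrightarrow> open V \<longrightarrow> emeasure P (U \<times> V) = emeasure M U * emeasure N V))"

text \<open>
  Signed Radon measures are represented by their Jordan decomposition \<open>(\<nu>\<^sup>+, \<nu>\<^sup>-)\<close>. Both parts
  may be infinite, so that a signed Radon measure is not a set function on all Borel sets.
  Singularity is required only locally, on each compact set; this is the condition that the
  infimum of \<open>\<nu>\<^sup>+\<close> and \<open>\<nu>\<^sup>-\<close> in the lattice of Radon measures is zero.
\<close>

definition signed_radon :: "('b::topological_space measure \<times> 'b measure) set" where
  "signed_radon =
     {(P, N). radon P \<and> radon N \<and>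
        (\<forall>K. compact K \<longrightarrow>
           (\<exists>B\<in>sets borel. emeasure P (K \<inter> B) = 0 \<and> emeasure N (K - B) = 0))}"

text \<open>
  \<open>radon_diff M N\<close> is the pair \<open>(\<nu>\<^sup>+, \<nu>\<^sup>-)\<close> in \<open>signed_radon\<close> with
  \<open>\<nu>\<^sup>+ - \<nu>\<^sup>- = M - N\<close>, rearranged to avoid \<open>\<infinity> - \<infinity>\<close>.
\<close>

definition radon_diff ::
    "'b::topological_space measure \<Rightarrow> 'b measure \<Rightarrow> 'b measure \<times> 'b measure" where
  "radon_diff M N =
     (THE \<nu>. \<nu> \<in> signed_radon \<and>
        (\<forall>E\<in>sets borel.
           emeasure (fst \<nu>) E + emeasure N E = emeasure (snd \<nu>) E + emeasure M E))"

definition mutual :: "('b::topological_space \<times> 'b \<Rightarrow> ereal) \<Rightarrow> 'b measure \<Rightarrow> 'b measure \<Rightarrow> ereal" where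
  "mutual \<kappa> M N = eint (radon_prod M N) \<kappa>"

text \<open>
  The integral of \<open>\<kappa>\<close> against \<open>\<nu> \<otimes> \<nu>\<^sub>1\<close> for signed measures: the positive part of
  \<open>\<nu> \<otimes> \<nu>\<^sub>1\<close> is \<open>\<nu>\<^sup>+ \<otimes> \<nu>\<^sub>1\<^sup>+ + \<nu>\<^sup>- \<otimes> \<nu>\<^sub>1\<^sup>-\<close>
  and its negative part is \<open>\<nu>\<^sup>+ \<otimes> \<nu>\<^sub>1\<^sup>- + \<nu>\<^sup>- \<otimes> \<nu>\<^sub>1\<^sup>+\<close>.
  For \<open>\<kappa>\<close> in \<open>\<Phi>\<close> each of the four terms is well defined and different from
  \<open>-\<infinity>\<close>, and the whole expression is undefined exactly when it reads \<open>\<infinity> - \<infinity>\<close>,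
  in which case it has the value \<open>\<infinity>\<close>.
\<close>

definition signed_mutual ::
    "('b::topological_space \<times> 'b \<Rightarrow> ereal) \<Rightarrow> 'b measure \<times> 'b measure
       \<Rightarrow> 'b measure \<times> 'b measure \<Rightarrow> ereal" where
  "signed_mutual \<kappa> \<nu> \<nu>1 =
     (mutual \<kappa> (fst \<nu>) (fst \<nu>1) + mutual \<kappa> (snd \<nu>) (snd \<nu>1))
     - (mutual \<kappa> (fst \<nu>) (snd \<nu>1) + mutual \<kappa> (snd \<nu>) (fst \<nu>1))"

definition signed_mutual_defined ::
    "('b::topological_space \<times> 'b \<Rightarrow> ereal) \<Rightarrow> 'b measure \<times> 'b measure
       \<Rightarrow> 'b measure \<times> 'b measure \<Rightarrow> bool" where
  "signed_mutual_defined \<kappa> \<nu> \<nu>1 \<longleftrightarrow>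
     \<not> (mutual \<kappa> (fst \<nu>) (fst \<nu>1) + mutual \<kappa> (snd \<nu>) (snd \<nu>1) = \<infinity> \<and>
        mutual \<kappa> (fst \<nu>) (snd \<nu>1) + mutual \<kappa> (snd \<nu>) (fst \<nu>1) = \<infinity>)"

definition is_kernel :: "('b::topological_space \<times> 'b \<Rightarrow> ereal) \<Rightarrow> bool" where
  "is_kernel \<kappa> \<longleftrightarrow> \<kappa> \<in> Phi"

definition positive_definite :: "('b::topological_space \<times> 'b \<Rightarrow> ereal) \<Rightarrow> bool" where
  "positive_definite \<kappa> \<longleftrightarrow>
     (\<forall>x y. \<kappa> (x, y) = \<kappa> (y, x)) \<and>
     (\<forall>\<nu>\<in>signed_radon. signed_mutual_defined \<kappa> \<nu> \<nu> \<longrightarrow> 0 \<le> signed_mutual \<kappa> \<nu> \<nu>)"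

definition Eplus :: "('b::topological_space \<times> 'b \<Rightarrow> ereal) \<Rightarrow> 'b measure set" where
  "Eplus \<kappa> = {M. radon M \<and> -\<infinity> < mutual \<kappa> M M \<and> mutual \<kappa> M M < \<infinity>}"

definition capacity :: "('b::topological_space \<times> 'b \<Rightarrow> ereal) \<Rightarrow> 'b set \<Rightarrow> ereal" where
  "capacity \<kappa> E =
     inverse (INF M\<in>{M\<in>Eplus \<kappa>. emeasure M UNIV = 1 \<and> compact (msupp M) \<and> msupp M \<subseteq> E}.
       mutual \<kappa> M M)"

definition nearly_everywhere ::
    "('b::topological_space \<times> 'b \<Rightarrow> ereal) \<Rightarrow> 'b set \<Rightarrow> ('b \<Rightarrow> bool) \<Rightarrow> bool" where
  "nearly_everywhere \<kappa> E P \<longleftrightarrow> capacity \<kappa> {x\<in>E. \<not> P x} = 0"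

text \<open>
  The index sets \<open>Ip\<close>, \<open>In\<close> stand for \<open>I\<^sup>+\<close>, \<open>I\<^sup>-\<close>. Vector measures
  are families \<open>\<mu> :: nat \<Rightarrow> 'b measure\<close> of which only the components with index in
  \<open>Ip \<union> In\<close> are used.
\<close>

definition condenser :: "nat set \<Rightarrow> nat set \<Rightarrow> (nat \<Rightarrow> 'b::topological_space set) \<Rightarrow> bool" where
  "condenser Ip In A \<longleftrightarrow>
     Ip \<inter> In = {} \<and>
     (\<forall>i\<in>Ip \<union> In. closed (A i) \<and> A i \<noteq> {}) \<and>
     (\<forall>K. compact K \<longrightarrow> finite {i\<in>Ip \<union> In. A i \<inter> K \<noteq> {}}) \<and>
     (\<forall>i\<in>Ip. \<forall>j\<in>In. A i \<inter> A j = {})"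

definition alpha :: "nat set \<Rightarrow> nat \<Rightarrow> real" where
  "alpha Ip i = (if i \<in> Ip then 1 else -1)"

definition MA :: "nat set \<Rightarrow> nat set \<Rightarrow> (nat \<Rightarrow> 'b::topological_space set)
    \<Rightarrow> (nat \<Rightarrow> 'b measure) set" where
  "MA Ip In A = (\<Pi> i\<in>Ip \<union> In. Mplus (A i))"

definition vmutual :: "nat set \<Rightarrow> nat set \<Rightarrow> ('b::topological_space \<times> 'b \<Rightarrow> ereal)
    \<Rightarrow> (nat \<Rightarrow> 'b measure) \<Rightarrow> (nat \<Rightarrow> 'b measure) \<Rightarrow> ereal" where
  "vmutual Ip In \<kappa> \<mu> \<mu>1 =
     esum ((Ip \<union> In) \<times> (Ip \<union> In))
       (\<lambda>(i, j). ereal (alpha Ip i * alpha Ip j) * mutual \<kappa> (\<mu> i) (\<mu>1 j))"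

definition EA :: "nat set \<Rightarrow> nat set \<Rightarrow> ('b::topological_space \<times> 'b \<Rightarrow> ereal)
    \<Rightarrow> (nat \<Rightarrow> 'b set) \<Rightarrow> (nat \<Rightarrow> 'b measure) set" where
  "EA Ip In \<kappa> A = {\<mu>\<in>MA Ip In A. \<bar>vmutual Ip In \<kappa> \<mu> \<mu>\<bar> \<noteq> \<infinity>}"

definition EA_dist :: "nat set \<Rightarrow> nat set \<Rightarrow> ('b::topological_space \<times> 'b \<Rightarrow> ereal)
    \<Rightarrow> (nat \<Rightarrow> 'b measure) \<Rightarrow> (nat \<Rightarrow> 'b measure) \<Rightarrow> ereal" where
  "EA_dist Ip In \<kappa> \<mu>1 \<mu>2 =
     esqrt (esum ((Ip \<union> In) \<times> (Ip \<union> In))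
       (\<lambda>(i, j). ereal (alpha Ip i * alpha Ip j) *
          signed_mutual \<kappa> (radon_diff (\<mu>1 i) (\<mu>2 i)) (radon_diff (\<mu>1 j) (\<mu>2 j))))"

definition vpot :: "nat set \<Rightarrow> nat set \<Rightarrow> ('b::topological_space \<times> 'b \<Rightarrow> ereal)
    \<Rightarrow> (nat \<Rightarrow> 'b measure) \<Rightarrow> nat \<Rightarrow> 'b \<Rightarrow> ereal" where
  "vpot Ip In \<kappa> \<mu> i x =
     esum (Ip \<union> In) (\<lambda>j. ereal (alpha Ip i * alpha Ip j) * eint (\<mu> j) (\<lambda>y. \<kappa> (x, y)))"

definition vpot_defined :: "nat set \<Rightarrow> nat set \<Rightarrow> ('b::topological_space \<times> 'b \<Rightarrow> ereal)
    \<Rightarrow> (nat \<Rightarrow> 'b measure) \<Rightarrow> nat \<Rightarrow> 'b \<Rightarrow> bool" where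
  "vpot_defined Ip In \<kappa> \<mu> i x \<longleftrightarrow>
     (\<forall>j\<in>Ip \<union> In. int_defined (\<mu> j) (\<lambda>y. \<kappa> (x, y))) \<and>
     esum_defined (Ip \<union> In)
       (\<lambda>j. ereal (alpha Ip i * alpha Ip j) * eint (\<mu> j) (\<lambda>y. \<kappa> (x, y)))"

text \<open>
  An external field is given by the two families \<open>f1\<close>, \<open>f2\<close> with
  \<open>f\<^sub>i = f1 i - f2 i\<close>. Points where this reads \<open>\<infinity> - \<infinity>\<close> are outside the domain
  of \<open>f\<^sub>i\<close>; \<open>efield\<close> has the value \<open>\<infinity>\<close> there.
\<close>

definition external_field :: "nat set \<Rightarrow> nat set \<Rightarrow> ('b::topological_space \<times> 'b \<Rightarrow> ereal)
    \<Rightarrow> (nat \<Rightarrow> 'b \<Rightarrow> ereal) \<Rightarrow> (nat \<Rightarrow> 'b \<Rightarrow> ereal) \<Rightarrow> bool" where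
  "external_field Ip In \<kappa> f1 f2 \<longleftrightarrow>
     (\<forall>i\<in>Ip \<union> In. f1 i \<in> Phi \<and> f2 i \<in> Phi \<and> nearly_everywhere \<kappa> UNIV (\<lambda>x. f2 i x \<noteq> \<infinity>))"

definition efield :: "(nat \<Rightarrow> 'b \<Rightarrow> ereal) \<Rightarrow> (nat \<Rightarrow> 'b \<Rightarrow> ereal) \<Rightarrow> nat \<Rightarrow> 'b \<Rightarrow> ereal" where
  "efield f1 f2 i x = f1 i x - f2 i x"

definition field_defined ::
    "(nat \<Rightarrow> 'b \<Rightarrow> ereal) \<Rightarrow> (nat \<Rightarrow> 'b \<Rightarrow> ereal) \<Rightarrow> nat \<Rightarrow> 'b \<Rightarrow> bool" where
  "field_defined f1 f2 i x \<longleftrightarrow> \<not> (f1 i x = \<infinity> \<and> f2 i x = \<infinity>)"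

definition field_int :: "nat set \<Rightarrow> nat set \<Rightarrow> (nat \<Rightarrow> 'b \<Rightarrow> ereal) \<Rightarrow> (nat \<Rightarrow> 'b \<Rightarrow> ereal)
    \<Rightarrow> (nat \<Rightarrow> 'b measure) \<Rightarrow> ereal" where
  "field_int Ip In f1 f2 \<mu> = esum (Ip \<union> In) (\<lambda>i. eint (\<mu> i) (efield f1 f2 i))"

definition W :: "nat set \<Rightarrow> nat set \<Rightarrow> ('b::topological_space \<times> 'b \<Rightarrow> ereal)
    \<Rightarrow> (nat \<Rightarrow> 'b \<Rightarrow> ereal) \<Rightarrow> (nat \<Rightarrow> 'b \<Rightarrow> ereal) \<Rightarrow> (nat \<Rightarrow> 'b measure) \<Rightarrow> nat \<Rightarrow> 'b \<Rightarrow> ereal" where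
  "W Ip In \<kappa> f1 f2 \<mu> i x = vpot Ip In \<kappa> \<mu> i x + efield f1 f2 i x"

definition W_defined :: "nat set \<Rightarrow> nat set \<Rightarrow> ('b::topological_space \<times> 'b \<Rightarrow> ereal)
    \<Rightarrow> (nat \<Rightarrow> 'b \<Rightarrow> ereal) \<Rightarrow> (nat \<Rightarrow> 'b \<Rightarrow> ereal) \<Rightarrow> (nat \<Rightarrow> 'b measure) \<Rightarrow> nat \<Rightarrow> 'b \<Rightarrow> bool" where
  "W_defined Ip In \<kappa> f1 f2 \<mu> i x \<longleftrightarrow>
     vpot_defined Ip In \<kappa> \<mu> i x \<and> field_defined f1 f2 i x \<and>
     \<not> (vpot Ip In \<kappa> \<mu> i x = \<infinity> \<and> efield f1 f2 i x = -\<infinity>) \<and>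
     \<not> (vpot Ip In \<kappa> \<mu> i x = -\<infinity> \<and> efield f1 f2 i x = \<infinity>)"

definition Gf :: "nat set \<Rightarrow> nat set \<Rightarrow> ('b::topological_space \<times> 'b \<Rightarrow> ereal)
    \<Rightarrow> (nat \<Rightarrow> 'b \<Rightarrow> ereal) \<Rightarrow> (nat \<Rightarrow> 'b \<Rightarrow> ereal) \<Rightarrow> (nat \<Rightarrow> 'b measure) \<Rightarrow> ereal" where
  "Gf Ip In \<kappa> f1 f2 \<mu> = vmutual Ip In \<kappa> \<mu> \<mu> + 2 * field_int Ip In f1 f2 \<mu>"

definition Ef :: "nat set \<Rightarrow> nat set \<Rightarrow> ('b::topological_space \<times> 'b \<Rightarrow> ereal)
    \<Rightarrow> (nat \<Rightarrow> 'b \<Rightarrow> ereal) \<Rightarrow> (nat \<Rightarrow> 'b \<Rightarrow> ereal)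
    \<Rightarrow> (nat \<Rightarrow> 'b set) \<Rightarrow> (nat \<Rightarrow> real) \<Rightarrow> (nat \<Rightarrow> 'b \<Rightarrow> real) \<Rightarrow> (nat \<Rightarrow> 'b measure) set" where
  "Ef Ip In \<kappa> f1 f2 A a g =
     {\<mu>\<in>EA Ip In \<kappa> A.
        (\<forall>i\<in>Ip \<union> In. (\<integral>\<^sup>+x\<in>A i. ennreal (g i x) \<partial>\<mu> i) = ennreal (a i)) \<and>
        \<bar>field_int Ip In f1 f2 \<mu>\<bar> \<noteq> \<infinity>}"

definition Gf_inf :: "nat set \<Rightarrow> nat set \<Rightarrow> ('b::topological_space \<times> 'b \<Rightarrow> ereal)
    \<Rightarrow> (nat \<Rightarrow> 'b \<Rightarrow> ereal) \<Rightarrow> (nat \<Rightarrow> 'b \<Rightarrow> ereal)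
    \<Rightarrow> (nat \<Rightarrow> 'b set) \<Rightarrow> (nat \<Rightarrow> real) \<Rightarrow> (nat \<Rightarrow> 'b \<Rightarrow> real) \<Rightarrow> ereal" where
  "Gf_inf Ip In \<kappa> f1 f2 A a g =
     (INF \<mu>\<in>Ef Ip In \<kappa> f1 f2 A a g. Gf Ip In \<kappa> f1 f2 \<mu>)"

definition equilibrium :: "nat set \<Rightarrow> nat set \<Rightarrow> ('b::topological_space \<times> 'b \<Rightarrow> ereal)
    \<Rightarrow> (nat \<Rightarrow> 'b \<Rightarrow> ereal) \<Rightarrow> (nat \<Rightarrow> 'b \<Rightarrow> ereal)
    \<Rightarrow> (nat \<Rightarrow> 'b set) \<Rightarrow> (nat \<Rightarrow> real) \<Rightarrow> (nat \<Rightarrow> 'b \<Rightarrow> real) \<Rightarrow> (nat \<Rightarrow> 'b measure) set" where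
  "equilibrium Ip In \<kappa> f1 f2 A a g =
     {\<mu>\<in>Ef Ip In \<kappa> f1 f2 A a g. Gf Ip In \<kappa> f1 f2 \<mu> = Gf_inf Ip In \<kappa> f1 f2 A a g}"

end

theory Submission
  imports Defs
begin

text \<open>Write \<open>\<langle>\<mu>, \<nu>\<rangle>\<close> for the sum over all \<open>i, j\<close> of
\<open>\<alpha>\<^sub>i \<alpha>\<^sub>j \<kappa>(\<mu>\<^sup>i, \<nu>\<^sup>j)\<close>. The admissible vector measures form a convex set on which the
Gauss functional is the quadratic form \<open>\<langle>\<mu>, \<mu>\<rangle>\<close> plus the linear functional
\<open>2 \<langle>f, \<mu>\<rangle>\<close>. If \<open>\<mu>\<close> and \<open>\<nu>\<close> both minimise it, the parallelogram identity gives
\<open>\<parallel>\<mu> - \<nu>\<parallel>\<^sup>2 = 2 G(\<mu>) + 2 G(\<nu>) - 4 G((\<mu> + \<nu>)/2) \<le> 0\<close>, so positive definiteness forces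
\<open>\<parallel>\<mu> - \<nu>\<parallel> = 0\<close>. By Cauchy-Schwarz a vector at distance zero has the same mutual energy with
everything: \<open>\<langle>\<mu>, \<mu>\<rangle> = \<langle>\<nu>, \<nu>\<rangle>\<close>, and then equality of the Gauss functionals gives equality of the
field integrals. For a unit measure \<open>M\<close> of finite energy and compact support, applying Cauchy-Schwarz to the restrictions of
\<open>M\<close> to all Borel sets shows that the potentials of \<open>\<mu>\<close> and \<open>\<nu>\<close> agree
\<open>M\<close>-almost everywhere. Hence the set where they differ supports no such \<open>M\<close>, which is what
capacity zero means. The field itself is well defined \<open>M\<close>-almost everywhere, since such an \<open>M\<close> does not
charge Borel sets of capacity zero (\<open>AE_not_in_capacity_zero\<close>).

The work lies in making sense of these sums. The condition \<open>\<langle>g\<^sub>i, \<mu>\<^sup>i\<rangle> = a\<^sub>i\<close> with \<open>g\<^sub>i > 0\<close>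
makes each component \<^emph>\<open>moderate\<close> (\<open>moderate_of_finite_weight\<close>): countably many open sets of
finite measure cover the space. Moderate Radon measures are closed under finite linear combinations, smaller
measures, Jordan decomposition and tensor products. Their Radon product is the iterated integral
(\<open>moderate_prodm\<close>, \<open>radon_prod_eq_prodm\<close>), which gives Tonelli's theorem on the full
Borel sets of the product.

On measures of finite energy the mutual energy is then a finite symmetric bilinear form. Positive definiteness
speaks of a signed measure through its Jordan decomposition; \<open>pair_energy\<close> transfers it to differences
of positive measures, and \<open>gram_nonneg\<close> to all finite Gram matrices. Infinite families are reached as
limits of finite squares of indices (\<open>energy_family_psd\<close>). The convergence of the mixed sums rests on a
dichotomy: either \<open>\<kappa> \<ge> 0\<close>, and a mixed sum is bounded by the two energies, or the space is compact,
and the condenser has only finitely many plates.\<close>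

section \<open>Integrals and sums of extended real valued functions\<close>

lemma int_defined_integrable:
  fixes f :: "'b \<Rightarrow> real"
  assumes "integrable M f"
  shows "int_defined M (\<lambda>x. ereal (f x))"
    and "eint M (\<lambda>x. ereal (f x)) = ereal (integral\<^sup>L M f)"
proof -
  have pos: "(\<integral>\<^sup>+x. ennreal (f x) \<partial>M) < \<infinity>" and neg: "(\<integral>\<^sup>+x. ennreal (- f x) \<partial>M) < \<infinity>"
    using assms unfolding real_integrable_def by (auto simp: top.not_eq_extremum)
  then show "int_defined M (\<lambda>x. ereal (f x))"
    by (auto simp: int_defined_def ennreal.abs_eq[symmetric] e2ennreal_ereal)
  obtain p where p: "(\<integral>\<^sup>+x. ennreal (f x) \<partial>M) = ennreal p" "0 \<le> p"
    using pos by (cases "\<integral>\<^sup>+x. ennreal (f x) \<partial>M") auto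
  obtain n where n: "(\<integral>\<^sup>+x. ennreal (- f x) \<partial>M) = ennreal n" "0 \<le> n"
    using neg by (cases "\<integral>\<^sup>+x. ennreal (- f x) \<partial>M") auto
  show "eint M (\<lambda>x. ereal (f x)) = ereal (integral\<^sup>L M f)"
    by (simp add: eint_def p n real_lebesgue_integral_def[OF assms] e2ennreal_ereal
        enn2ereal_ennreal)
qed

lemma eint_cong_AE:
  assumes "AE x in M. f x = g x"
  shows "eint M f = eint M g" "int_defined M f = int_defined M g"
proof -
  have "(\<integral>\<^sup>+x. e2ennreal (f x) \<partial>M) = (\<integral>\<^sup>+x. e2ennreal (g x) \<partial>M)"
    "(\<integral>\<^sup>+x. e2ennreal (- f x) \<partial>M) = (\<integral>\<^sup>+x. e2ennreal (- g x) \<partial>M)"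
    using assms by (auto intro!: nn_integral_cong_AE)
  then show "eint M f = eint M g" "int_defined M f = int_defined M g"
    by (simp_all add: eint_def int_defined_def)
qed

lemma eint_finite_parts:
  assumes "\<bar>eint M f\<bar> \<noteq> \<infinity>"
  shows "(\<integral>\<^sup>+x. e2ennreal (f x) \<partial>M) < \<infinity>" "(\<integral>\<^sup>+x. e2ennreal (- f x) \<partial>M) < \<infinity>"
  using assms unfolding eint_def
  by (cases "\<integral>\<^sup>+x. e2ennreal (f x) \<partial>M"; cases "\<integral>\<^sup>+x. e2ennreal (- f x) \<partial>M";
      simp add: enn2ereal_ennreal)+

lemma eint_eq_diff:
  assumes "(\<integral>\<^sup>+x. e2ennreal (f x) \<partial>M) < \<infinity>" "(\<integral>\<^sup>+x. e2ennreal (- f x) \<partial>M) < \<infinity>"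
  shows "eint M f = ereal (enn2real (\<integral>\<^sup>+x. e2ennreal (f x) \<partial>M)
      - enn2real (\<integral>\<^sup>+x. e2ennreal (- f x) \<partial>M))" "int_defined M f"
  using assms unfolding eint_def int_defined_def
  by (cases "\<integral>\<^sup>+x. e2ennreal (f x) \<partial>M"; cases "\<integral>\<^sup>+x. e2ennreal (- f x) \<partial>M";
      simp add: enn2ereal_ennreal)+

lemma summable_on_iff_integrable_count_space:
  fixes r :: "'i \<Rightarrow> real"
  shows "r summable_on S \<longleftrightarrow> integrable (count_space S) r"
  using summable_on_iff_abs_summable_on_real[of r S] abs_summable_equivalent[of r S]
  unfolding Infinite_Set_Sum.abs_summable_on_def by simp

text \<open>The extended sum is an integral with respect to counting measure, so summability of the real terms is
integrability, and the two values agree.\<close>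

lemma esum_ereal:
  fixes r :: "'i \<Rightarrow> real"
  assumes "r summable_on S" "\<And>i. i \<in> S \<Longrightarrow> t i = ereal (r i)"
  shows "esum S t = ereal (infsum r S)" "esum_defined S t"
proof -
  have int: "integrable (count_space S) r"
    using assms(1) by (simp only: summable_on_iff_integrable_count_space)
  then have *: "Infinite_Set_Sum.abs_summable_on r S"
    by (simp only: Infinite_Set_Sum.abs_summable_on_def)
  have eq: "AE i in count_space S. t i = ereal (r i)"
    using assms(2) by (simp add: AE_count_space)
  show "esum S t = ereal (infsum r S)"
    using int_defined_integrable(2)[OF int] eint_cong_AE(1)[OF eq] infsetsum_infsum[OF *]
    by (simp add: infsetsum_def)
  show "esum_defined S t"
    using int_defined_integrable(1)[OF int] eint_cong_AE(2)[OF eq] by simp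
qed

text \<open>The converse of \<open>esum_ereal\<close>: because an undefined sum has the value \<open>\<infinity>\<close>, finiteness of the
value alone yields finite terms and absolute convergence.\<close>

lemma esum_finiteD:
  assumes "\<bar>esum S t\<bar> \<noteq> \<infinity>"
  shows "\<And>i. i \<in> S \<Longrightarrow> \<bar>t i\<bar> \<noteq> \<infinity>"
    and "(\<lambda>i. real_of_ereal (t i)) summable_on S"
proof -
  note fin = eint_finite_parts[OF assms]
  have "AE i in count_space S. e2ennreal (t i) \<noteq> \<infinity>"
    "AE i in count_space S. e2ennreal (- t i) \<noteq> \<infinity>"
    using nn_integral_PInf_AE[of "\<lambda>i. e2ennreal (t i)" "count_space S"]
      nn_integral_PInf_AE[of "\<lambda>i. e2ennreal (- t i)" "count_space S"] fin by auto
  then have t: "\<bar>t i\<bar> \<noteq> \<infinity>" if "i \<in> S" for i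
    using that by (cases "t i") (auto simp: AE_count_space e2ennreal_infty)
  then show "\<And>i. i \<in> S \<Longrightarrow> \<bar>t i\<bar> \<noteq> \<infinity>" .
  have 1: "(\<integral>\<^sup>+i. e2ennreal (t i) \<partial>count_space S)
      = (\<integral>\<^sup>+i. ennreal (real_of_ereal (t i)) \<partial>count_space S)"
    using t by (intro nn_integral_cong) (metis space_count_space ereal_real' e2ennreal_ereal)
  have 2: "(\<integral>\<^sup>+i. e2ennreal (- t i) \<partial>count_space S)
      = (\<integral>\<^sup>+i. ennreal (- real_of_ereal (t i)) \<partial>count_space S)"
    using t by (intro nn_integral_cong)
      (metis space_count_space ereal_real' e2ennreal_ereal uminus_ereal.simps(1))
  have "integrable (count_space S) (\<lambda>i. real_of_ereal (t i))"
    using fin unfolding real_integrable_def 1 2 by (auto simp: less_top)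
  then show "(\<lambda>i. real_of_ereal (t i)) summable_on S"
    by (simp only: summable_on_iff_integrable_count_space)
qed

lemma lsc_borel_measurable [measurable_dest]: "lsc \<psi> \<Longrightarrow> \<psi> \<in> borel_measurable borel"
  unfolding lsc_def borel_measurable_ereal_iff_Ioi
  by (auto simp: vimage_def greaterThan_def intro!: borel_open)

text \<open>A member of \<open>\<Phi>\<close> that takes negative values lives on a compact space, which is covered by finitely many of
the open sets \<open>{x. -n < \<psi> x}\<close>.\<close>

lemma Phi_bounded_below:
  assumes "\<psi> \<in> Phi" "\<not> (\<forall>x. 0 \<le> \<psi> x)"
  obtains c :: real where "\<And>x. - ereal c \<le> \<psi> x" "0 \<le> c"
proof -
  have "compact (UNIV :: 'a set)" "lsc \<psi>" and fin: "\<And>x. \<psi> x \<noteq> -\<infinity>"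
    using assms by (auto simp: Phi_def)
  define G where "G n = {x. ereal (- real n) < \<psi> x}" for n
  have cover: "UNIV \<subseteq> (\<Union>n\<in>UNIV. G n)"
  proof
    fix x show "x \<in> (\<Union>n\<in>UNIV. G n)"
    proof (cases "\<psi> x")
      case (real r)
      obtain n where "- r < real n" using reals_Archimedean2 by blast
      then have "x \<in> G n" using real by (simp add: G_def)
      then show ?thesis by blast
    qed (use fin in \<open>auto simp: G_def\<close>)
  qed
  have opn: "open (G n)" for n
    using \<open>lsc \<psi>\<close> by (simp add: lsc_def G_def)
  obtain D where D: "D \<subseteq> UNIV" "finite D" "UNIV \<subseteq> (\<Union>n\<in>D. G n)"
    by (rule compactE_image[OF \<open>compact UNIV\<close> opn cover])
  have "- ereal (real (Max D)) \<le> \<psi> x" for x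
  proof -
    have "x \<in> (\<Union>n\<in>D. G n)" using D(3) by blast
    then obtain n where n: "n \<in> D" "x \<in> G n" by blast
    then have "ereal (- real n) < \<psi> x" by (simp add: G_def)
    moreover have "n \<le> Max D" using D(2) n(1) by simp
    then have "ereal (- real (Max D)) \<le> ereal (- real n)" by simp
    ultimately show ?thesis by (cases "\<psi> x") auto
  qed
  then show ?thesis using that[of "real (Max D)"] by simp
qed

section \<open>Moderate Radon measures\<close>

text \<open>The sets that can be enclosed between closed and open sets up to small measure inside \<open>V\<close> form a
\<open>\<sigma>\<close>-algebra; inner regularity puts the open sets into it, compact sets being closed.\<close>

lemma borel_closed_open_approx:
  fixes M :: "'b::t2_space measure"
  assumes [measurable_cong, simp]: "sets M = sets borel" and V: "open V" "emeasure M V < \<infinity>"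
    and inner: "\<And>W e. open W \<Longrightarrow> W \<subseteq> V \<Longrightarrow> (0::real) < e \<Longrightarrow>
      \<exists>K. compact K \<and> K \<subseteq> W \<and> emeasure M (W - K) \<le> ennreal e"
    and "E \<in> sets borel" "0 < e"
  shows "\<exists>F U. closed F \<and> open U \<and> F \<subseteq> E \<and> E \<subseteq> U \<and> emeasure M (V \<inter> (U - F)) \<le> ennreal e"
proof -
  have "E \<in> sigma_sets UNIV {S. open S}"
    using \<open>E \<in> sets borel\<close> by (simp add: borel_def)
  then show ?thesis using \<open>0 < e\<close>
  proof (induction E arbitrary: e)
    case (Basic W)
    then have "open W" by simp
    with V inner[of "V \<inter> W" e] Basic obtain K where K: "compact K" "K \<subseteq> V \<inter> W"
      "emeasure M (V \<inter> W - K) \<le> ennreal e" by (auto simp: open_Int)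
    moreover have "V \<inter> W - K = V \<inter> (W - K)" by blast
    ultimately show ?case using \<open>open W\<close> by (intro exI[of _ K] exI[of _ W]) (auto simp: compact_imp_closed)
  next
    case Empty
    show ?case by (intro exI[of _ "{}"]) auto
  next
    case (Compl E)
    from Compl.IH[OF Compl.prems] obtain F U where "closed F" "open U" "F \<subseteq> E" "E \<subseteq> U"
      "emeasure M (V \<inter> (U - F)) \<le> ennreal e"
      by (elim exE conjE)
    moreover have "- F - - U = U - F" by blast
    ultimately show ?case by (intro exI[of _ "- U"] exI[of _ "- F"]) (auto simp: open_Compl)
  next
    case (Union E)
    \<comment> \<open>One half of the error pays for the countably many pieces, the other half for replacing the union of the \<open>F n\<close> by a finite one, which is closed.\<close>
    define d where "d n = (e/2) * (1/2) ^ Suc n" for n :: nat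
    have d: "d n > 0" for n using Union.prems by (simp add: d_def)
    have "\<forall>n. \<exists>F U. closed F \<and> open U \<and> F \<subseteq> E n \<and> E n \<subseteq> U \<and> emeasure M (V \<inter> (U - F)) \<le> ennreal (d n)"
      using Union.IH[OF d] by (rule allI)
    then obtain F U where FU: "\<And>n. closed (F n)" "\<And>n. open (U n)" "\<And>n. F n \<subseteq> E n" "\<And>n. E n \<subseteq> U n"
      "\<And>n. emeasure M (V \<inter> (U n - F n)) \<le> ennreal (d n)" by metis
    have [measurable]: "V \<in> sets borel" "U n \<in> sets borel" "F n \<in> sets borel" for n
      using FU V by auto
    define R where "R N = V \<inter> ((\<Union>n. U n) - (\<Union>n<N. F n))" for N :: nat
    have R[measurable]: "R N \<in> sets borel" for N unfolding R_def by measurable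
    have "d sums (e/2)"
      unfolding d_def using sums_mult[OF power_half_series, of "e/2"] by simp
    then have dsum: "(\<Sum>n. ennreal (d n)) = ennreal (e/2)"
      using d by (intro suminf_ennreal_eq) (auto intro: less_imp_le)
    have "(\<Inter>N. R N) \<subseteq> (\<Union>n. V \<inter> (U n - F n))" by (auto simp: R_def)
    then have "emeasure M (\<Inter>N. R N) \<le> emeasure M (\<Union>n. V \<inter> (U n - F n))"
      by (intro emeasure_mono) measurable
    also have "\<dots> \<le> (\<Sum>n. emeasure M (V \<inter> (U n - F n)))"
      by (intro emeasure_subadditive_countably) auto
    also have "\<dots> \<le> (\<Sum>n. ennreal (d n))"
      by (intro suminf_le FU summableI)
    also have "\<dots> < ennreal e" using Union.prems by (simp add: dsum ennreal_less_iff)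
    finally have lt: "emeasure M (\<Inter>N. R N) < ennreal e" .
    have fin: "emeasure M (R N) \<noteq> \<infinity>" for N
    proof -
      have "R N \<subseteq> V" unfolding R_def by (rule Int_lower1)
      then have "emeasure M (R N) \<le> emeasure M V"
        by (rule emeasure_mono) measurable
      also note V(2)
      finally show ?thesis by (rule less_imp_neq)
    qed
    have "R n \<subseteq> R m" if "m \<le> n" for m n
    proof -
      have "(\<Union>i<m. F i) \<subseteq> (\<Union>i<n. F i)" using that by (intro UN_mono) auto
      then show ?thesis unfolding R_def by blast
    qed
    then have "decseq R" unfolding decseq_def by blast
    have "range R \<subseteq> sets M" using R by auto
    then have "(INF N. emeasure M (R N)) = emeasure M (\<Inter>N. R N)"
      using \<open>decseq R\<close> fin by (rule INF_emeasure_decseq)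
    with lt have "(INF N. emeasure M (R N)) < ennreal e" by simp
    then obtain N where N: "emeasure M (R N) < ennreal e"
      unfolding INF_less_iff by blast
    show ?case
    proof (intro exI conjI)
      show "closed (\<Union>n<N. F n)" using FU(1) by auto
      show "open (\<Union>n. U n)" using FU(2) by auto
      show "(\<Union>n<N. F n) \<subseteq> (\<Union>n. E n)" using FU(3) by (intro UN_mono) auto
      show "(\<Union>n. E n) \<subseteq> (\<Union>n. U n)" using FU(4) by (intro UN_mono) auto
      show "emeasure M (V \<inter> ((\<Union>n. U n) - (\<Union>n<N. F n))) \<le> ennreal e"
        using less_imp_le[OF N] unfolding R_def .
    qed
  qed
qed

text \<open>Bourbaki's moderate measures: \<open>\<sigma>\<close>-finiteness is witnessed by \<^emph>\<open>open\<close> sets. This is what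
transports outer regularity from sets of finite measure to all Borel sets, and it is inherited by all the
constructions below.\<close>

definition moderate :: "'b::topological_space measure \<Rightarrow> bool" where
  "moderate M \<longleftrightarrow> radon M \<and>
     (\<exists>V::nat \<Rightarrow> 'b set. incseq V \<and> (\<forall>n. open (V n) \<and> emeasure M (V n) < \<infinity>) \<and> (\<Union>n. V n) = UNIV)"

lemma radonD:
  assumes "radon M"
  shows "sets M = sets borel"
    and "compact K \<Longrightarrow> emeasure M K < \<infinity>"
    and "E \<in> sets borel \<Longrightarrow> emeasure M E = (INF U\<in>{U. open U \<and> E \<subseteq> U}. emeasure M U)"
    and "open U \<Longrightarrow> emeasure M U = (SUP K\<in>{K. compact K \<and> K \<subseteq> U}. emeasure M K)"
proof -
  note * = assms[unfolded radon_def]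
  show "sets M = sets borel" by (rule *[THEN conjunct1])
  show "compact K \<Longrightarrow> emeasure M K < \<infinity>"
    by (rule *[THEN conjunct2, THEN conjunct1, rule_format])
  show "E \<in> sets borel \<Longrightarrow> emeasure M E = (INF U\<in>{U. open U \<and> E \<subseteq> U}. emeasure M U)"
    by (rule *[THEN conjunct2, THEN conjunct2, THEN conjunct1, rule_format])
  show "open U \<Longrightarrow> emeasure M U = (SUP K\<in>{K. compact K \<and> K \<subseteq> U}. emeasure M K)"
    by (rule *[THEN conjunct2, THEN conjunct2, THEN conjunct2, rule_format])
qed

lemmas radon_sets [simp] = radonD(1)
  and radon_compact_finite = radonD(2) and radon_outer = radonD(3) and radon_inner = radonD(4)

lemma moderate_radon [simp]: "moderate M \<Longrightarrow> radon M"
  by (simp add: moderate_def)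

lemma moderate_sets [simp]: "moderate M \<Longrightarrow> sets M = sets borel"
  by (rule radon_sets[OF moderate_radon])

lemma sets_borel_space [simp]: "sets M = sets borel \<Longrightarrow> space M = UNIV"
  using sets_eq_imp_space_eq[of M borel] by simp

lemma moderateE:
  fixes M :: "'b::topological_space measure"
  assumes "moderate M"
  obtains V :: "nat \<Rightarrow> 'b set"
  where "incseq V" "\<And>n. open (V n)" "\<And>n. emeasure M (V n) < \<infinity>" "(\<Union>n. V n) = UNIV"
  using assms by (auto simp: moderate_def)

lemma radon_inner_approx:
  fixes M :: "'b::t2_space measure" and W :: "'b set"
  assumes "radon M" "open W" "emeasure M W < \<infinity>" "(0::real) < e"
  shows "\<exists>K. compact K \<and> K \<subseteq> W \<and> emeasure M (W - K) \<le> ennreal e"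
proof -
  let ?C = "{K. compact K \<and> K \<subseteq> W}"
  have M: "sets M = sets borel" and W: "emeasure M W = (SUP K\<in>?C. emeasure M K)"
    using radon_sets[OF assms(1)] radon_inner[OF assms(1,2)] by simp_all
  have "{} \<in> ?C" by simp
  then have ne: "?C \<noteq> {}" by blast
  have "emeasure M W \<noteq> \<infinity>" using assms(3) by simp
  then obtain K where "K \<in> ?C" and lt: "emeasure M W < emeasure M K + ennreal e"
    using SUP_approx_ennreal[OF assms(4) ne W] by blast
  then have K: "compact K" "K \<subseteq> W" by simp_all
  have KB: "K \<in> sets M" "W \<in> sets M"
    unfolding M using K(1) assms(2) by (simp_all add: compact_imp_closed)
  have "emeasure M K \<le> emeasure M W" by (rule emeasure_mono[OF K(2) KB(2)])
  also note assms(3)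
  finally have fin: "emeasure M K \<noteq> \<infinity>" by simp
  then have "emeasure M (W - K) = emeasure M W - emeasure M K"
    by (rule emeasure_Diff[OF _ KB(2,1) K(2)])
  also have "\<dots> \<le> ennreal e"
    using less_imp_le[OF lt] fin by (simp add: ennreal_minus_le_iff add.commute)
  finally show ?thesis using K by blast
qed

text \<open>Regularity has to be checked only inside the members of an exhausting sequence. For outer regularity of
\<open>E\<close>, an open set is chosen for each \<open>V n\<close> with error \<open>e/2\<^sup>n\<^sup>+\<^sup>1\<close>, and the
traces of these open sets on the \<open>V n\<close> are united.\<close>

lemma moderateI:
  fixes M :: "'b::t2_space measure"
  assumes M: "sets M = sets borel"
    and V: "incseq V" "\<And>n. open (V n)" "\<And>n::nat. emeasure M (V n) < \<infinity>" "(\<Union>n. V n) = UNIV"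
    and inner: "\<And>W n e. open W \<Longrightarrow> W \<subseteq> V n \<Longrightarrow> (0::real) < e \<Longrightarrow>
      \<exists>K. compact K \<and> K \<subseteq> W \<and> emeasure M (W - K) \<le> ennreal e"
  shows "moderate M"
proof -
  note [measurable_cong, simp] = M
  have [measurable]: "V n \<in> sets borel" for n using V by auto
  have inc: "V m \<subseteq> V n" if "m \<le> n" for m n using V(1) that by (auto simp: incseq_def)
  have compact: "emeasure M K < \<infinity>" if "compact K" for K
  proof -
    have "\<exists>D. finite D \<and> K \<subseteq> (\<Union>n\<in>D. V n)"
    proof (rule compactE_image[OF \<open>compact K\<close>, of UNIV V])
      show "open (V n)" for n by (rule V(2))
      show "K \<subseteq> (\<Union>n\<in>UNIV. V n)" unfolding V(4) by (rule subset_UNIV)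
    qed (intro exI conjI)
    then obtain D where D: "finite D" "K \<subseteq> (\<Union>n\<in>D. V n)"
      by (elim exE conjE)
    have "V n \<subseteq> V (Max (insert 0 D))" if "n \<in> D" for n
      using D(1) that by (intro inc) auto
    then have "(\<Union>n\<in>D. V n) \<subseteq> V (Max (insert 0 D))" by (rule UN_least)
    with D(2) have "K \<subseteq> V (Max (insert 0 D))" by (rule subset_trans)
    then have "emeasure M K \<le> emeasure M (V (Max (insert 0 D)))"
      by (rule emeasure_mono) measurable
    then show ?thesis using V(3) by (rule le_less_trans)
  qed
  have outer: "emeasure M E = (INF U\<in>{U. open U \<and> E \<subseteq> U}. emeasure M U)"
    if E[measurable]: "E \<in> sets borel" for E
  proof (rule antisym)
    show "emeasure M E \<le> (INF U\<in>{U. open U \<and> E \<subseteq> U}. emeasure M U)"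
      by (intro INF_greatest emeasure_mono) auto
    have "(INF U\<in>{U. open U \<and> E \<subseteq> U}. emeasure M U) \<le> emeasure M E + ennreal e" if "0 < e" for e :: real
    proof -
      define d where "d n = e * (1/2) ^ Suc n" for n :: nat
      have d: "d n > 0" for n using that by (simp add: d_def)
      have "\<exists>U. open U \<and> E \<subseteq> U \<and> emeasure M (V n \<inter> (U - E)) \<le> ennreal (d n)" for n
      proof -
        have "\<exists>F U. closed F \<and> open U \<and> F \<subseteq> E \<and> E \<subseteq> U \<and> emeasure M (V n \<inter> (U - F)) \<le> ennreal (d n)"
          by (rule borel_closed_open_approx[OF M V(2) V(3) _ E d]) (rule inner)
        then obtain F U where FU: "closed F" "open U" "F \<subseteq> E" "E \<subseteq> U"
          "emeasure M (V n \<inter> (U - F)) \<le> ennreal (d n)"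
          by (elim exE conjE)
        have "emeasure M (V n \<inter> (U - E)) \<le> emeasure M (V n \<inter> (U - F))"
          using FU(1-3) by (intro emeasure_mono) (auto intro!: sets.Int sets.Diff)
        then have "emeasure M (V n \<inter> (U - E)) \<le> ennreal (d n)" using FU(5) by (rule order_trans)
        with FU(2,4) show ?thesis by (intro exI[of _ U] conjI)
      qed
      then obtain U where U: "\<And>n. open (U n)" "\<And>n. E \<subseteq> U n"
        "\<And>n. emeasure M (V n \<inter> (U n - E)) \<le> ennreal (d n)" by metis
      have [measurable]: "U n \<in> sets borel" for n using U by auto
      have "d sums e"
        unfolding d_def using sums_mult[OF power_half_series, of "e"] by simp
      then have dsum: "(\<Sum>n. ennreal (d n)) = ennreal e"
        using d by (intro suminf_ennreal_eq) (auto intro: less_imp_le)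
      let ?U = "\<Union>n. V n \<inter> U n"
      have "E \<subseteq> ?U"
      proof
        fix x assume "x \<in> E"
        moreover obtain n where "x \<in> V n" using V(4) by blast
        ultimately have "x \<in> V n \<inter> U n" using U(2)[of n] by blast
        then show "x \<in> ?U" by blast
      qed
      moreover have "open ?U" using U(1) V(2) by (intro open_UN open_Int ballI)
      ultimately have "(INF U\<in>{U. open U \<and> E \<subseteq> U}. emeasure M U) \<le> emeasure M ?U"
        by (intro INF_lower) auto
      also have "?U = E \<union> (\<Union>n. V n \<inter> (U n - E))"
      proof
        show "?U \<subseteq> E \<union> (\<Union>n. V n \<inter> (U n - E))" by blast
        have "(\<Union>n. V n \<inter> (U n - E)) \<subseteq> ?U" by blast
        with \<open>E \<subseteq> ?U\<close> show "E \<union> (\<Union>n. V n \<inter> (U n - E)) \<subseteq> ?U" by (rule Un_least)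
      qed
      also have "emeasure M \<dots> \<le> emeasure M E + emeasure M (\<Union>n. V n \<inter> (U n - E))"
        by (rule emeasure_subadditive) measurable
      also have "\<dots> \<le> emeasure M E + ennreal e"
      proof (rule add_left_mono)
        have "emeasure M (\<Union>n. V n \<inter> (U n - E)) \<le> (\<Sum>n. emeasure M (V n \<inter> (U n - E)))"
          by (rule emeasure_subadditive_countably) auto
        also have "\<dots> \<le> (\<Sum>n. ennreal (d n))" by (intro suminf_le U summableI)
        also note dsum
        finally show "emeasure M (\<Union>n. V n \<inter> (U n - E)) \<le> ennreal e" .
      qed
      finally show ?thesis .
    qed
    then show "(INF U\<in>{U. open U \<and> E \<subseteq> U}. emeasure M U) \<le> emeasure M E"
      by (rule ennreal_le_epsilon)
  qed
  have in_open: "emeasure M W = (SUP K\<in>{K. compact K \<and> K \<subseteq> W}. emeasure M K)" if oW: "open W" for W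
  proof (rule antisym)
    have [measurable]: "W \<in> sets borel" using oW by (rule borel_open)
    let ?S = "SUP K\<in>{K. compact K \<and> K \<subseteq> W}. emeasure M K"
    show "?S \<le> emeasure M W"
      by (rule SUP_least, rule emeasure_mono) auto
    have "emeasure M (W \<inter> V n) \<le> ?S" for n
    proof (rule ennreal_le_epsilon)
      fix e :: real assume "0 < e"
      with inner[OF open_Int[OF oW V(2)] Int_lower2]
      have "\<exists>K. compact K \<and> K \<subseteq> W \<inter> V n \<and> emeasure M (W \<inter> V n - K) \<le> ennreal e" .
      then obtain K where K: "compact K" "K \<subseteq> W \<inter> V n" "emeasure M (W \<inter> V n - K) \<le> ennreal e"
        by (elim exE conjE)
      have Km[measurable]: "K \<in> sets borel" using K(1) by (intro borel_closed compact_imp_closed)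
      have KW: "K \<union> (W \<inter> V n - K) = W \<inter> V n" using K(2) by blast
      have "emeasure M (K \<union> (W \<inter> V n - K)) \<le> emeasure M K + emeasure M (W \<inter> V n - K)"
        by (rule emeasure_subadditive) measurable
      then have "emeasure M (W \<inter> V n) \<le> emeasure M K + emeasure M (W \<inter> V n - K)"
        unfolding KW .
      also have "\<dots> \<le> ?S + ennreal e"
      proof (rule add_mono)
        show "emeasure M K \<le> ?S" using K(1,2) by (intro SUP_upper) simp
      qed (rule K(3))
      finally show "emeasure M (W \<inter> V n) \<le> ?S + ennreal e" .
    qed
    then have le: "(SUP n. emeasure M (W \<inter> V n)) \<le> ?S" by (rule SUP_least)
    have "(SUP n. emeasure M (W \<inter> V n)) = emeasure M (\<Union>n. W \<inter> V n)"
    proof (rule SUP_emeasure_incseq)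
      show "range (\<lambda>n. W \<inter> V n) \<subseteq> sets M" by auto
      show "incseq (\<lambda>n. W \<inter> V n)"
        unfolding incseq_def using inc by (intro allI impI Int_mono subset_refl)
    qed
    moreover have "(\<Union>n. W \<inter> V n) = W" unfolding Int_UN_distrib[symmetric] V(4) by (rule Int_UNIV_right)
    ultimately show "emeasure M W \<le> ?S" using le by simp
  qed
  show ?thesis
    unfolding moderate_def
  proof
    show "radon M" unfolding radon_def using M compact outer in_open by (intro conjI allI impI ballI)
    show "\<exists>V::nat \<Rightarrow> 'b set. incseq V \<and> (\<forall>n. open (V n) \<and> emeasure M (V n) < \<infinity>) \<and> (\<Union>n. V n) = UNIV"
      using V by (intro exI[of _ V]) simp
  qed
qed

lemma radon_eqI:
  assumes "radon M" "radon N" "\<And>U. open U \<Longrightarrow> emeasure M U = emeasure N U"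
  shows "M = N"
proof (rule measure_eqI)
  show "sets M = sets N" using assms by simp
  fix E assume "E \<in> sets M"
  then have E: "E \<in> sets borel" using assms by simp
  have "emeasure M E = (INF U\<in>{U. open U \<and> E \<subseteq> U}. emeasure M U)"
    by (rule radon_outer[OF assms(1) E])
  also have "\<dots> = (INF U\<in>{U. open U \<and> E \<subseteq> U}. emeasure N U)"
    using assms by (intro INF_cong) auto
  also have "\<dots> = emeasure N E" by (rule radon_outer[OF assms(2) E, symmetric])
  finally show "emeasure M E = emeasure N E" .
qed

lemma radon_eqI_compact:
  assumes "radon M" "radon N" "\<And>K. compact K \<Longrightarrow> emeasure M K = emeasure N K"
  shows "M = N"
proof (rule radon_eqI[OF assms(1,2)])
  fix U :: "'a set" assume "open U"
  have "emeasure M U = (SUP K\<in>{K. compact K \<and> K \<subseteq> U}. emeasure M K)"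
    by (rule radon_inner[OF assms(1) \<open>open U\<close>])
  also have "\<dots> = (SUP K\<in>{K. compact K \<and> K \<subseteq> U}. emeasure N K)"
    using assms by (intro SUP_cong) auto
  also have "\<dots> = emeasure N U" by (rule radon_inner[OF assms(2) \<open>open U\<close>, symmetric])
  finally show "emeasure M U = emeasure N U" .
qed

lemma moderate_finite:
  assumes "radon M" "emeasure M UNIV < \<infinity>"
  shows "moderate M"
  unfolding moderate_def using assms
  by (intro conjI exI[of _ "\<lambda>_. UNIV"]) (auto simp: incseq_def)

text \<open>A compact set that exhausts an open set up to \<open>e\<close> with respect to \<open>M\<close> does so with respect to every
smaller measure.\<close>

lemma moderate_submeasure:
  fixes M Q :: "'b::t2_space measure"
  assumes M: "moderate M" and Q: "sets Q = sets borel"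
    and le: "\<And>E. E \<in> sets borel \<Longrightarrow> emeasure Q E \<le> emeasure M E"
  shows "moderate Q"
proof -
  obtain V :: "nat \<Rightarrow> 'b set" where V: "incseq V" "\<And>n. open (V n)" "\<And>n. emeasure M (V n) < \<infinity>" "(\<Union>n. V n) = UNIV"
    by (rule moderateE[OF M]) auto
  show ?thesis
  proof (rule moderateI[OF Q V(1,2) _ V(4)])
    show "emeasure Q (V n) < \<infinity>" for n using le[OF borel_open[OF V(2)]] V(3) by (rule le_less_trans)
    fix W n and e :: real assume W: "open W" "W \<subseteq> V n" "0 < e"
    have "emeasure M W \<le> emeasure M (V n)" using W V M by (intro emeasure_mono) auto
    then have "emeasure M W < \<infinity>" using V(3) by (rule le_less_trans)
    with radon_inner_approx[OF moderate_radon[OF M] W(1) _ W(3)]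
    obtain K where K: "compact K" "K \<subseteq> W" "emeasure M (W - K) \<le> ennreal e"
      by (elim meta_impE exE conjE)
    have "emeasure Q (W - K) \<le> emeasure M (W - K)"
      using W K by (intro le sets.Diff) (auto simp: compact_imp_closed)
    then have "emeasure Q (W - K) \<le> ennreal e" using K(3) by (rule order_trans)
    with K(1,2) show "\<exists>K. compact K \<and> K \<subseteq> W \<and> emeasure Q (W - K) \<le> ennreal e"
      by (intro exI[of _ K] conjI)
  qed
qed

text \<open>The combinations with nonnegative coefficients; \<open>ennreal\<close> cuts a negative coefficient off to zero.\<close>

definition lincomb :: "'j set \<Rightarrow> ('j \<Rightarrow> real) \<Rightarrow> ('j \<Rightarrow> 'a::topological_space measure) \<Rightarrow> 'a measure" where
  "lincomb J c m = measure_of UNIV (sets borel) (\<lambda>E. \<Sum>j\<in>J. ennreal (c j) * emeasure (m j) E)"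

lemma sets_lincomb [simp, measurable_cong]: "sets (lincomb J c m) = sets borel"
  unfolding lincomb_def using sets.sets_measure_of_eq[of borel] by simp

lemma emeasure_lincomb:
  fixes m :: "'j \<Rightarrow> 'a::topological_space measure"
  assumes m: "\<And>j. j \<in> J \<Longrightarrow> sets (m j) = sets borel" and E: "E \<in> sets borel"
  shows "emeasure (lincomb J c m) E = (\<Sum>j\<in>J. ennreal (c j) * emeasure (m j) E)"
proof (rule emeasure_measure_of[OF lincomb_def])
  show "sets borel \<subseteq> Pow UNIV" by simp
  show "E \<in> sets (lincomb J c m)" using E by simp
  show "positive (sets (lincomb J c m)) (\<lambda>E. \<Sum>j\<in>J. ennreal (c j) * emeasure (m j) E)"
    by (simp add: positive_def)
  show "countably_additive (sets (lincomb J c m)) (\<lambda>E. \<Sum>j\<in>J. ennreal (c j) * emeasure (m j) E)"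
  proof (rule countably_additiveI)
    fix F :: "nat \<Rightarrow> 'a set" assume F: "range F \<subseteq> sets (lincomb J c m)" "disjoint_family F"
    have "(\<Sum>n. \<Sum>j\<in>J. ennreal (c j) * emeasure (m j) (F n))
        = (\<Sum>j\<in>J. \<Sum>n. ennreal (c j) * emeasure (m j) (F n))"
      by (intro suminf_sum summableI)
    also have "\<dots> = (\<Sum>j\<in>J. ennreal (c j) * emeasure (m j) (\<Union>n. F n))"
    proof (rule sum.cong[OF refl])
      fix j assume "j \<in> J"
      then have "(\<Sum>n. emeasure (m j) (F n)) = emeasure (m j) (\<Union>n. F n)"
        using F m by (intro suminf_emeasure) auto
      then show "(\<Sum>n. ennreal (c j) * emeasure (m j) (F n)) = ennreal (c j) * emeasure (m j) (\<Union>n. F n)"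
        using ennreal_suminf_cmult[of "ennreal (c j)" "\<lambda>n. emeasure (m j) (F n)"] by simp
    qed
    finally show "(\<Sum>n. \<Sum>j\<in>J. ennreal (c j) * emeasure (m j) (F n))
        = (\<Sum>j\<in>J. ennreal (c j) * emeasure (m j) (\<Union>n. F n))" .
  qed
qed

lemma emeasure_lincomb_pair:
  assumes "sets P = sets borel" "sets C = sets borel" "E \<in> sets borel"
  shows "emeasure (lincomb UNIV (\<lambda>_. 1) (\<lambda>b. if b then P else C)) E = emeasure P E + emeasure C E"
  using assms by (subst emeasure_lincomb) (auto simp: UNIV_bool add.commute)

lemma nn_integral_lincomb:
  assumes m: "\<And>j. j \<in> J \<Longrightarrow> sets (m j) = sets borel" and f: "f \<in> borel_measurable borel"
  shows "(\<integral>\<^sup>+x. f x \<partial>lincomb J c m) = (\<Sum>j\<in>J. ennreal (c j) * (\<integral>\<^sup>+x. f x \<partial>m j))"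
proof -
  have mj: "g \<in> borel_measurable (m j)" if "g \<in> borel_measurable borel" "j \<in> J" for g :: "_ \<Rightarrow> ennreal" and j
    using that(1) measurable_cong_sets[OF m[OF that(2)] refl] by blast
  have ml: "g \<in> borel_measurable (lincomb J c m)" if "g \<in> borel_measurable borel" for g :: "_ \<Rightarrow> ennreal"
    using that measurable_cong_sets[OF sets_lincomb refl] by blast
  show ?thesis
    using f
  proof (induction rule: borel_measurable_induct)
    case (cong f g)
    then have "f = g" by (simp add: fun_eq_iff)
    then show ?case using cong.IH by simp
  next
    case (set A)
    have "(\<Sum>j\<in>J. ennreal (c j) * (\<integral>\<^sup>+x. indicator A x \<partial>m j)) = (\<Sum>j\<in>J. ennreal (c j) * emeasure (m j) A)"
      using set m by (intro sum.cong) auto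
    moreover have "(\<integral>\<^sup>+x. indicator A x \<partial>lincomb J c m) = emeasure (lincomb J c m) A"
      using set by (intro nn_integral_indicator) simp
    ultimately show ?case using emeasure_lincomb[OF m set] by simp
  next
    case (mult u v)
    have "(\<Sum>j\<in>J. ennreal (c j) * (\<integral>\<^sup>+x. v * u x \<partial>m j)) = (\<Sum>j\<in>J. v * (ennreal (c j) * (\<integral>\<^sup>+x. u x \<partial>m j)))"
      using mj[OF mult(2)] by (intro sum.cong refl) (simp add: nn_integral_cmult mult.left_commute)
    then show ?case
      using mult.IH by (simp add: nn_integral_cmult[OF ml[OF mult(2)]] sum_distrib_left)
  next
    case (add u v)
    have "(\<Sum>j\<in>J. ennreal (c j) * (\<integral>\<^sup>+x. v x + u x \<partial>m j))
        = (\<Sum>j\<in>J. ennreal (c j) * (\<integral>\<^sup>+x. v x \<partial>m j) + ennreal (c j) * (\<integral>\<^sup>+x. u x \<partial>m j))"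
      using mj[OF add(1)] mj[OF add(3)] by (intro sum.cong refl) (simp add: nn_integral_add distrib_left)
    then show ?case
      using add.IH by (simp add: nn_integral_add[OF ml[OF add(3)] ml[OF add(1)]] sum.distrib)
  next
    case (seq U)
    have inc: "incseq U" by (rule seq(3))
    have "(\<Sum>j\<in>J. ennreal (c j) * (\<integral>\<^sup>+x. (SUP i. U i x) \<partial>m j)) = (\<Sum>j\<in>J. SUP i. ennreal (c j) * (\<integral>\<^sup>+x. U i x \<partial>m j))"
      using nn_integral_monotone_convergence_SUP[OF inc mj[OF seq(1)]]
      by (intro sum.cong refl) (simp add: SUP_mult_left_ennreal)
    also have "\<dots> = (SUP i. \<Sum>j\<in>J. ennreal (c j) * (\<integral>\<^sup>+x. U i x \<partial>m j))"
    proof (rule ennreal_SUP_sum[symmetric])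
      show "incseq (\<lambda>i. ennreal (c j) * (\<integral>\<^sup>+x. U i x \<partial>m j))" for j
        using inc by (intro incseq_SucI mult_left_mono nn_integral_mono) (auto simp: incseq_Suc_iff le_fun_def)
    qed
    finally show ?case
      using nn_integral_monotone_convergence_SUP[OF inc ml[OF seq(1)]] seq.IH
      by (simp add: SUP_apply image_comp)
  qed
qed

lemma moderate_lincomb:
  fixes m :: "'j \<Rightarrow> 'b::t2_space measure"
  assumes J: "finite J" and m: "\<And>j. j \<in> J \<Longrightarrow> moderate (m j)" 
  shows "moderate (lincomb J c m)"
proof -
  have "\<forall>j\<in>J. \<exists>V::nat \<Rightarrow> 'b set. incseq V \<and> (\<forall>n. open (V n) \<and> emeasure (m j) (V n) < \<infinity>) \<and> (\<Union>n. V n) = UNIV"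
    using m by (auto simp: moderate_def)
  then obtain V :: "'j \<Rightarrow> nat \<Rightarrow> 'b set" where V: "\<And>j. j \<in> J \<Longrightarrow> incseq (V j)"
    "\<And>j n. j \<in> J \<Longrightarrow> open (V j n)"
    "\<And>j n. j \<in> J \<Longrightarrow> emeasure (m j) (V j n) < \<infinity>"
    "\<And>j. j \<in> J \<Longrightarrow> (\<Union>n. V j n) = UNIV" by metis
  define O' where "O' n = (\<Inter>j\<in>J. V j n)" for n
  have O: "open (O' n)" for n using V J by (auto simp: O'_def)
  have fin: "emeasure (m j) W < \<infinity>" if "j \<in> J" "W \<subseteq> O' n" "open W" for j n W
  proof -
    have "emeasure (m j) W \<le> emeasure (m j) (V j n)"
      using that V m O by (intro emeasure_mono) (auto simp: O'_def)
    then show ?thesis using V(3)[OF that(1)] by (rule le_less_trans)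
  qed
  have sets: "sets (m j) = sets borel" if "j \<in> J" for j using m[OF that] by simp
  show ?thesis
  proof (rule moderateI)
    show "incseq O'"
    proof (rule incseq_SucI)
      show "O' n \<subseteq> O' (Suc n)" for n
        unfolding O'_def using incseq_SucD[OF V(1)] by (intro INT_anti_mono subset_refl)
    qed
    show "open (O' n)" for n by (rule O)
    show "(\<Union>n. O' n) = UNIV"
    proof -
      have "\<exists>n. x \<in> O' n" for x
      proof -
        have "\<exists>n. x \<in> V j n" if "j \<in> J" for j
          using V(4)[OF that] UNIV_I[of x] by (metis UN_E)
        then obtain N where N: "\<And>j. j \<in> J \<Longrightarrow> x \<in> V j (N j)" by metis
        have "x \<in> V j (Max (N ` J))" if "j \<in> J" for j
        proof -
          have "V j (N j) \<subseteq> V j (Max (N ` J))"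
            using V(1)[OF that] J that by (auto simp: incseq_def)
          then show ?thesis using N[OF that] by blast
        qed
        then show ?thesis by (auto simp: O'_def)
      qed
      then show ?thesis by blast
    qed
    show "emeasure (lincomb J c m) (O' n) < \<infinity>" for n
      using fin[of _ "O' n" n] O J by (subst emeasure_lincomb[OF sets])
        (auto simp: ennreal_mult_less_top less_top[symmetric] ennreal_mult_eq_top_iff)
    fix W n and e :: real assume W: "open W" "W \<subseteq> O' n" "0 < e"
    \<comment> \<open>The summands \<open>1\<close> keep the denominator positive for vanishing coefficients and for empty \<open>J\<close>.\<close>
    define d where "d j = e / ((\<bar>c j\<bar> + 1) * (real (card J) + 1))" for j
    have d: "d j > 0" for j using W by (auto simp: d_def intro!: divide_pos_pos mult_pos_pos)
    have "\<exists>K. compact K \<and> K \<subseteq> W \<and> emeasure (m j) (W - K) \<le> ennreal (d j)" if "j \<in> J" for j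
      by (rule radon_inner_approx[OF moderate_radon[OF m[OF that]] W(1) fin[OF that W(2,1)] d])
    then obtain K where K: "\<And>j. j \<in> J \<Longrightarrow> compact (K j)" "\<And>j. j \<in> J \<Longrightarrow> K j \<subseteq> W"
      "\<And>j. j \<in> J \<Longrightarrow> emeasure (m j) (W - K j) \<le> ennreal (d j)" by metis
    let ?K = "\<Union>j\<in>J. K j"
    have cK: "compact ?K" using K J by (intro compact_UN) auto
    then have B: "W - ?K \<in> sets borel" using W by (auto simp: compact_imp_closed)
    have "emeasure (lincomb J c m) (W - ?K) = (\<Sum>j\<in>J. ennreal (c j) * emeasure (m j) (W - ?K))"
      by (rule emeasure_lincomb[OF sets B])
    also have "\<dots> \<le> (\<Sum>j\<in>J. ennreal (e / (real (card J) + 1)))"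
    proof (rule sum_mono)
      fix j assume j: "j \<in> J"
      have "emeasure (m j) (W - ?K) \<le> emeasure (m j) (W - K j)"
        using j sets[OF j] W K(1)[OF j] by (intro emeasure_mono) (auto simp: compact_imp_closed)
      also have "\<dots> \<le> ennreal (d j)" using K j by auto
      finally have "ennreal (c j) * emeasure (m j) (W - ?K) \<le> ennreal (\<bar>c j\<bar> + 1) * ennreal (d j)"
        by (intro mult_mono ennreal_leI) auto
      also have "\<dots> = ennreal ((\<bar>c j\<bar> + 1) * d j)" using d[of j] by (simp add: ennreal_mult)
      also have "(\<bar>c j\<bar> + 1) * d j = e / (real (card J) + 1)"
        by (simp add: d_def)
      finally show "ennreal (c j) * emeasure (m j) (W - ?K) \<le> ennreal (e / (real (card J) + 1))" .
    qed
    also have "\<dots> = ennreal (real (card J) * (e / (real (card J) + 1)))"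
      using W(3) by (subst ennreal_mult) (auto simp: ennreal_of_nat_eq_real_of_nat)
    also have "\<dots> \<le> ennreal e"
      using W(3) by (intro ennreal_leI) (auto simp: field_simps)
    finally show "\<exists>K. compact K \<and> K \<subseteq> W \<and> emeasure (lincomb J c m) (W - K) \<le> ennreal e"
      using cK K by (intro exI[of _ ?K]) auto
  qed simp
qed

lemma sigma_finite_moderate:
  assumes "moderate M"
  shows "sigma_finite_measure M"
proof -
  obtain V :: "nat \<Rightarrow> 'a set" where V: "incseq V" "\<And>n. open (V n)" "\<And>n. emeasure M (V n) < \<infinity>" "(\<Union>n. V n) = UNIV"
    by (rule moderateE[OF assms]) auto
  show ?thesis
    using V assms by (intro sigma_finite_measure.intro exI[of _ "range V"]) (auto simp: less_top)
qed

text \<open>Let \<open>f\<close> and \<open>h\<close> be the densities of \<open>M\<close> and \<open>N\<close> with respect to \<open>M + N\<close>. The common part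
\<open>C\<close> has the density \<open>min f h\<close>, and \<open>B = {x. f x \<le> h x}\<close> separates the remainders
\<open>P = M - C\<close> and \<open>Q = N - C\<close>.\<close>

lemma moderate_Jordan:
  fixes M N :: "'b::t2_space measure"
  assumes M: "moderate M" and N: "moderate N"
  obtains P Q C B where "moderate P" "moderate Q" "moderate C" "B \<in> sets borel"
    "emeasure P B = 0" "emeasure Q (- B) = 0"
    "\<And>E. E \<in> sets borel \<Longrightarrow> emeasure M E = emeasure P E + emeasure C E"
    "\<And>E. E \<in> sets borel \<Longrightarrow> emeasure N E = emeasure Q E + emeasure C E"
proof -
  define S where "S = lincomb UNIV (\<lambda>_. 1) (\<lambda>b. if b then M else N)"
  have S: "moderate S" unfolding S_def using M N by (intro moderate_lincomb) auto
  have eS: "emeasure S E = emeasure M E + emeasure N E" if "E \<in> sets borel" for E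
    unfolding S_def using M N that by (intro emeasure_lincomb_pair) auto
  interpret sigma_finite_measure S by (rule sigma_finite_moderate[OF S])
  have [measurable_cong, simp]: "sets S = sets borel" using S by simp
  have "absolutely_continuous S M" "absolutely_continuous S N"
    unfolding absolutely_continuous_def null_sets_def using M N eS by auto
  then obtain f h where f[measurable]: "f \<in> borel_measurable S" "density S f = M"
    and h[measurable]: "h \<in> borel_measurable S" "density S h = N"
    using Radon_Nikodym[of M] Radon_Nikodym[of N] M N by auto
  have [measurable]: "f \<in> borel_measurable borel" "h \<in> borel_measurable borel"
    using f(1) h(1) by simp_all
  \<comment> \<open>The case distinction makes \<open>p\<close> and \<open>q\<close> vanish on their sides of \<open>B\<close> even where both densities are infinite.\<close>
  define p where "p x = (if f x \<le> h x then 0 else f x - h x)" for x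
  define q where "q x = (if f x \<le> h x then h x - f x else 0)" for x
  define c where "c x = min (f x) (h x)" for x
  have [measurable]: "p \<in> borel_measurable borel" "q \<in> borel_measurable borel" "c \<in> borel_measurable borel"
    unfolding p_def q_def c_def by measurable
  have pc: "p x + c x = f x" and qc: "q x + c x = h x" for x
    by (auto simp: p_def q_def c_def min_def diff_add_cancel_ennreal)
  have split: "emeasure (density S g) E = emeasure (density S u) E + emeasure (density S v) E"
    if "\<And>x. u x + v x = g x" "u \<in> borel_measurable borel" "v \<in> borel_measurable borel" "E \<in> sets borel"
    for g u v E
  proof -
    have g: "g = (\<lambda>x. u x + v x)" using that by auto
    show ?thesis using that(2-4) unfolding g
      by (simp add: emeasure_density distrib_right nn_integral_add)
  qed
  have M': "emeasure M E = emeasure (density S p) E + emeasure (density S c) E" if "E \<in> sets borel" for E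
    using split[of p c f E, OF pc] that f by simp
  have N': "emeasure N E = emeasure (density S q) E + emeasure (density S c) E" if "E \<in> sets borel" for E
    using split[of q c h E, OF qc] that h by simp
  define B where "B = {x. f x \<le> h x}"
  have B[measurable]: "B \<in> sets borel" unfolding B_def by measurable
  show ?thesis
  proof (rule that[of "density S p" "density S q" "density S c" B])
    show "moderate (density S p)" using M' by (intro moderate_submeasure[OF M]) auto
    show "moderate (density S c)" using M' by (intro moderate_submeasure[OF M]) auto
    show "moderate (density S q)" using N' by (intro moderate_submeasure[OF N]) auto
    show "B \<in> sets borel" by (rule B)
    show "emeasure (density S p) B = 0"
      by (simp add: emeasure_density nn_integral_0_iff_AE B_def p_def)
    show "emeasure (density S q) (- B) = 0"
      by (simp add: emeasure_density nn_integral_0_iff_AE B_def q_def)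
  qed (use M' N' in blast)+
qed

text \<open>On a compact set all measures are finite, so the two equations give \<open>P + Q' = P' + Q\<close> there. Outside the
separating set \<open>B\<close> the measure \<open>Q\<close> vanishes, whence \<open>P \<le> P + Q' = P'\<close>, and \<open>P\<close> is
concentrated there; dually for \<open>Q\<close> on \<open>B\<close>.\<close>

lemma signed_radon_unique:
  assumes PQ: "(P, Q) \<in> signed_radon" "(P', Q') \<in> signed_radon"
    and M: "radon M" and N: "radon N"
    and eq: "\<And>E. E \<in> sets borel \<Longrightarrow> emeasure P E + emeasure N E = emeasure Q E + emeasure M E"
      "\<And>E. E \<in> sets borel \<Longrightarrow> emeasure P' E + emeasure N E = emeasure Q' E + emeasure M E"
    and K: "compact (K :: 'b::t2_space set)"
  shows "emeasure P K \<le> emeasure P' K" "emeasure Q K \<le> emeasure Q' K"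
proof -
  have r: "radon P" "radon Q" "radon P'" "radon Q'" using PQ by (auto simp: signed_radon_def)
  obtain B where Bm[measurable]: "B \<in> sets borel" and B: "emeasure P (K \<inter> B) = 0" "emeasure Q (K - B) = 0"
    using PQ K by (auto simp: signed_radon_def)
  have KB[measurable]: "K \<in> sets borel" using K by (auto simp: compact_imp_closed)
  have fin: "emeasure R E < \<infinity>" if "radon R" "E \<subseteq> K" "E \<in> sets borel" for R E
  proof -
    have "emeasure R E \<le> emeasure R K" using that by (intro emeasure_mono) auto
    also have "\<dots> < \<infinity>" using that K by (intro radon_compact_finite)
    finally show ?thesis .
  qed
  have cross: "emeasure P E + emeasure Q' E = emeasure P' E + emeasure Q E"
    if "E \<subseteq> K" "E \<in> sets borel" for E
  proof -
    have "(emeasure P E + emeasure Q' E) + (emeasure N E + emeasure M E)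
        = (emeasure P E + emeasure N E) + (emeasure Q' E + emeasure M E)" by (simp only: ac_simps)
    also have "\<dots> = (emeasure Q E + emeasure M E) + (emeasure P' E + emeasure N E)"
      by (simp only: eq[OF that(2)])
    also have "\<dots> = (emeasure P' E + emeasure Q E) + (emeasure N E + emeasure M E)"
      by (simp only: ac_simps)
    finally have "(emeasure N E + emeasure M E) + (emeasure P E + emeasure Q' E)
        = (emeasure N E + emeasure M E) + (emeasure P' E + emeasure Q E)"
      by (simp only: add.commute)
    moreover have "emeasure N E + emeasure M E \<noteq> \<infinity>"
      using fin[OF M that] fin[OF N that] by auto
    ultimately show ?thesis by (simp only: ennreal_add_left_cancel) simp
  qed
  have split: "emeasure R K = emeasure R (K \<inter> B) + emeasure R (K - B)" if "radon R" for R
  proof -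
    have "emeasure R (K \<inter> B) + emeasure R (K - B) = emeasure R (K \<inter> B \<union> (K - B))"
      using radon_sets[OF that] sets.Int[OF KB Bm] sets.Diff[OF KB Bm]
      by (intro plus_emeasure) (simp_all only:, blast)
    then show ?thesis by (simp only: Int_Diff_Un)
  qed
  have mono: "emeasure R (K \<inter> B) \<le> emeasure R K" "emeasure R (K - B) \<le> emeasure R K" if "radon R" for R
    using radon_sets[OF that] KB by (simp_all only: emeasure_mono Int_lower1 Diff_subset)
  have "emeasure P K = emeasure P (K - B)"
    using split[OF r(1)] by (simp only: B add_0_left)
  also have "\<dots> \<le> emeasure P (K - B) + emeasure Q' (K - B)" by (rule add_increasing2) simp_all
  also have "\<dots> = emeasure P' (K - B)"
    using cross[OF _ sets.Diff[OF KB Bm]] by (simp only: B add_0_right Diff_subset)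
  also have "\<dots> \<le> emeasure P' K" by (rule mono[OF r(3)])
  finally show "emeasure P K \<le> emeasure P' K" .
  have "emeasure Q K = emeasure Q (K \<inter> B)"
    using split[OF r(2)] by (simp only: B add_0_right)
  also have "\<dots> \<le> emeasure P' (K \<inter> B) + emeasure Q (K \<inter> B)" by (rule add_increasing) simp_all
  also have "\<dots> = emeasure Q' (K \<inter> B)"
    using cross[OF _ sets.Int[OF KB Bm]] by (simp only: B add_0_left Int_lower1)
  also have "\<dots> \<le> emeasure Q' K" by (rule mono[OF r(4)])
  finally show "emeasure Q K \<le> emeasure Q' K" .
qed

text \<open>The pair \<open>radon_diff M N\<close> as the singular part of a splitting \<open>M = P + C\<close>, \<open>N = Q + C\<close>, the form in
which energies of signed measures are reduced to those of positive ones.\<close>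

lemma radon_diff_Jordan:
  fixes M N :: "'b::t2_space measure"
  assumes M: "moderate M" and N: "moderate N"
  obtains P Q C where "radon_diff M N = (P, Q)" "(P, Q) \<in> signed_radon"
    "moderate P" "moderate Q" "moderate C"
    "M = lincomb UNIV (\<lambda>_. 1) (\<lambda>b. if b then P else C)"
    "N = lincomb UNIV (\<lambda>_. 1) (\<lambda>b. if b then Q else C)"
proof -
  obtain P Q C B where *: "moderate P" "moderate Q" "moderate C" "B \<in> sets borel"
    "emeasure P B = 0" "emeasure Q (- B) = 0"
    "\<And>E. E \<in> sets borel \<Longrightarrow> emeasure M E = emeasure P E + emeasure C E"
    "\<And>E. E \<in> sets borel \<Longrightarrow> emeasure N E = emeasure Q E + emeasure C E"
    using moderate_Jordan[OF M N] by metis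
  have sr: "(P, Q) \<in> signed_radon"
  proof -
    have "emeasure P (K \<inter> B) = 0 \<and> emeasure Q (K - B) = 0" if "compact K" for K
    proof
      have "emeasure P (K \<inter> B) \<le> emeasure P B" using * by (intro emeasure_mono) auto
      then show "emeasure P (K \<inter> B) = 0" using * by simp
      have "emeasure Q (K - B) \<le> emeasure Q (- B)" using * by (intro emeasure_mono) auto
      then show "emeasure Q (K - B) = 0" using * by simp
    qed
    then show ?thesis unfolding signed_radon_def using * by auto
  qed
  have eq: "emeasure P E + emeasure N E = emeasure Q E + emeasure M E" if "E \<in> sets borel" for E
    using *(7,8)[OF that] by (simp add: ac_simps)
  have "radon_diff M N = (P, Q)"
    unfolding radon_diff_def
  proof (rule the_equality)
    fix \<nu> :: "'b measure \<times> 'b measure"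
    assume \<nu>: "\<nu> \<in> signed_radon \<and> (\<forall>E\<in>sets borel.
           emeasure (fst \<nu>) E + emeasure N E = emeasure (snd \<nu>) E + emeasure M E)"
    obtain P' Q' where [simp]: "\<nu> = (P', Q')" by (cases \<nu>)
    have sr': "(P', Q') \<in> signed_radon" using \<nu> by simp
    have eq': "emeasure P' E + emeasure N E = emeasure Q' E + emeasure M E" if "E \<in> sets borel" for E
      using \<nu> that by (simp only: \<open>\<nu> = (P', Q')\<close> fst_conv snd_conv)
    note u1 = signed_radon_unique[OF sr sr' moderate_radon[OF M] moderate_radon[OF N] eq eq']
    note u2 = signed_radon_unique[OF sr' sr moderate_radon[OF M] moderate_radon[OF N] eq' eq]
    have r: "radon P'" "radon Q'" using sr' by (auto simp: signed_radon_def)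
    have "P' = P"
      using u1(1) u2(1) by (intro radon_eqI_compact r moderate_radon * antisym)
    moreover have "Q' = Q"
      using u1(2) u2(2) by (intro radon_eqI_compact r moderate_radon * antisym)
    ultimately show "\<nu> = (P, Q)" by simp
  next
    show "(P, Q) \<in> signed_radon \<and> (\<forall>E\<in>sets borel.
           emeasure (fst (P, Q)) E + emeasure N E = emeasure (snd (P, Q)) E + emeasure M E)"
      by (intro conjI ballI) (simp_all only: fst_conv snd_conv sr eq)
  qed
  moreover have "M = lincomb UNIV (\<lambda>_. 1) (\<lambda>b. if b then P else C)"
  proof (rule measure_eqI)
    fix E assume "E \<in> sets M"
    then have "E \<in> sets borel" using M by simp
    then show "emeasure M E = emeasure (lincomb UNIV (\<lambda>_. 1) (\<lambda>b. if b then P else C)) E"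
      using emeasure_lincomb_pair[of P C E] * by simp
  qed (use M in simp)
  moreover have "N = lincomb UNIV (\<lambda>_. 1) (\<lambda>b. if b then Q else C)"
  proof (rule measure_eqI)
    fix E assume "E \<in> sets N"
    then have "E \<in> sets borel" using N by simp
    then show "emeasure N E = emeasure (lincomb UNIV (\<lambda>_. 1) (\<lambda>b. if b then Q else C)) E"
      using emeasure_lincomb_pair[of Q C E] * by simp
  qed (use N in simp)
  ultimately show ?thesis using that * sr by blast
qed

section \<open>Products of moderate Radon measures\<close>

lemma open_Pair_vimage:
  fixes W :: "('a::topological_space \<times> 'b::topological_space) set"
  shows "open W \<Longrightarrow> open (Pair x -` W)"
  by (intro open_vimage continuous_intros)

lemma measurable_Pair_borel: "Pair x \<in> borel \<rightarrow>\<^sub>M borel"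
  by (intro borel_measurable_continuous_onI continuous_intros)

lemma sets_Pair_vimage: "E \<in> sets borel \<Longrightarrow> Pair x -` E \<in> sets borel"
  using measurable_sets[OF measurable_Pair_borel[of x], of E] by simp

text \<open>A slice with measure above \<open>c\<close> contains a compact set with measure above \<open>c\<close>, and by the tube lemma the
neighbouring slices contain the same compact set.\<close>

lemma open_slice_less:
  fixes W :: "('a::t2_space \<times> 'b::t2_space) set"
  assumes N: "radon N" and W: "open W"
  shows "open {x. c < emeasure N (Pair x -` W)}"
proof (subst open_subopen, intro ballI)
  fix x0 assume "x0 \<in> {x. c < emeasure N (Pair x -` W)}"
  then have "c < emeasure N (Pair x0 -` W)" by simp
  also have "emeasure N (Pair x0 -` W) = (SUP K\<in>{K. compact K \<and> K \<subseteq> Pair x0 -` W}. emeasure N K)"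
    by (rule radon_inner[OF N open_Pair_vimage[OF W]])
  finally obtain K where K: "compact K" "K \<subseteq> Pair x0 -` W" "c < emeasure N K"
    by (auto simp: less_SUP_iff)
  have "{x0} \<times> K \<subseteq> W" using K(2) by auto
  then have "\<exists>X. x0 \<in> X \<and> open X \<and> X \<times> K \<subseteq> W"
    by (rule Elementary_Topology.tube_lemma[OF K(1) W])
  then obtain X where X: "x0 \<in> X" "open X" "X \<times> K \<subseteq> W"
    by (elim exE conjE)
  have "X \<subseteq> {x. c < emeasure N (Pair x -` W)}"
  proof
    fix x assume "x \<in> X"
    then have KW: "K \<subseteq> Pair x -` W" using X(3) by auto
    have "Pair x -` W \<in> sets N"
      unfolding radon_sets[OF N] by (rule borel_open[OF open_Pair_vimage[OF W]])
    with KW have "emeasure N K \<le> emeasure N (Pair x -` W)" by (rule emeasure_mono)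
    with K(3) show "x \<in> {x. c < emeasure N (Pair x -` W)}" by simp
  qed
  with X(1,2) show "\<exists>T. open T \<and> x0 \<in> T \<and> T \<subseteq> {x. c < emeasure N (Pair x -` W)}"
    by (intro exI[of _ X] conjI)
qed

text \<open>Lower semicontinuity settles open sets. Complements require finite measure, so Dynkin's argument is run inside
each open set \<open>V n\<close> of an exhausting sequence.\<close>

lemma borel_measurable_slice:
  fixes E :: "('a::t2_space \<times> 'b::t2_space) set"
  assumes N: "moderate N" and E: "E \<in> sets borel"
  shows "(\<lambda>x. emeasure N (Pair x -` E)) \<in> borel_measurable borel"
proof -
  have sN: "sets N = sets borel" using N by (rule moderate_sets)
  have slice: "(\<lambda>x. emeasure N (Pair x -` E \<inter> V)) \<in> borel_measurable borel"
    if V: "open V" "emeasure N V < \<infinity>" for V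
  proof -
    let ?G = "{W :: ('a \<times> 'b) set. open W}"
    have int: "Int_stable ?G" "?G \<subseteq> Pow UNIV" by (auto simp: Int_stable_def)
    have VB: "V \<in> sets N" unfolding sN using V(1) by (rule borel_open)
    have FB: "Pair x -` F \<inter> V \<in> sets N" if "F \<in> sets borel" for F :: "('a \<times> 'b) set" and x
      using sets_Pair_vimage[OF that, of x] VB unfolding sN by (rule sets.Int)
    have "E \<in> sigma_sets UNIV ?G" using E by (simp add: borel_def)
    with int show ?thesis
    proof (induction rule: sigma_sets_induct_disjoint)
      case (basic W)
      then have "open W" by simp
      then have o: "open (W \<inter> UNIV \<times> V)" using V(1) by (intro open_Int open_Times open_UNIV)
      have eq: "Pair x -` (W \<inter> UNIV \<times> V) = Pair x -` W \<inter> V" for x by auto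
      have "open {x. c < emeasure N (Pair x -` W \<inter> V)}" for c
        using open_slice_less[OF moderate_radon[OF N] o, of c] unfolding eq .
      then show ?case by (intro borel_measurableI_greater) simp
    next
      case empty
      show ?case by simp
    next
      case (compl F)
      then have F: "F \<in> sets borel" by (simp add: borel_def)
      have "emeasure N (Pair x -` (UNIV - F) \<inter> V) = emeasure N V - emeasure N (Pair x -` F \<inter> V)" for x
      proof -
        have "Pair x -` (UNIV - F) \<inter> V = V - Pair x -` F \<inter> V" by auto
        moreover have "emeasure N (Pair x -` F \<inter> V) \<le> emeasure N V"
          using VB by (intro emeasure_mono) auto
        then have "emeasure N (Pair x -` F \<inter> V) < \<infinity>" using V(2) by (rule le_less_trans)
        then have "emeasure N (V - Pair x -` F \<inter> V) = emeasure N V - emeasure N (Pair x -` F \<inter> V)"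
          using VB FB[OF F, of x] by (intro emeasure_Diff) auto
        ultimately show ?thesis by simp
      qed
      then show ?case using compl.IH by simp
    next
      case (union F)
      then have F: "F i \<in> sets borel" for i by (auto simp: borel_def)
      have "emeasure N (Pair x -` (\<Union>i. F i) \<inter> V) = (\<Sum>i. emeasure N (Pair x -` F i \<inter> V))" for x
      proof -
        have eq: "Pair x -` (\<Union>i. F i) \<inter> V = (\<Union>i. Pair x -` F i \<inter> V)" by auto
        have "disjoint_family (\<lambda>i. Pair x -` F i \<inter> V)"
          by (rule disjoint_family_on_bisimulation[OF union(1)]) blast
        moreover have "range (\<lambda>i. Pair x -` F i \<inter> V) \<subseteq> sets N" using FB[OF F] by blast
        ultimately show ?thesis unfolding eq by (intro suminf_emeasure[symmetric])
      qed
      then show ?case using union.IH by simp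
    qed
  qed
  obtain V :: "nat \<Rightarrow> 'b set" where V: "incseq V" "\<And>n. open (V n)" "\<And>n. emeasure N (V n) < \<infinity>" "(\<Union>n. V n) = UNIV"
    by (rule moderateE[OF N]) auto
  have "emeasure N (Pair x -` E) = (SUP n. emeasure N (Pair x -` E \<inter> V n))" for x
  proof -
    have "Pair x -` E \<inter> V n \<in> sets N" for n
      unfolding sN by (rule sets.Int[OF sets_Pair_vimage[OF E] borel_open[OF V(2)]])
    then have "range (\<lambda>n. Pair x -` E \<inter> V n) \<subseteq> sets N" by blast
    moreover have "incseq (\<lambda>n. Pair x -` E \<inter> V n)"
      using incseq_SucD[OF V(1)] by (intro incseq_SucI Int_mono subset_refl)
    ultimately have "(SUP n. emeasure N (Pair x -` E \<inter> V n)) = emeasure N (\<Union>n. Pair x -` E \<inter> V n)"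
      by (rule SUP_emeasure_incseq)
    also have "(\<Union>n. Pair x -` E \<inter> V n) = Pair x -` E"
      unfolding Int_UN_distrib[symmetric] V(4) by (rule Int_UNIV_right)
    finally show ?thesis by simp
  qed
  then show ?thesis using slice[OF V(2,3)] by simp
qed

text \<open>The product measure as an iterated integral, defined on all Borel sets of the product space and not only on
the product \<open>\<sigma>\<close>-algebra.\<close>

definition prodm :: "'a::topological_space measure \<Rightarrow> 'b::topological_space measure \<Rightarrow> ('a \<times> 'b) measure" where
  "prodm M N = measure_of UNIV (sets borel) (\<lambda>E. \<integral>\<^sup>+x. emeasure N (Pair x -` E) \<partial>M)"

lemma sets_prodm [simp, measurable_cong]: "sets (prodm M N) = sets borel"
  unfolding prodm_def using sets.sets_measure_of_eq[of borel] by simp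

lemma emeasure_prodm:
  fixes M :: "'a::t2_space measure" and N :: "'b::t2_space measure"
  assumes M: "sets M = sets borel" and N: "moderate N" and E: "E \<in> sets borel"
  shows "emeasure (prodm M N) E = (\<integral>\<^sup>+x. emeasure N (Pair x -` E) \<partial>M)"
proof (rule emeasure_measure_of[OF prodm_def])
  show "sets borel \<subseteq> Pow UNIV" by simp
  show "E \<in> sets (prodm M N)" using E by simp
  show "positive (sets (prodm M N)) (\<lambda>E. \<integral>\<^sup>+x. emeasure N (Pair x -` E) \<partial>M)"
    by (simp add: positive_def)
  show "countably_additive (sets (prodm M N)) (\<lambda>E. \<integral>\<^sup>+x. emeasure N (Pair x -` E) \<partial>M)"
  proof (rule countably_additiveI)
    fix F :: "nat \<Rightarrow> ('a \<times> 'b) set" assume F: "range F \<subseteq> sets (prodm M N)" "disjoint_family F"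
    then have FB: "F i \<in> sets borel" for i by auto
    have "(\<Sum>i. \<integral>\<^sup>+x. emeasure N (Pair x -` F i) \<partial>M) = (\<integral>\<^sup>+x. (\<Sum>i. emeasure N (Pair x -` F i)) \<partial>M)"
      using borel_measurable_slice[OF N FB]
      by (intro nn_integral_suminf[symmetric]) (simp add: measurable_cong_sets[OF M refl])
    also have "\<dots> = (\<integral>\<^sup>+x. emeasure N (Pair x -` (\<Union>i. F i)) \<partial>M)"
    proof (rule nn_integral_cong)
      fix x
      have "disjoint_family (\<lambda>i. Pair x -` F i)"
        by (rule disjoint_family_on_bisimulation[OF F(2)]) blast
      then show "(\<Sum>i. emeasure N (Pair x -` F i)) = emeasure N (Pair x -` (\<Union>i. F i))"
        unfolding vimage_UN using sets_Pair_vimage[OF FB]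
        by (intro suminf_emeasure) (auto simp: moderate_sets[OF N])
    qed
    finally show "(\<Sum>i. \<integral>\<^sup>+x. emeasure N (Pair x -` F i) \<partial>M) = (\<integral>\<^sup>+x. emeasure N (Pair x -` (\<Union>i. F i)) \<partial>M)" .
  qed
qed

text \<open>By induction on \<open>f\<close>; measurability of the inner integral is carried along, since the steps for sums and
suprema use it.\<close>

lemma nn_integral_prodm:
  fixes M :: "'a::t2_space measure" and N :: "'b::t2_space measure"
  assumes M: "sets M = sets borel" and N: "moderate N" and f: "f \<in> borel_measurable borel"
  shows "(\<lambda>x. \<integral>\<^sup>+y. f (x, y) \<partial>N) \<in> borel_measurable borel"
    and "(\<integral>\<^sup>+z. f z \<partial>prodm M N) = (\<integral>\<^sup>+x. \<integral>\<^sup>+y. f (x, y) \<partial>N \<partial>M)"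
proof -
  have mM: "g \<in> borel_measurable M" if "g \<in> borel_measurable borel" for g :: "'a \<Rightarrow> ennreal"
    using that measurable_cong_sets[OF M refl] by blast
  have mP: "g \<in> borel_measurable (prodm M N)" if "g \<in> borel_measurable borel" for g :: "'a \<times> 'b \<Rightarrow> ennreal"
    using that measurable_cong_sets[OF sets_prodm refl] by blast
  have mN: "(\<lambda>y. g (x, y)) \<in> borel_measurable N" if "g \<in> borel_measurable borel"
    for g :: "'a \<times> 'b \<Rightarrow> ennreal" and x
    using measurable_compose[OF measurable_Pair_borel that, of x]
      measurable_cong_sets[OF moderate_sets[OF N] refl] by blast
  have "(\<lambda>x. \<integral>\<^sup>+y. f (x, y) \<partial>N) \<in> borel_measurable borel \<and>
    (\<integral>\<^sup>+z. f z \<partial>prodm M N) = (\<integral>\<^sup>+x. \<integral>\<^sup>+y. f (x, y) \<partial>N \<partial>M)"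
    using f
  proof (induction rule: borel_measurable_induct)
    case (cong f g)
    then have "f = g" by (simp add: fun_eq_iff)
    then show ?case using cong.IH by simp
  next
    case (set A)
    have A: "(\<integral>\<^sup>+y. indicator A (x, y) \<partial>N) = emeasure N (Pair x -` A)" for x
    proof -
      have "(\<integral>\<^sup>+y. indicator A (x, y) \<partial>N) = (\<integral>\<^sup>+y. indicator (Pair x -` A) y \<partial>N)"
        by (intro nn_integral_cong) (auto simp: indicator_def)
      then show ?thesis using sets_Pair_vimage[OF set, of x] moderate_sets[OF N] by simp
    qed
    have "(\<integral>\<^sup>+z. indicator A z \<partial>prodm M N) = emeasure (prodm M N) A"
      using set by (intro nn_integral_indicator) simp
    then show ?case unfolding A using borel_measurable_slice[OF N set] emeasure_prodm[OF M N set] by simp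
  next
    case (mult u v)
    have eq: "(\<integral>\<^sup>+y. v * u (x, y) \<partial>N) = v * (\<integral>\<^sup>+y. u (x, y) \<partial>N)" for x
      by (rule nn_integral_cmult[OF mN[OF mult(2)]])
    have IH: "(\<lambda>x. \<integral>\<^sup>+y. u (x, y) \<partial>N) \<in> borel_measurable borel"
      "(\<integral>\<^sup>+z. u z \<partial>prodm M N) = (\<integral>\<^sup>+x. \<integral>\<^sup>+y. u (x, y) \<partial>N \<partial>M)" using mult.IH by blast+
    show ?case
      unfolding eq nn_integral_cmult[OF mP[OF mult(2)]] nn_integral_cmult[OF mM[OF IH(1)]] IH(2)
      using IH(1) by simp
  next
    case (add u v)
    have eq: "(\<integral>\<^sup>+y. v (x, y) + u (x, y) \<partial>N) = (\<integral>\<^sup>+y. v (x, y) \<partial>N) + (\<integral>\<^sup>+y. u (x, y) \<partial>N)" for x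
      by (rule nn_integral_add[OF mN[OF add(3)] mN[OF add(1)]])
    have IH: "(\<lambda>x. \<integral>\<^sup>+y. u (x, y) \<partial>N) \<in> borel_measurable borel"
      "(\<lambda>x. \<integral>\<^sup>+y. v (x, y) \<partial>N) \<in> borel_measurable borel"
      "(\<integral>\<^sup>+z. u z \<partial>prodm M N) = (\<integral>\<^sup>+x. \<integral>\<^sup>+y. u (x, y) \<partial>N \<partial>M)"
      "(\<integral>\<^sup>+z. v z \<partial>prodm M N) = (\<integral>\<^sup>+x. \<integral>\<^sup>+y. v (x, y) \<partial>N \<partial>M)" using add.IH by blast+
    show ?case
      unfolding eq nn_integral_add[OF mP[OF add(3)] mP[OF add(1)]]
        nn_integral_add[OF mM[OF IH(2)] mM[OF IH(1)]] IH(3,4)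
      using IH(1,2) by simp
  next
    case (seq U)
    have inc: "incseq (\<lambda>i y. U i (x, y))" for x
      using seq(3) by (auto simp: incseq_def le_fun_def)
    have eq: "(\<integral>\<^sup>+y. (SUP i. U i (x, y)) \<partial>N) = (SUP i. \<integral>\<^sup>+y. U i (x, y) \<partial>N)" for x
      by (rule nn_integral_monotone_convergence_SUP[OF inc mN[OF seq(1)]])
    have IH: "(\<lambda>x. \<integral>\<^sup>+y. U i (x, y) \<partial>N) \<in> borel_measurable borel"
      "(\<integral>\<^sup>+z. U i z \<partial>prodm M N) = (\<integral>\<^sup>+x. \<integral>\<^sup>+y. U i (x, y) \<partial>N \<partial>M)" for i using seq.IH by blast+
    have inc2: "incseq (\<lambda>i x. \<integral>\<^sup>+y. U i (x, y) \<partial>N)"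
      using seq(3) by (auto simp: incseq_def le_fun_def intro!: nn_integral_mono)
    have "(\<integral>\<^sup>+z. (SUP i. U i z) \<partial>prodm M N) = (SUP i. \<integral>\<^sup>+z. U i z \<partial>prodm M N)"
      by (rule nn_integral_monotone_convergence_SUP[OF seq(3) mP[OF seq(1)]])
    also have "\<dots> = (\<integral>\<^sup>+x. (SUP i. \<integral>\<^sup>+y. U i (x, y) \<partial>N) \<partial>M)"
      unfolding IH(2) by (rule nn_integral_monotone_convergence_SUP[OF inc2 mM[OF IH(1)], symmetric])
    finally have "(\<integral>\<^sup>+z. (SUP i. U i z) \<partial>prodm M N) = (\<integral>\<^sup>+x. \<integral>\<^sup>+y. (SUP i. U i (x, y)) \<partial>N \<partial>M)"
      unfolding eq .
    moreover have "(\<lambda>x. \<integral>\<^sup>+y. (SUP i. U i (x, y)) \<partial>N) \<in> borel_measurable borel"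
      unfolding eq by (intro borel_measurable_SUP IH(1)) simp
    ultimately show ?case by (simp only: SUP_apply image_comp o_def simp_thms)
  qed
  then show "(\<lambda>x. \<integral>\<^sup>+y. f (x, y) \<partial>N) \<in> borel_measurable borel"
    "(\<integral>\<^sup>+z. f z \<partial>prodm M N) = (\<integral>\<^sup>+x. \<integral>\<^sup>+y. f (x, y) \<partial>N \<partial>M)" by blast+
qed

lemma directed_finite_upper_bound:
  assumes "finite D" "D \<subseteq> F" "F \<noteq> {}"
    and "\<And>f g. f \<in> F \<Longrightarrow> g \<in> F \<Longrightarrow> \<exists>h\<in>F. f \<le> h \<and> g \<le> (h :: 'c::order)"
  shows "\<exists>h\<in>F. \<forall>f\<in>D. f \<le> h"
  using assms(1,2)
proof (induction D)
  case empty
  then show ?case using assms(3) by blast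
next
  case (insert f D)
  then obtain h where h: "h \<in> F" "\<forall>g\<in>D. g \<le> h" by auto
  then obtain k where "k \<in> F" "f \<le> k" "h \<le> k" using assms(4)[of f h] insert.prems by auto
  with h show ?case by (intro bexI[of _ k]) auto
qed

text \<open>Monotone convergence for directed families, the \<open>\<tau>\<close>-smoothness of Radon measures. Choose an increasing
sequence \<open>g n\<close> in \<open>F\<close> whose integrals tend to the supremum \<open>s\<close> of all integrals; its limit
\<open>L\<close> has integral \<open>s\<close>. Suppose that \<open>L < q < H\<close> on a set of positive measure. By inner regularity
of the open set \<open>{x. q < H x}\<close> a compact set \<open>K\<close> meets it in positive measure, and by compactness and
directedness a single \<open>f\<close> in \<open>F\<close> exceeds \<open>q\<close> on \<open>K\<close>. Then \<open>max L f\<close> has an integral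
larger than \<open>s\<close>, although each \<open>max (g n) f\<close> lies below a member of \<open>F\<close>.\<close>

lemma nn_integral_SUP_directed_lsc:
  fixes M :: "'a::t2_space measure" and F :: "('a \<Rightarrow> ennreal) set"
  assumes M: "radon M" and F: "F \<noteq> {}"
    and dir: "\<And>f g. f \<in> F \<Longrightarrow> g \<in> F \<Longrightarrow> \<exists>h\<in>F. f \<le> h \<and> g \<le> h"
    and lsc: "\<And>f c. f \<in> F \<Longrightarrow> open {x. c < f x}"
    and fin: "(\<integral>\<^sup>+x. (SUP f\<in>F. f x) \<partial>M) < \<infinity>"
  shows "(\<integral>\<^sup>+x. (SUP f\<in>F. f x) \<partial>M) = (SUP f\<in>F. \<integral>\<^sup>+x. f x \<partial>M)"
proof -
  have sM[measurable_cong, simp]: "sets M = sets borel" using M by simp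
  define H where "H x = (SUP f\<in>F. f x)" for x
  define s where "s = (SUP f\<in>F. \<integral>\<^sup>+x. f x \<partial>M)"
  have opH: "open {x. c < H x}" for c
  proof -
    have "{x. c < H x} = (\<Union>f\<in>F. {x. c < f x})" by (auto simp: H_def less_SUP_iff)
    then show ?thesis using lsc by auto
  qed
  have meas: "g \<in> borel_measurable borel" if "\<And>c. open {x. c < g x}" for g :: "'a \<Rightarrow> ennreal"
    using that by (intro borel_measurableI_greater) auto
  have Hm[measurable]: "H \<in> borel_measurable borel" by (rule meas[OF opH])
  have fm: "f \<in> borel_measurable borel" if "f \<in> F" for f by (rule meas[OF lsc[OF that]])
  have fH: "f x \<le> H x" if "f \<in> F" for f x using that by (auto simp: H_def intro: SUP_upper)
  have sH: "s \<le> (\<integral>\<^sup>+x. H x \<partial>M)"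
    unfolding s_def using fH by (intro SUP_least nn_integral_mono) auto
  have Hfin: "(\<integral>\<^sup>+x. H x \<partial>M) < \<infinity>" using fin by (simp add: H_def)
  then have sfin: "s < \<infinity>" using sH by (rule le_less_trans[rotated])
  obtain S :: "nat \<Rightarrow> ennreal" where S: "range S \<subseteq> (\<lambda>f. \<integral>\<^sup>+x. f x \<partial>M) ` F" "s = (SUP n. S n)"
    using ennreal_SUP_countable_SUP[OF F, of "\<lambda>f. \<integral>\<^sup>+x. f x \<partial>M"] unfolding s_def by blast
  then have "\<forall>n. \<exists>f\<in>F. S n = (\<integral>\<^sup>+x. f x \<partial>M)" by blast
  then obtain k where k: "\<And>n. k n \<in> F" "\<And>n. S n = (\<integral>\<^sup>+x. k n x \<partial>M)" by metis
  \<comment> \<open>The \<open>k n\<close> with integrals approaching \<open>s\<close> are dominated by an increasing sequence, by directedness.\<close>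
  have "\<exists>g. \<forall>n. (g n \<in> F \<and> k n \<le> g n) \<and> g n \<le> g (Suc n)"
  proof (rule dependent_nat_choice)
    show "\<exists>f. f \<in> F \<and> k 0 \<le> f" using k by blast
    show "\<exists>f'. (f' \<in> F \<and> k (Suc n) \<le> f') \<and> f \<le> f'" if "f \<in> F \<and> k n \<le> f" for f n
      using dir[of f "k (Suc n)"] that k(1)[of "Suc n"] by blast
  qed
  then obtain g where g: "\<And>n. g n \<in> F" "\<And>n. k n \<le> g n" "\<And>n. g n \<le> g (Suc n)" by blast
  have ginc: "incseq g" using g(3) by (rule incseq_SucI)
  have gm[measurable]: "g n \<in> borel_measurable borel" for n by (rule fm[OF g(1)])
  define L where "L x = (SUP n. g n x)" for x
  have Lm[measurable]: "L \<in> borel_measurable borel" unfolding L_def by measurable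
  have LH: "L x \<le> H x" for x unfolding L_def using fH[OF g(1)] by (intro SUP_least)
  have intL: "(\<integral>\<^sup>+x. L x \<partial>M) = s"
  proof -
    have "(\<integral>\<^sup>+x. L x \<partial>M) = (SUP n. \<integral>\<^sup>+x. g n x \<partial>M)"
      unfolding L_def using ginc by (intro nn_integral_monotone_convergence_SUP) auto
    also have "\<dots> = s"
    proof (rule antisym)
      show "(SUP n. \<integral>\<^sup>+x. g n x \<partial>M) \<le> s" unfolding s_def using g(1) by (intro SUP_least SUP_upper)
      have "S n \<le> (SUP n. \<integral>\<^sup>+x. g n x \<partial>M)" for n
      proof -
        have "S n \<le> (\<integral>\<^sup>+x. g n x \<partial>M)"
          unfolding k(2) using g(2)[of n] by (intro nn_integral_mono) (auto simp: le_fun_def)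
        also have "\<dots> \<le> (SUP n. \<integral>\<^sup>+x. g n x \<partial>M)" by (intro SUP_upper) auto
        finally show ?thesis .
      qed
      then show "s \<le> (SUP n. \<integral>\<^sup>+x. g n x \<partial>M)" unfolding S(2) by (intro SUP_least)
    qed
    finally show ?thesis .
  qed
  have null: "AE x in M. \<not> (L x < q \<and> q < H x)" for q
  proof (rule ccontr)
    define E where "E = {x. L x < q \<and> q < H x}"
    have E[measurable]: "E \<in> sets borel" unfolding E_def by measurable
    assume "\<not> (AE x in M. \<not> (L x < q \<and> q < H x))"
    then have "emeasure M E \<noteq> 0"
      using AE_iff_measurable[of E M "\<lambda>x. \<not> (L x < q \<and> q < H x)"] by (auto simp: E_def)
    then have Epos: "0 < emeasure M E" by (simp add: zero_less_iff_neq_zero)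
    then have "E \<noteq> {}" by auto
    then have "0 < q" by (auto simp: E_def intro: le_less_trans[OF zero_le])
    have "q \<noteq> \<infinity>" using \<open>E \<noteq> {}\<close> by (auto simp: E_def)
    have "q * emeasure M {x. q < H x} = (\<integral>\<^sup>+x. q * indicator {x. q < H x} x \<partial>M)"
      by (subst nn_integral_cmult_indicator) auto
    also have "\<dots> \<le> (\<integral>\<^sup>+x. H x \<partial>M)"
      by (intro nn_integral_mono) (auto simp: indicator_def)
    finally have "q * emeasure M {x. q < H x} < \<infinity>" using Hfin by (rule le_less_trans)
    then have ofin: "emeasure M {x. q < H x} < \<infinity>"
      using \<open>0 < q\<close> by (auto simp: ennreal_mult_less_top)
    have "E \<subseteq> {x. q < H x}" by (auto simp: E_def)
    then have "emeasure M E \<le> emeasure M {x. q < H x}" by (intro emeasure_mono) auto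
    then have Efin: "emeasure M E < \<infinity>" using ofin by (rule le_less_trans)
    then obtain e where e: "emeasure M E = ennreal e" "0 < e"
      using Epos by (cases "emeasure M E") auto
    then obtain K where K: "compact K" "K \<subseteq> {x. q < H x}" "emeasure M ({x. q < H x} - K) \<le> ennreal (e/2)"
      using radon_inner_approx[OF M opH[of q] ofin, of "e/2"] by auto
    have Km[measurable]: "K \<in> sets borel" using K by (auto simp: compact_imp_closed)
    have Kpos: "emeasure M (K \<inter> E) \<noteq> 0"
    proof
      assume z: "emeasure M (K \<inter> E) = 0"
      have "emeasure M E \<le> emeasure M (({x. q < H x} - K) \<union> (K \<inter> E))"
        using \<open>E \<subseteq> {x. q < H x}\<close> by (intro emeasure_mono) auto
      also have "\<dots> \<le> emeasure M ({x. q < H x} - K) + emeasure M (K \<inter> E)"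
        by (intro emeasure_subadditive) auto
      also have "\<dots> \<le> ennreal (e/2)" using K z by simp
      finally show False using e by simp
    qed
    obtain D where D: "D \<subseteq> F" "finite D" "K \<subseteq> (\<Union>f\<in>D. {x. q < f x})"
    proof (rule compactE_image[OF K(1)])
      show "open {x. q < f x}" if "f \<in> F" for f by (rule lsc[OF that])
      show "K \<subseteq> (\<Union>f\<in>F. {x. q < f x})" using K(2) by (auto simp: H_def less_SUP_iff)
    qed
    then obtain f where f: "f \<in> F" "\<And>f'. f' \<in> D \<Longrightarrow> f' \<le> f"
      using directed_finite_upper_bound[OF D(2,1) F] dir by metis
    have qf: "q < f x" if "x \<in> K" for x
    proof -
      obtain f' where "f' \<in> D" "q < f' x" using D(3) \<open>x \<in> K\<close> by blast
      then show ?thesis using f(2)[of f'] by (auto simp: le_fun_def intro: less_le_trans)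
    qed
    have fmm[measurable]: "f \<in> borel_measurable borel" by (rule fm[OF f(1)])
    have "(\<integral>\<^sup>+x. max (L x) (f x) \<partial>M) = (SUP n. \<integral>\<^sup>+x. max (g n x) (f x) \<partial>M)"
    proof -
      have "(SUP n. max (g n x) (f x)) = max (L x) (f x)" for x
        unfolding L_def sup_max[symmetric] by (simp add: SUP_sup_distrib[symmetric])
      moreover have "incseq (\<lambda>n x. max (g n x) (f x))"
        using ginc by (auto simp: incseq_def le_fun_def intro: max.coboundedI1)
      then have "(\<integral>\<^sup>+x. (SUP n. max (g n x) (f x)) \<partial>M) = (SUP n. \<integral>\<^sup>+x. max (g n x) (f x) \<partial>M)"
        by (intro nn_integral_monotone_convergence_SUP) auto
      ultimately show ?thesis by simp
    qed
    also have "\<dots> \<le> s"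
    proof (rule SUP_least)
      fix n
      obtain h where h: "h \<in> F" "g n \<le> h" "f \<le> h" using dir[OF g(1) f(1)] by blast
      then have "(\<integral>\<^sup>+x. max (g n x) (f x) \<partial>M) \<le> (\<integral>\<^sup>+x. h x \<partial>M)"
        by (intro nn_integral_mono) (auto simp: le_fun_def)
      also have "\<dots> \<le> s" unfolding s_def using h by (intro SUP_upper)
      finally show "(\<integral>\<^sup>+x. max (g n x) (f x) \<partial>M) \<le> s" .
    qed
    finally have le: "(\<integral>\<^sup>+x. max (L x) (f x) \<partial>M) \<le> (\<integral>\<^sup>+x. L x \<partial>M)" by (simp add: intL)
    have "\<not> (AE x in M. max (L x) (f x) \<le> L x)"
    proof
      assume "AE x in M. max (L x) (f x) \<le> L x"
      then have "AE x in M. x \<notin> K \<inter> E"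
      proof eventually_elim
        case (elim x)
        then show ?case using qf[of x] by (auto simp: E_def)
      qed
      then show False using Kpos AE_iff_measurable[of "K \<inter> E" M "\<lambda>x. x \<notin> K \<inter> E"] by auto
    qed
    then have "(\<integral>\<^sup>+x. L x \<partial>M) < (\<integral>\<^sup>+x. max (L x) (f x) \<partial>M)"
      using sfin intL by (intro nn_integral_less) auto
    with le show False by simp
  qed
  obtain D :: "ennreal set" where D: "countable D" "\<And>X. open X \<Longrightarrow> X \<noteq> {} \<Longrightarrow> \<exists>d\<in>D. d \<in> X"
    using countable_dense_setE by blast
  have "AE x in M. \<forall>q\<in>D. \<not> (L x < q \<and> q < H x)"
    using null D(1) by (simp add: AE_ball_countable)
  then have "AE x in M. H x \<le> L x"
  proof eventually_elim
    case (elim x)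
    show ?case
    proof (rule ccontr)
      assume "\<not> H x \<le> L x"
      then have "{L x<..<H x} \<noteq> {}" by (simp add: dense)
      then obtain q where "q \<in> D" "q \<in> {L x<..<H x}" using D(2)[of "{L x<..<H x}"] by auto
      with elim show False by auto
    qed
  qed
  then have "(\<integral>\<^sup>+x. H x \<partial>M) \<le> (\<integral>\<^sup>+x. L x \<partial>M)" by (rule nn_integral_mono_AE)
  with sH intL have "(\<integral>\<^sup>+x. H x \<partial>M) = s" by simp
  then show ?thesis by (simp add: H_def s_def)
qed

lemma compact_open_between:
  fixes K W :: "'a::t2_space set"
  assumes "locally_compact_space (euclidean :: 'a topology)" "compact K" "open W" "K \<subseteq> W"
  shows "\<exists>G. open G \<and> compact (closure G) \<and> K \<subseteq> G \<and> closure G \<subseteq> W"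
proof -
  have "neighbourhood_base_of (\<lambda>C. compact C \<and> closed C) (euclidean :: 'a topology)"
    using locally_compact_space_neighbourhood_base_closedin[of "euclidean :: 'a topology"] assms(1)
    by (simp add: Hausdorff_space_def separation_t2 disjnt_def)
  then have "\<exists>U C. open U \<and> compact C \<and> closed C \<and> x \<in> U \<and> U \<subseteq> C \<and> C \<subseteq> W" if "x \<in> W" for x
    using that assms(3) unfolding neighbourhood_base_of open_openin[symmetric] by meson
  then obtain U where "\<And>x. x \<in> W \<Longrightarrow> \<exists>C. open (U x) \<and> compact C \<and> closed C \<and> x \<in> U x \<and> U x \<subseteq> C \<and> C \<subseteq> W"
    by metis
  then obtain C where *: "\<And>x. x \<in> W \<Longrightarrow>
      open (U x) \<and> compact (C x) \<and> closed (C x) \<and> x \<in> U x \<and> U x \<subseteq> C x \<and> C x \<subseteq> W"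
    by metis
  have UC: "open (U x)" "compact (C x)" "closed (C x)" "x \<in> U x" "U x \<subseteq> C x" "C x \<subseteq> W" if "x \<in> W" for x
    using *[OF that] by simp_all
  obtain D where D: "D \<subseteq> K" "finite D" "K \<subseteq> (\<Union>x\<in>D. U x)"
  proof (rule compactE_image[OF assms(2)])
    show "open (U x)" if "x \<in> K" for x using UC(1)[OF subsetD[OF assms(4) that]] .
    show "K \<subseteq> (\<Union>x\<in>K. U x)" using UC(4)[OF subsetD[OF assms(4)]] by (intro subsetI UN_I)
  qed auto
  have UCD: "open (U x)" "compact (C x)" "U x \<subseteq> C x" "C x \<subseteq> W" if "x \<in> D" for x
    using UC(1,2,5,6)[OF subsetD[OF assms(4) subsetD[OF D(1) that]]] .
  have cC: "compact (\<Union>x\<in>D. C x)" using UCD(2) D(2) by (intro compact_UN)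
  have "(\<Union>x\<in>D. U x) \<subseteq> (\<Union>x\<in>D. C x)" using UCD(3) by (intro UN_mono subset_refl)
  then have sub: "closure (\<Union>x\<in>D. U x) \<subseteq> (\<Union>x\<in>D. C x)"
    using cC by (intro closure_minimal compact_imp_closed)
  have "compact (closure (\<Union>x\<in>D. U x))"
    using compact_Int_closed[OF cC closed_closure, of "\<Union>x\<in>D. U x"] sub by (simp only: inf.absorb2)
  moreover have "(\<Union>x\<in>D. C x) \<subseteq> W" using UCD(4) by (rule UN_least)
  with sub have "closure (\<Union>x\<in>D. U x) \<subseteq> W" by (rule subset_trans)
  moreover have "open (\<Union>x\<in>D. U x)" using UCD(1) by (rule open_UN[OF ballI])
  ultimately show ?thesis
    using D(3) by (intro exI[of _ "\<Union>x\<in>D. U x"] conjI)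
qed

text \<open>Inner regularity on an open set \<open>W\<close>: the open sets with compact closure in \<open>W\<close> are directed, and the
measures of their slices increase to those of the slices of \<open>W\<close>. Thus \<open>\<tau>\<close>-smoothness of \<open>M\<close>
produces a compact subset of \<open>W\<close> of nearly full measure.\<close>

lemma moderate_prodm:
  fixes M :: "'a::t2_space measure" and N :: "'b::t2_space measure"
  assumes lc: "locally_compact_space (euclidean :: 'a topology)" "locally_compact_space (euclidean :: 'b topology)"
    and M: "moderate M" and N: "moderate N"
  shows "moderate (prodm M N)"
proof -
  obtain U :: "nat \<Rightarrow> 'a set" where U: "incseq U" "\<And>n. open (U n)" "\<And>n. emeasure M (U n) < \<infinity>" "(\<Union>n. U n) = UNIV"
    by (rule moderateE[OF M]) auto
  obtain V :: "nat \<Rightarrow> 'b set" where V: "incseq V" "\<And>n. open (V n)" "\<And>n. emeasure N (V n) < \<infinity>" "(\<Union>n. V n) = UNIV"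
    by (rule moderateE[OF N]) auto
  have lc2: "locally_compact_space (euclidean :: ('a \<times> 'b) topology)"
    using locally_compact_space_prod_topology[of "euclidean :: 'a topology" "euclidean :: 'b topology"] lc by simp
  have UV: "open (U n \<times> V n)" for n using U V by (auto intro: open_Times)
  have fin: "emeasure (prodm M N) (U n \<times> V n) < \<infinity>" for n
  proof -
    have "emeasure (prodm M N) (U n \<times> V n) = (\<integral>\<^sup>+x. emeasure N (Pair x -` (U n \<times> V n)) \<partial>M)"
      using UV by (intro emeasure_prodm N) (use M in auto)
    also have "\<dots> = (\<integral>\<^sup>+x. emeasure N (V n) * indicator (U n) x \<partial>M)"
      by (intro nn_integral_cong) (auto simp: indicator_def Pair_vimage_Sigma)
    also have "\<dots> = emeasure N (V n) * emeasure M (U n)"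
      using M U by (intro nn_integral_cmult_indicator) auto
    also have "\<dots> < \<infinity>" using U V by (auto simp: ennreal_mult_less_top)
    finally show ?thesis .
  qed
  show ?thesis
  proof (rule moderateI[OF sets_prodm _ UV fin])
    show "incseq (\<lambda>n. U n \<times> V n)"
      using incseq_SucD[OF U(1)] incseq_SucD[OF V(1)] by (intro incseq_SucI Sigma_mono)
    show "(\<Union>n. U n \<times> V n) = UNIV"
    proof -
      have "(x, y) \<in> (\<Union>n. U n \<times> V n)" for x y
      proof -
        obtain n m where "x \<in> U n" "y \<in> V m" using U(4) V(4) by blast
        then have "x \<in> U (max n m)" "y \<in> V (max n m)"
          using incseqD[OF U(1), of n "max n m"] incseqD[OF V(1), of m "max n m"] by auto
        then show ?thesis by blast
      qed
      then show ?thesis by auto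
    qed
    fix W n and e :: real assume W: "open W" "W \<subseteq> U n \<times> V n" "0 < e"
    define GG where "GG = {G. open G \<and> compact (closure G) \<and> closure G \<subseteq> W}"
    define F where "F = (\<lambda>G x. emeasure N (Pair x -` G)) ` GG"
    have WB: "W \<in> sets borel" using W by auto
    have PW: "emeasure (prodm M N) W < \<infinity>"
    proof -
      have "emeasure (prodm M N) W \<le> emeasure (prodm M N) (U n \<times> V n)"
        by (rule emeasure_mono[OF W(2)]) (simp add: borel_open[OF UV])
      then show ?thesis using fin[of n] by (rule le_less_trans)
    qed
    have mono: "emeasure N (Pair x -` G) \<le> emeasure N (Pair x -` G')" if "G \<subseteq> G'" "open G'" for G G' x
    proof (rule emeasure_mono)
      show "Pair x -` G \<subseteq> Pair x -` G'" using that(1) by (rule vimage_mono)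
      show "Pair x -` G' \<in> sets N"
        unfolding moderate_sets[OF N] by (rule borel_open[OF open_Pair_vimage[OF that(2)]])
    qed
    have "{} \<in> GG" by (auto simp: GG_def)
    then have Fne: "F \<noteq> {}" by (auto simp: F_def)
    have dirG: "G \<union> G' \<in> GG" if "G \<in> GG" "G' \<in> GG" for G G'
      using that unfolding GG_def mem_Collect_eq closure_Un by (intro conjI open_Un compact_Un Un_least) simp_all
    have dir: "\<exists>h\<in>F. f \<le> h \<and> g \<le> h" if fg: "f \<in> F" "g \<in> F" for f g
    proof -
      obtain G G' where G: "G \<in> GG" "G' \<in> GG" and f: "f = (\<lambda>x. emeasure N (Pair x -` G))"
        and g: "g = (\<lambda>x. emeasure N (Pair x -` G'))" using fg by (auto simp: F_def)
      have o: "open (G \<union> G')" using dirG[OF G] by (simp add: GG_def)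
      have "f \<le> (\<lambda>x. emeasure N (Pair x -` (G \<union> G')))"
        unfolding f le_fun_def by (intro allI mono[OF Un_upper1 o])
      moreover have "g \<le> (\<lambda>x. emeasure N (Pair x -` (G \<union> G')))"
        unfolding g le_fun_def by (intro allI mono[OF Un_upper2 o])
      moreover have "(\<lambda>x. emeasure N (Pair x -` (G \<union> G'))) \<in> F"
        unfolding F_def by (rule imageI[OF dirG[OF G]])
      ultimately show ?thesis by (intro bexI conjI)
    qed
    have lsc: "open {x. c < f x}" if fF: "f \<in> F" for f c
    proof -
      obtain G where "G \<in> GG" and f: "f = (\<lambda>x. emeasure N (Pair x -` G))" using fF by (auto simp: F_def)
      then have "open G" by (simp add: GG_def)
      then show ?thesis unfolding f by (rule open_slice_less[OF moderate_radon[OF N]])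
    qed
    have sup: "(SUP f\<in>F. f x) = emeasure N (Pair x -` W)" for x
    proof (rule antisym)
      show "(SUP f\<in>F. f x) \<le> emeasure N (Pair x -` W)"
      proof (rule SUP_least)
        fix f assume "f \<in> F"
        then obtain G where G: "G \<in> GG" "f = (\<lambda>x. emeasure N (Pair x -` G))" by (auto simp: F_def)
        have "closure G \<subseteq> W" using G(1) by (simp add: GG_def)
        with closure_subset have "G \<subseteq> W" by (rule subset_trans)
        then show "f x \<le> emeasure N (Pair x -` W)" unfolding G(2) by (rule mono[OF _ W(1)])
      qed
      have "emeasure N (Pair x -` W) = (SUP K\<in>{K. compact K \<and> K \<subseteq> Pair x -` W}. emeasure N K)"
        by (rule radon_inner[OF moderate_radon[OF N] open_Pair_vimage[OF W(1)]])
      also have "\<dots> \<le> (SUP f\<in>F. f x)"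
      proof (rule SUP_least)
        fix K assume "K \<in> {K. compact K \<and> K \<subseteq> Pair x -` W}"
        then have K: "compact ({x} \<times> K)" "{x} \<times> K \<subseteq> W" by (auto intro: compact_Times)
        obtain G where G: "open G" "compact (closure G)" "{x} \<times> K \<subseteq> G" "closure G \<subseteq> W"
          using compact_open_between[OF lc2 K(1) W(1) K(2)] by (elim exE conjE)
        have "emeasure N K \<le> emeasure N (Pair x -` G)"
        proof (rule emeasure_mono)
          show "K \<subseteq> Pair x -` G" using G(3) by auto
          show "Pair x -` G \<in> sets N"
            unfolding moderate_sets[OF N] by (rule borel_open[OF open_Pair_vimage[OF G(1)]])
        qed
        also have "\<dots> \<le> (SUP f\<in>F. f x)"
          using G by (intro SUP_upper2[of "\<lambda>x. emeasure N (Pair x -` G)"]) (auto simp: F_def GG_def)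
        finally show "emeasure N K \<le> (SUP f\<in>F. f x)" .
      qed
      finally show "emeasure N (Pair x -` W) \<le> (SUP f\<in>F. f x)" .
    qed
    have PWeq: "emeasure (prodm M N) W = (\<integral>\<^sup>+x. (SUP f\<in>F. f x) \<partial>M)"
      unfolding sup by (rule emeasure_prodm[OF moderate_sets[OF M] N WB])
    have PWS: "emeasure (prodm M N) W = (SUP f\<in>F. \<integral>\<^sup>+x. f x \<partial>M)"
      unfolding PWeq
      by (rule nn_integral_SUP_directed_lsc[OF moderate_radon[OF M] Fne]) (rule dir lsc PW[unfolded PWeq]; assumption?)+
    obtain f where f: "f \<in> F" "emeasure (prodm M N) W < (\<integral>\<^sup>+x. f x \<partial>M) + ennreal e"
      using SUP_approx_ennreal[OF W(3) Fne PWS] PW by (auto simp: less_top)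
    then obtain G where G: "G \<in> GG" "f = (\<lambda>x. emeasure N (Pair x -` G))" by (auto simp: F_def)
    have oG: "open G" "compact (closure G)" "closure G \<subseteq> W" using G by (auto simp: GG_def)
    have "(\<integral>\<^sup>+x. f x \<partial>M) = emeasure (prodm M N) G"
      unfolding G(2) by (rule emeasure_prodm[OF moderate_sets[OF M] N borel_open[OF oG(1)], symmetric])
    with f have lt: "emeasure (prodm M N) W < emeasure (prodm M N) G + ennreal e" by simp
    have GW: "G \<subseteq> W" using closure_subset oG(3) by (rule subset_trans)
    have sW: "W \<in> sets (prodm M N)" "G \<in> sets (prodm M N)" using WB borel_open[OF oG(1)] by simp_all
    have "emeasure (prodm M N) G \<le> emeasure (prodm M N) W"
      by (rule emeasure_mono[OF GW sW(1)])
    then have Gfin: "emeasure (prodm M N) G < \<infinity>" using PW by (rule le_less_trans)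
    have "emeasure (prodm M N) (W - closure G) \<le> emeasure (prodm M N) (W - G)"
      by (rule emeasure_mono[OF Diff_mono[OF subset_refl closure_subset] sets.Diff[OF sW]])
    also have "\<dots> = emeasure (prodm M N) W - emeasure (prodm M N) G"
      by (rule emeasure_Diff[OF less_imp_neq[OF Gfin] sW GW])
    also have "\<dots> \<le> ennreal e"
      using less_imp_le[OF lt] Gfin by (simp add: ennreal_minus_le_iff add.commute less_top)
    finally show "\<exists>K. compact K \<and> K \<subseteq> W \<and> emeasure (prodm M N) (W - K) \<le> ennreal e"
      using oG(2,3) by (intro exI[of _ "closure G"] conjI)
  qed
qed

text \<open>Inclusion-exclusion by induction on the number of rectangles, because the intersection of two rectangles is
a rectangle. If the intersection has infinite measure then so has the union, and nothing needs to be cancelled.\<close>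

lemma emeasure_finite_Union_rectangles_eq:
  fixes P Q :: "('a::topological_space \<times> 'b::topological_space) measure"
  assumes s: "sets P = sets borel" "sets Q = sets borel"
    and eq: "\<And>U V. open U \<Longrightarrow> open V \<Longrightarrow> emeasure P (U \<times> V) = emeasure Q (U \<times> V)"
    and I: "finite I"
    and UV: "\<And>i. i \<in> I \<Longrightarrow> open (U i)" "\<And>i. i \<in> I \<Longrightarrow> open (V i)"
  shows "emeasure P (\<Union>i\<in>I. U i \<times> V i) = emeasure Q (\<Union>i\<in>I. U i \<times> V i)"
  using I UV
proof (induction I arbitrary: U V)
  case empty
  then show ?case by simp
next
  case (insert j I)
  let ?R = "U j \<times> V j" and ?G = "\<Union>i\<in>I. U i \<times> V i"
  let ?D = "\<Union>i\<in>I. (U j \<inter> U i) \<times> (V j \<inter> V i)"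
  have oR: "open ?R" and oG: "open ?G" using insert.prems by (auto intro!: open_Times)
  have D: "?R \<inter> ?G = ?D" by auto
  have eD: "emeasure P ?D = emeasure Q ?D"
    using insert.prems by (intro insert.IH) (auto intro: open_Int)
  have eG: "emeasure P ?G = emeasure Q ?G"
    using insert.prems by (intro insert.IH) auto
  have eR: "emeasure P ?R = emeasure Q ?R" using insert.prems by (intro eq) auto
  have P: "emeasure P ?R + emeasure P ?G = emeasure P (?R \<union> ?G) + emeasure P ?D"
    unfolding D[symmetric] by (rule emeasure_Un_Int) (simp_all only: s borel_open oR oG)
  have Q: "emeasure Q ?R + emeasure Q ?G = emeasure Q (?R \<union> ?G) + emeasure Q ?D"
    unfolding D[symmetric] by (rule emeasure_Un_Int) (simp_all only: s borel_open oR oG)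
  have "emeasure P (?R \<union> ?G) = emeasure Q (?R \<union> ?G)"
  proof (cases "emeasure P ?D = \<infinity>")
    case True
    have sub: "emeasure M ?D \<le> emeasure M (?R \<union> ?G)" if "sets M = sets borel" for M
    proof (rule emeasure_mono)
      show "?D \<subseteq> ?R \<union> ?G" unfolding D[symmetric] by (rule le_infI1[OF Un_upper1])
      show "?R \<union> ?G \<in> sets M" unfolding that by (rule borel_open[OF open_Un[OF oR oG]])
    qed
    then have "emeasure P (?R \<union> ?G) = \<infinity>" "emeasure Q (?R \<union> ?G) = \<infinity>"
      using True eD sub[OF s(1)] sub[OF s(2)] by (simp_all add: top_unique)
    then show ?thesis by simp
  next
    case False
    have "emeasure P ?D + emeasure P (?R \<union> ?G) = emeasure P ?R + emeasure P ?G"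
      unfolding P by (rule add.commute)
    also have "\<dots> = emeasure P ?D + emeasure Q (?R \<union> ?G)"
      unfolding eR eG Q eD by (rule add.commute)
    finally show ?thesis using False unfolding ennreal_add_left_cancel by simp
  qed
  then show ?case by simp
qed

text \<open>Every compact subset of an open set \<open>W\<close> lies in a finite union of open rectangles contained in
\<open>W\<close>, so the values on rectangles determine those on open sets, and hence the measure.\<close>

lemma radon_eq_rectangles:
  fixes P Q :: "('a::topological_space \<times> 'b::topological_space) measure"
  assumes P: "radon P" and Q: "radon Q"
    and eq: "\<And>U V. open U \<Longrightarrow> open V \<Longrightarrow> emeasure P (U \<times> V) = emeasure Q (U \<times> V)"
  shows "P = Q"
proof -
  have le: "emeasure P W \<le> emeasure Q W"
    if P: "radon P" and Q: "radon Q" and W: "open W"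
      and eq: "\<And>U V. open U \<Longrightarrow> open V \<Longrightarrow> emeasure P (U \<times> V) = emeasure Q (U \<times> V)"
    for P Q :: "('a \<times> 'b) measure" and W
  proof -
    have "emeasure P W = (SUP K\<in>{K. compact K \<and> K \<subseteq> W}. emeasure P K)"
      by (rule radon_inner[OF P W])
    also have "\<dots> \<le> emeasure Q W"
    proof (rule SUP_least)
      fix K assume "K \<in> {K. compact K \<and> K \<subseteq> W}"
      then have K: "compact K" "K \<subseteq> W" by auto
      have "\<exists>U V. open U \<and> open V \<and> z \<in> U \<times> V \<and> U \<times> V \<subseteq> W" if "z \<in> K" for z
        using open_prod_elim[OF W subsetD[OF K(2) that]] by metis
      then obtain U V where UV: "\<And>z. z \<in> K \<Longrightarrow> open (U z)" "\<And>z. z \<in> K \<Longrightarrow> open (V z)"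
        "\<And>z. z \<in> K \<Longrightarrow> z \<in> U z \<times> V z" "\<And>z. z \<in> K \<Longrightarrow> U z \<times> V z \<subseteq> W" by metis
      obtain D where D: "D \<subseteq> K" "finite D" "K \<subseteq> (\<Union>z\<in>D. U z \<times> V z)"
      proof (rule compactE_image[OF K(1)])
        show "open (U z \<times> V z)" if "z \<in> K" for z using UV(1,2)[OF that] by (rule open_Times)
        show "K \<subseteq> (\<Union>z\<in>K. U z \<times> V z)" using UV(3) by (intro subsetI UN_I)
      qed auto
      have UVD: "open (U z)" "open (V z)" "U z \<times> V z \<subseteq> W" if "z \<in> D" for z
        using UV(1,2,4)[OF subsetD[OF D(1) that]] .
      have o: "open (\<Union>z\<in>D. U z \<times> V z)" using UVD(1,2) by (intro open_UN ballI open_Times)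
      have "emeasure P K \<le> emeasure P (\<Union>z\<in>D. U z \<times> V z)"
        by (rule emeasure_mono[OF D(3)]) (simp only: radon_sets[OF P] borel_open[OF o])
      also have "\<dots> = emeasure Q (\<Union>z\<in>D. U z \<times> V z)"
        by (rule emeasure_finite_Union_rectangles_eq[OF radon_sets[OF P] radon_sets[OF Q] _ D(2)])
          (erule (1) eq | erule UVD)+
      also have "\<dots> \<le> emeasure Q W"
      proof (rule emeasure_mono)
        show "(\<Union>z\<in>D. U z \<times> V z) \<subseteq> W" using UVD(3) by (rule UN_least)
      qed (simp only: radon_sets[OF Q] borel_open[OF W])
      finally show "emeasure P K \<le> emeasure Q W" .
    qed
    finally show ?thesis .
  qed
  show ?thesis
  proof (rule radon_eqI[OF P Q])
    fix W :: "('a \<times> 'b) set" assume "open W"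
    show "emeasure P W = emeasure Q W"
      using le[OF P Q \<open>open W\<close> eq] le[OF Q P \<open>open W\<close> eq[symmetric]] by (intro antisym)
  qed
qed

lemma emeasure_prodm_Times:
  fixes M :: "'a::t2_space measure" and N :: "'b::t2_space measure"
  assumes M: "sets M = sets borel" and N: "moderate N" and UV: "open U" "open V"
  shows "emeasure (prodm M N) (U \<times> V) = emeasure M U * emeasure N V"
proof -
  have "emeasure (prodm M N) (U \<times> V) = (\<integral>\<^sup>+x. emeasure N (Pair x -` (U \<times> V)) \<partial>M)"
    using UV by (intro emeasure_prodm N M borel_open open_Times)
  also have "\<dots> = (\<integral>\<^sup>+x. emeasure N V * indicator U x \<partial>M)"
    by (intro nn_integral_cong) (auto simp: indicator_def Pair_vimage_Sigma)
  also have "\<dots> = emeasure N V * emeasure M U"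
    using M UV by (intro nn_integral_cmult_indicator) auto
  finally show ?thesis by (simp add: mult.commute)
qed

lemma radon_prod_eq_prodm:
  fixes M :: "'a::t2_space measure" and N :: "'b::t2_space measure"
  assumes lc: "locally_compact_space (euclidean :: 'a topology)" "locally_compact_space (euclidean :: 'b topology)"
    and M: "moderate M" and N: "moderate N"
  shows "radon_prod M N = prodm M N"
  unfolding radon_prod_def
proof (rule the_equality)
  have r: "radon (prodm M N)" using moderate_prodm[OF lc M N] by simp
  have e: "emeasure (prodm M N) (U \<times> V) = emeasure M U * emeasure N V" if "open U" "open V" for U V
    using M that by (intro emeasure_prodm_Times N) auto
  show "radon (prodm M N) \<and> (\<forall>U V. open U \<longrightarrow> open V \<longrightarrow>
      emeasure (prodm M N) (U \<times> V) = emeasure M U * emeasure N V)"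
    using r e by blast
  fix P assume "radon P \<and> (\<forall>U V. open U \<longrightarrow> open V \<longrightarrow>
      emeasure P (U \<times> V) = emeasure M U * emeasure N V)"
  then show "P = prodm M N" using e by (intro radon_eq_rectangles r) auto
qed

text \<open>Both measures are Radon with the same values on open rectangles.\<close>

lemma prodm_swap:
  fixes M :: "'a::t2_space measure" and N :: "'b::t2_space measure"
  assumes lc: "locally_compact_space (euclidean :: 'a topology)" "locally_compact_space (euclidean :: 'b topology)"
    and M: "moderate M" and N: "moderate N"
  shows "prodm M N = distr (prodm N M) borel prod.swap"
proof -
  have c: "continuous_on A (prod.swap :: 'b \<times> 'a \<Rightarrow> 'a \<times> 'b)" "continuous_on B (prod.swap :: 'a \<times> 'b \<Rightarrow> 'b \<times> 'a)" for A B
    unfolding prod.swap_def by (intro continuous_intros)+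
  have [measurable]: "(prod.swap :: 'b \<times> 'a \<Rightarrow> 'a \<times> 'b) \<in> borel \<rightarrow>\<^sub>M borel"
    using c by (intro borel_measurable_continuous_onI)
  have em: "emeasure (distr (prodm N M) borel prod.swap) E = emeasure (prodm N M) (prod.swap -` E)"
    if "E \<in> sets borel" for E :: "('a \<times> 'b) set"
    using that by (subst emeasure_distr) auto
  have mod: "moderate (prodm N M)" by (rule moderate_prodm[OF lc(2,1) N M])
  obtain V :: "nat \<Rightarrow> ('b \<times> 'a) set" where V: "incseq V" "\<And>n. open (V n)"
    "\<And>n. emeasure (prodm N M) (V n) < \<infinity>" "(\<Union>n. V n) = UNIV"
    by (rule moderateE[OF mod]) auto
  have oV: "open (prod.swap -` W)" if "open W" for W :: "('a \<times> 'b) set"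
    using that c by (intro open_vimage)
  have oV': "open (prod.swap -` W)" if "open W" for W :: "('b \<times> 'a) set"
    using that c by (intro open_vimage)
  have ss: "prod.swap -` (prod.swap -` W) = W" for W :: "('b \<times> 'a) set" by auto
  have "moderate (distr (prodm N M) borel prod.swap)"
  proof (rule moderateI)
    show "incseq (\<lambda>n. prod.swap -` V n)" using V(1) unfolding incseq_def by blast
    show "open (prod.swap -` V n)" for n using oV' V by blast
    show "emeasure (distr (prodm N M) borel prod.swap) (prod.swap -` V n) < \<infinity>" for n
      using em[of "prod.swap -` V n"] oV'[OF V(2)[of n]] V(3)[of n] by (simp only: borel_open ss)
    show "(\<Union>n. prod.swap -` V n) = UNIV" using V(4) by (metis vimage_UN vimage_UNIV)
    fix W :: "('a \<times> 'b) set" and n and e :: real assume W: "open W" "W \<subseteq> prod.swap -` V n" "0 < e"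
    have "prod.swap -` W \<subseteq> V n" using W(2) by auto
    then have "emeasure (prodm N M) (prod.swap -` W) \<le> emeasure (prodm N M) (V n)"
      using V by (intro emeasure_mono) auto
    then have "emeasure (prodm N M) (prod.swap -` W) < \<infinity>" using V(3)[of n] by (rule le_less_trans)
    then obtain K where K: "compact K" "K \<subseteq> prod.swap -` W"
      "emeasure (prodm N M) (prod.swap -` W - K) \<le> ennreal e"
      using radon_inner_approx[OF moderate_radon[OF mod] oV[OF W(1)] _ W(3)] by blast
    have cK: "compact (prod.swap ` K)" using K c by (intro compact_continuous_image)
    have im: "prod.swap ` K = prod.swap -` K"
    proof (intro set_eqI iffI)
      fix z assume "z \<in> prod.swap -` K"
      then have "prod.swap (prod.swap z) \<in> prod.swap ` K" by (intro imageI) simp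
      then show "z \<in> prod.swap ` K" by simp
    qed auto
    have eq: "prod.swap -` (W - prod.swap ` K) = prod.swap -` W - K" unfolding im vimage_Diff ss ..
    have "W - prod.swap ` K \<in> sets borel"
      using W cK by (intro sets.Diff) (auto simp: compact_imp_closed)
    from em[OF this] have "emeasure (distr (prodm N M) borel prod.swap) (W - prod.swap ` K) \<le> ennreal e"
      using K(3) unfolding eq by simp
    moreover have "prod.swap ` K \<subseteq> W" using K(2) by auto
    ultimately show "\<exists>K. compact K \<and> K \<subseteq> W \<and> emeasure (distr (prodm N M) borel prod.swap) (W - K) \<le> ennreal e"
      using cK by (intro exI[of _ "prod.swap ` K"] conjI)
  qed simp
  then have "radon (distr (prodm N M) borel prod.swap)" by simp
  moreover have "emeasure (prodm M N) (U \<times> V) = emeasure (distr (prodm N M) borel prod.swap) (U \<times> V)"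
    if UV: "open U" "open V" for U :: "'a set" and V :: "'b set"
  proof -
    have "(prod.swap -` (U \<times> V) :: ('b \<times> 'a) set) = V \<times> U" by auto
    then have "emeasure (distr (prodm N M) borel prod.swap) (U \<times> V) = emeasure (prodm N M) (V \<times> U)"
      using em[of "U \<times> V"] open_Times[OF UV] by simp
    also have "\<dots> = emeasure N V * emeasure M U"
      using UV N by (intro emeasure_prodm_Times M) auto
    also have "\<dots> = emeasure (prodm M N) (U \<times> V)"
      using UV M by (subst emeasure_prodm_Times[OF _ N]) (auto simp: mult.commute)
    finally show ?thesis by simp
  qed
  ultimately show ?thesis
    using moderate_prodm[OF lc M N] by (intro radon_eq_rectangles) auto
qed

lemma moderate_Tonelli:
  fixes M :: "'a::t2_space measure" and N :: "'b::t2_space measure"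
  assumes lc: "locally_compact_space (euclidean :: 'a topology)" "locally_compact_space (euclidean :: 'b topology)"
    and M: "moderate M" and N: "moderate N" and f: "f \<in> borel_measurable borel"
  shows "(\<integral>\<^sup>+x. \<integral>\<^sup>+y. f (x, y) \<partial>N \<partial>M) = (\<integral>\<^sup>+y. \<integral>\<^sup>+x. f (x, y) \<partial>M \<partial>N)"
proof -
  have sw: "(prod.swap :: 'b \<times> 'a \<Rightarrow> 'a \<times> 'b) \<in> borel \<rightarrow>\<^sub>M borel"
    unfolding prod.swap_def by (intro borel_measurable_continuous_onI continuous_intros)
  then have fs: "(\<lambda>z. f (prod.swap z)) \<in> borel_measurable borel" using f by (rule measurable_compose)
  have "(\<integral>\<^sup>+x. \<integral>\<^sup>+y. f (x, y) \<partial>N \<partial>M) = (\<integral>\<^sup>+z. f z \<partial>prodm M N)"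
    by (rule nn_integral_prodm(2)[OF moderate_sets[OF M] N f, symmetric])
  also have "\<dots> = (\<integral>\<^sup>+z. f (prod.swap z) \<partial>prodm N M)"
    unfolding prodm_swap[OF lc M N]
    by (rule nn_integral_distr) (simp_all add: measurable_cong_sets[OF sets_prodm refl] sw f)
  also have "\<dots> = (\<integral>\<^sup>+y. \<integral>\<^sup>+x. f (x, y) \<partial>M \<partial>N)"
    unfolding nn_integral_prodm(2)[OF moderate_sets[OF N] M fs] by simp
  finally show ?thesis .
qed

section \<open>Mutual energies and the Gram inequality\<close>

definition iter :: "('a \<times> 'b \<Rightarrow> ennreal) \<Rightarrow> 'a measure \<Rightarrow> 'b measure \<Rightarrow> ennreal" where
  "iter k M N = (\<integral>\<^sup>+x. \<integral>\<^sup>+y. k (x, y) \<partial>N \<partial>M)"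

lemma borel_measurable_section:
  fixes k :: "'a::t2_space \<times> 'b::t2_space \<Rightarrow> 'c::topological_space"
  shows "k \<in> borel_measurable borel \<Longrightarrow> (\<lambda>y. k (x, y)) \<in> borel_measurable borel"
  by (rule measurable_compose[OF measurable_Pair_borel])

lemma iter_lincomb_left:
  fixes m :: "'j \<Rightarrow> 'a::t2_space measure" and N :: "'b::t2_space measure"
  assumes k: "k \<in> borel_measurable borel" and N: "moderate N"
    and m: "\<And>j. j \<in> J \<Longrightarrow> moderate (m j)"
  shows "iter k (lincomb J c m) N = (\<Sum>j\<in>J. ennreal (c j) * iter k (m j) N)"
  unfolding iter_def
  by (rule nn_integral_lincomb[OF moderate_sets[OF m] nn_integral_prodm(1)[OF sets_lincomb[of J c m] N k]])

lemma iter_lincomb_right: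
  fixes m :: "'j \<Rightarrow> 'b::t2_space measure" and M :: "'a::t2_space measure"
  assumes k: "k \<in> borel_measurable borel" and M: "moderate M"
    and m: "\<And>j. j \<in> J \<Longrightarrow> moderate (m j)"
  shows "iter k M (lincomb J c m) = (\<Sum>j\<in>J. ennreal (c j) * iter k M (m j))"
proof -
  have meas: "(\<lambda>x. \<integral>\<^sup>+y. k (x, y) \<partial>m j) \<in> borel_measurable M" if "j \<in> J" for j
    using nn_integral_prodm(1)[OF moderate_sets[OF M] m[OF that] k]
      measurable_cong_sets[OF moderate_sets[OF M] refl] by blast
  have "iter k M (lincomb J c m) = (\<integral>\<^sup>+x. (\<Sum>j\<in>J. ennreal (c j) * (\<integral>\<^sup>+y. k (x, y) \<partial>m j)) \<partial>M)"
    unfolding iter_def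
    by (intro nn_integral_cong nn_integral_lincomb[OF moderate_sets[OF m]] borel_measurable_section[OF k])
  also have "\<dots> = (\<Sum>j\<in>J. \<integral>\<^sup>+x. ennreal (c j) * (\<integral>\<^sup>+y. k (x, y) \<partial>m j) \<partial>M)"
    using meas by (intro nn_integral_sum) simp
  also have "\<dots> = (\<Sum>j\<in>J. ennreal (c j) * iter k M (m j))"
    unfolding iter_def by (intro sum.cong refl nn_integral_cmult meas)
  finally show ?thesis .
qed

lemma iter_mono_measure:
  assumes "sets M' = sets M" "M' \<le> M" "sets N' = sets N" "N' \<le> N"
  shows "iter k M' N' \<le> iter k M N"
proof -
  have "iter k M' N' \<le> (\<integral>\<^sup>+x. \<integral>\<^sup>+y. k (x, y) \<partial>N \<partial>M')"
    unfolding iter_def using assms by (intro nn_integral_mono nn_integral_mono_measure)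
  also have "\<dots> \<le> iter k M N"
    unfolding iter_def using assms by (intro nn_integral_mono_measure)
  finally show ?thesis .
qed

lemma nn_integral_null_measure_borel: "(\<integral>\<^sup>+x. f x \<partial>null_measure M) = 0"
  by (simp add: nn_integral_null_measure)

text \<open>The zero measure pads a single measure to a family.\<close>

lemma moderate_null_measure: "moderate (null_measure (borel :: 'a::t2_space measure))"
proof (rule moderateI)
  show "incseq (\<lambda>n::nat. UNIV :: 'a set)" by (simp add: incseq_def)
  show "\<exists>K. compact K \<and> K \<subseteq> W' \<and> emeasure (null_measure borel) (W' - K) \<le> ennreal e" for W' :: "'a set" and e
    by (intro exI[of _ "{}"]) simp
qed simp_all

lemma enn2ereal_eq_enn2real: "x < \<infinity> \<Longrightarrow> enn2ereal x = ereal (enn2real x)"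
  by (cases x) (simp_all add: enn2ereal_ennreal)

locale lc_kernel =
  fixes \<kappa> :: "'x::t2_space \<times> 'x \<Rightarrow> ereal"
  assumes lc: "locally_compact_space (euclidean :: 'x topology)"
    and ker: "is_kernel \<kappa>"
    and pd: "positive_definite \<kappa>"
begin

definition kpos :: "'x \<times> 'x \<Rightarrow> ennreal" where "kpos z = e2ennreal (\<kappa> z)"
definition kneg :: "'x \<times> 'x \<Rightarrow> ennreal" where "kneg z = e2ennreal (- \<kappa> z)"

lemma borel_measurable_kernel: "\<kappa> \<in> borel_measurable borel"
proof -
  have "lsc \<kappa>" using ker by (simp add: is_kernel_def Phi_def)
  then show ?thesis by (rule lsc_borel_measurable)
qed

lemma kpos_meas: "kpos \<in> borel_measurable borel" and kneg_meas: "kneg \<in> borel_measurable borel"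
  unfolding kpos_def kneg_def using borel_measurable_kernel by measurable

lemma kernel_sym: "\<kappa> (x, y) = \<kappa> (y, x)"
  using pd unfolding positive_definite_def by blast

text \<open>This dichotomy controls all negative parts: either they vanish, or all measures and index sets in question
are finite.\<close>

lemma kernel_nonneg_or_compact: "(\<forall>z. 0 \<le> \<kappa> z) \<or> compact (UNIV :: 'x set)"
proof (cases "\<forall>z. 0 \<le> \<kappa> z")
  case False
  then have "compact (UNIV :: ('x \<times> 'x) set)" using ker by (auto simp: is_kernel_def Phi_def)
  then have "compact (range (fst :: 'x \<times> 'x \<Rightarrow> 'x))"
    by (intro compact_continuous_image continuous_intros)
  then show ?thesis by simp
qed simp

lemma iter_sym:
  assumes "moderate M" "moderate N"
  shows "iter kpos M N = iter kpos N M" "iter kneg M N = iter kneg N M"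
  using moderate_Tonelli[OF lc lc assms kpos_meas] moderate_Tonelli[OF lc lc assms kneg_meas]
  unfolding iter_def kpos_def kneg_def kernel_sym[of _ "_ :: 'x"] by (simp_all add: kernel_sym)

lemma iter_kneg_nonneg: "(\<And>z. 0 \<le> \<kappa> z) \<Longrightarrow> iter kneg M N = 0"
  by (simp add: iter_def kneg_def e2ennreal_neg)

text \<open>A kernel with negative values lives on a compact space, where it is bounded below and Radon measures are
finite.\<close>

lemma iter_kneg_finite:
  assumes M: "moderate M" and N: "moderate N"
  shows "iter kneg M N < \<infinity>"
proof (cases "\<forall>z. 0 \<le> \<kappa> z")
  case True
  show ?thesis unfolding iter_kneg_nonneg[OF spec[OF True]] by simp
next
  case False
  obtain c :: real where c: "\<And>z. - ereal c \<le> \<kappa> z" "0 \<le> c"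
    by (rule Phi_bounded_below[OF ker[unfolded is_kernel_def] False]) auto
  have cU: "compact (UNIV :: 'x set)" using False kernel_nonneg_or_compact by blast
  have kneg_le: "kneg z \<le> ennreal c" for z
  proof -
    have "- \<kappa> z \<le> ereal c" using c(1)[of z] by (simp add: ereal_uminus_le_reorder)
    then have "kneg z \<le> e2ennreal (ereal c)" unfolding kneg_def by (rule e2ennreal_mono)
    then show ?thesis by (simp add: e2ennreal_ereal)
  qed
  have "iter kneg M N \<le> (\<integral>\<^sup>+x. \<integral>\<^sup>+y. ennreal c \<partial>N \<partial>M)"
    unfolding iter_def by (intro nn_integral_mono kneg_le)
  also have "\<dots> = ennreal c * emeasure N UNIV * emeasure M UNIV"
    using M N by simp
  also have "\<dots> < \<infinity>"
    using radon_compact_finite[OF moderate_radon[OF M] cU] radon_compact_finite[OF moderate_radon[OF N] cU]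
    by (simp add: ennreal_mult_less_top)
  finally show ?thesis .
qed

text \<open>The mutual energy as a real number. It is meaningful only if the integral of the positive part is finite;
\<open>enn2real\<close> sends \<open>\<infinity>\<close> to zero.\<close>

definition K :: "'x measure \<Rightarrow> 'x measure \<Rightarrow> real" where
  "K M N = enn2real (iter kpos M N) - enn2real (iter kneg M N)"

lemma mutual_eq:
  assumes M: "moderate M" and N: "moderate N"
  shows "mutual \<kappa> M N = enn2ereal (iter kpos M N) - enn2ereal (iter kneg M N)"
  using nn_integral_prodm(2)[OF moderate_sets[OF M] N kpos_meas]
    nn_integral_prodm(2)[OF moderate_sets[OF M] N kneg_meas]
  unfolding mutual_def radon_prod_eq_prodm[OF lc lc M N] eint_def kpos_def kneg_def iter_def by simp

lemma mutual_eq_K: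
  assumes M: "moderate M" and N: "moderate N" and fin: "iter kpos M N < \<infinity>"
  shows "mutual \<kappa> M N = ereal (K M N)"
  unfolding mutual_eq[OF M N] K_def enn2ereal_eq_enn2real[OF fin] enn2ereal_eq_enn2real[OF iter_kneg_finite[OF M N]]
  by simp

lemma mutual_eq_infinity:
  assumes M: "moderate M" and N: "moderate N" and inf: "iter kpos M N = \<infinity>"
  shows "mutual \<kappa> M N = \<infinity>"
  unfolding mutual_eq[OF M N] inf enn2ereal_eq_enn2real[OF iter_kneg_finite[OF M N]]
  by simp

lemma iter_kpos_finite_iff:
  assumes M: "moderate M" and N: "moderate N"
  shows "iter kpos M N < \<infinity> \<longleftrightarrow> \<bar>mutual \<kappa> M N\<bar> \<noteq> \<infinity>"
proof (cases "iter kpos M N = \<infinity>")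
  case True
  then show ?thesis using mutual_eq_infinity[OF M N True] by simp
next
  case False
  then have "iter kpos M N < \<infinity>" by (simp add: less_top)
  then show ?thesis using mutual_eq_K[OF M N] by simp
qed

definition finite_energy :: "'x measure \<Rightarrow> bool" where
  "finite_energy M \<longleftrightarrow> moderate M \<and> iter kpos M M < \<infinity>"

lemma finite_energyD: "finite_energy M \<Longrightarrow> moderate M" "finite_energy M \<Longrightarrow> iter kpos M M < \<infinity>"
  by (simp_all add: finite_energy_def)

abbreviation msum :: "'x measure \<Rightarrow> 'x measure \<Rightarrow> 'x measure" where
  "msum P C \<equiv> lincomb UNIV (\<lambda>_. 1) (\<lambda>b. if b then P else C)"

lemma iter_msum:
  assumes "k \<in> borel_measurable borel" "moderate P" "moderate C" "moderate N"
  shows "iter k (msum P C) N = iter k P N + iter k C N"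
    and "iter k N (msum P C) = iter k N P + iter k N C"
proof -
  have m: "moderate (if b then P else C)" for b using assms(2,3) by simp
  show "iter k (msum P C) N = iter k P N + iter k C N"
    unfolding iter_lincomb_left[OF assms(1,4) m] by (simp add: UNIV_bool add.commute)
  show "iter k N (msum P C) = iter k N P + iter k N C"
    unfolding iter_lincomb_right[OF assms(1,4) m] by (simp add: UNIV_bool add.commute)
qed

lemma moderate_msum: "moderate P \<Longrightarrow> moderate C \<Longrightarrow> moderate (msum P C)"
  by (intro moderate_lincomb) simp_all

lemma K_msum:
  assumes P: "moderate P" and C: "moderate C" and N: "moderate N"
    and fin: "iter kpos P N < \<infinity>" "iter kpos C N < \<infinity>"
  shows "K (msum P C) N = K P N + K C N"
  unfolding K_def iter_msum(1)[OF kpos_meas P C N] iter_msum(1)[OF kneg_meas P C N]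
  using fin iter_kneg_finite[OF P N] iter_kneg_finite[OF C N]
  by (simp add: enn2real_plus)

lemma K_sym: "moderate M \<Longrightarrow> moderate N \<Longrightarrow> K M N = K N M"
  unfolding K_def using iter_sym[of M N] by simp

lemma finite_energy_msumD:
  assumes P: "moderate P" and C: "moderate C" and fin: "finite_energy (msum P C)"
  shows "finite_energy P" "finite_energy C" "iter kpos P C < \<infinity>" "iter kpos C P < \<infinity>"
proof -
  note PC = moderate_msum[OF P C]
  have "iter kpos (msum P C) (msum P C) = (iter kpos P P + iter kpos P C) + (iter kpos C P + iter kpos C C)"
    unfolding iter_msum(1)[OF kpos_meas P C PC] iter_msum(2)[OF kpos_meas P C P] iter_msum(2)[OF kpos_meas P C C] ..
  then have "(iter kpos P P + iter kpos P C) + (iter kpos C P + iter kpos C C) < \<infinity>" using finite_energyD(2)[OF fin] by simp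
  then show "finite_energy P" "finite_energy C" "iter kpos P C < \<infinity>" "iter kpos C P < \<infinity>"
    using P C by (simp_all add: finite_energy_def)
qed

text \<open>Positive definiteness for the difference of two positive measures. Split \<open>M = P + C\<close> and
\<open>N = Q + C\<close> with \<open>P\<close> and \<open>Q\<close> singular; the energies of \<open>P\<close>, \<open>Q\<close>, \<open>C\<close> are finite
since \<open>M\<close> and \<open>N\<close> have finite energy and negative parts are finite anyway. So the energy of
\<open>(P, Q)\<close> is defined and nonnegative, which would fail if \<open>\<kappa>(P, Q)\<close> were infinite. Expanding
\<open>\<kappa>(M, N)\<close> shows that it is finite, and \<open>C\<close> drops out of
\<open>\<kappa>(M, M) + \<kappa>(N, N) - 2 \<kappa>(M, N)\<close>.\<close>

lemma pair_energy:
  assumes M: "finite_energy M" and N: "finite_energy N"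
  shows "iter kpos M N < \<infinity>" and "2 * K M N \<le> K M M + K N N"
proof -
  note mM = finite_energyD(1)[OF M] and mN = finite_energyD(1)[OF N]
  obtain P Q C where sr: "(P, Q) \<in> signed_radon"
    and P: "moderate P" and Q: "moderate Q" and C: "moderate C"
    and MPC: "M = msum P C" and NQC: "N = msum Q C"
    by (rule radon_diff_Jordan[OF mM mN])
  note M' = finite_energy_msumD[OF P C M[unfolded MPC]] and N' = finite_energy_msumD[OF Q C N[unfolded NQC]]
  note PP = mutual_eq_K[OF P P finite_energyD(2)[OF M'(1)]] and QQ = mutual_eq_K[OF Q Q finite_energyD(2)[OF N'(1)]]
  have def: "signed_mutual_defined \<kappa> (P, Q) (P, Q)"
    unfolding signed_mutual_defined_def fst_conv snd_conv PP QQ by simp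
  then have nonneg: "0 \<le> signed_mutual \<kappa> (P, Q) (P, Q)"
    using pd sr unfolding positive_definite_def by blast
  \<comment> \<open>An infinite mixed energy would make the energy of \<open>(P, Q)\<close> equal to \<open>-\<infinity>\<close>.\<close>
  have PQ: "iter kpos P Q < \<infinity>"
  proof (rule ccontr)
    assume "\<not> iter kpos P Q < \<infinity>"
    then have PQi: "iter kpos P Q = \<infinity>" by (metis infinity_ennreal_def top.not_eq_extremum)
    have "signed_mutual \<kappa> (P, Q) (P, Q) = -\<infinity>"
      unfolding signed_mutual_def fst_conv snd_conv PP QQ mutual_eq_infinity[OF P Q PQi]
        mutual_eq_infinity[OF Q P PQi[unfolded iter_sym(1)[OF P Q]]]
      by simp
    with nonneg show False by simp
  qed
  have QP: "iter kpos Q P < \<infinity>" using PQ iter_sym(1)[OF P Q] by simp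
  have le: "K P Q + K Q P \<le> K P P + K Q Q"
    using nonneg unfolding signed_mutual_def fst_conv snd_conv PP QQ mutual_eq_K[OF P Q PQ] mutual_eq_K[OF Q P QP]
    by simp
  note finC = M'(3,4) N'(3,4) finite_energyD(2)[OF M'(2)] finite_energyD(2)[OF M'(1)] finite_energyD(2)[OF N'(1)]
  have fin2: "iter kpos P N < \<infinity>" "iter kpos C N < \<infinity>" "iter kpos P M < \<infinity>" "iter kpos C M < \<infinity>"
    "iter kpos Q N < \<infinity>"
    unfolding NQC MPC iter_msum(2)[OF kpos_meas Q C P] iter_msum(2)[OF kpos_meas Q C C]
      iter_msum(2)[OF kpos_meas P C P] iter_msum(2)[OF kpos_meas P C C] iter_msum(2)[OF kpos_meas Q C Q]
    using PQ finC by simp_all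
  show "iter kpos M N < \<infinity>"
    unfolding MPC iter_msum(1)[OF kpos_meas P C mN] using fin2 by simp
  have r: "K X M = K X P + K X C" if "moderate X" "iter kpos X P < \<infinity>" "iter kpos X C < \<infinity>" for X
    unfolding K_sym[OF that(1) mM] K_sym[OF that(1) P] K_sym[OF that(1) C] unfolding MPC
    using that iter_sym(1)[OF that(1)] P C by (intro K_msum) simp_all
  have r': "K X N = K X Q + K X C" if "moderate X" "iter kpos X Q < \<infinity>" "iter kpos X C < \<infinity>" for X
    unfolding K_sym[OF that(1) mN] K_sym[OF that(1) Q] K_sym[OF that(1) C] unfolding NQC
    using that iter_sym(1)[OF that(1)] Q C by (intro K_msum) simp_all
  have MM: "K M M = (K P P + K P C) + (K C P + K C C)"
    using K_msum[OF P C mM fin2(3,4)] r[OF P] r[OF C] finC unfolding MPC[symmetric] by simp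
  have NN: "K N N = (K Q Q + K Q C) + (K C Q + K C C)"
    using K_msum[OF Q C mN fin2(5,2)] r'[OF Q] r'[OF C] finC unfolding NQC[symmetric] by simp
  have MN: "K M N = (K P Q + K P C) + (K C Q + K C C)"
    using K_msum[OF P C mN fin2(1,2)] r'[OF P] r'[OF C] finC PQ unfolding MPC[symmetric] by simp
  show "2 * K M N \<le> K M M + K N N"
    unfolding MM NN MN using le K_sym[OF P Q] K_sym[OF P C] K_sym[OF Q C] by simp
qed

lemma K_lincomb_left:
  assumes J: "finite J" and m: "\<And>j. j \<in> J \<Longrightarrow> finite_energy (m j)" and N: "finite_energy N" and c: "\<And>j. j \<in> J \<Longrightarrow> 0 \<le> c j"
  shows "K (lincomb J c m) N = (\<Sum>j\<in>J. c j * K (m j) N)"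
proof -
  have e: "enn2real (\<Sum>j\<in>J. ennreal (c j) * u j) = (\<Sum>j\<in>J. c j * enn2real (u j))"
    if "\<And>j. j \<in> J \<Longrightarrow> u j < \<infinity>" for u
    using that c by (subst enn2real_sum) (auto simp: ennreal_mult_less_top enn2real_mult intro!: sum.cong)
  have "iter kpos (lincomb J c m) N = (\<Sum>j\<in>J. ennreal (c j) * iter kpos (m j) N)"
    by (rule iter_lincomb_left[OF kpos_meas finite_energyD(1)[OF N]]) (rule finite_energyD(1)[OF m])
  moreover have "iter kneg (lincomb J c m) N = (\<Sum>j\<in>J. ennreal (c j) * iter kneg (m j) N)"
    by (rule iter_lincomb_left[OF kneg_meas finite_energyD(1)[OF N]]) (rule finite_energyD(1)[OF m])
  ultimately have "K (lincomb J c m) N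
      = (\<Sum>j\<in>J. c j * enn2real (iter kpos (m j) N)) - (\<Sum>j\<in>J. c j * enn2real (iter kneg (m j) N))"
    unfolding K_def
    using e[of "\<lambda>j. iter kpos (m j) N", OF pair_energy(1)[OF m N]]
      e[of "\<lambda>j. iter kneg (m j) N", OF iter_kneg_finite[OF finite_energyD(1)[OF m] finite_energyD(1)[OF N]]] by simp
  then show ?thesis unfolding K_def by (simp add: right_diff_distrib sum_subtractf)
qed

lemma finite_energy_lincomb:
  assumes J: "finite J" and m: "\<And>j. j \<in> J \<Longrightarrow> finite_energy (m j)"
  shows "finite_energy (lincomb J c m)"
proof -
  have mod: "moderate (lincomb J c m)" by (rule moderate_lincomb[OF J finite_energyD(1)[OF m]])
  have "iter kpos (m i) (lincomb J c m) < \<infinity>" if "i \<in> J" for i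
  proof -
    have "iter kpos (m i) (lincomb J c m) = (\<Sum>j\<in>J. ennreal (c j) * iter kpos (m i) (m j))"
      by (rule iter_lincomb_right[OF kpos_meas finite_energyD(1)[OF m[OF that]]]) (rule finite_energyD(1)[OF m])
    then show ?thesis using J pair_energy(1)[OF m[OF that] m] by (simp add: ennreal_mult_less_top)
  qed
  moreover have "iter kpos (lincomb J c m) (lincomb J c m) = (\<Sum>i\<in>J. ennreal (c i) * iter kpos (m i) (lincomb J c m))"
    by (rule iter_lincomb_left[OF kpos_meas mod]) (rule finite_energyD(1)[OF m])
  ultimately have "iter kpos (lincomb J c m) (lincomb J c m) < \<infinity>"
    using J by (simp add: ennreal_mult_less_top)
  with mod show ?thesis by (simp add: finite_energy_def)
qed

lemma K_lincomb:
  assumes J: "finite J" and m: "\<And>j. j \<in> J \<Longrightarrow> finite_energy (m j)" and c: "\<And>j. j \<in> J \<Longrightarrow> 0 \<le> c j"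
    and I: "finite I" and n: "\<And>i. i \<in> I \<Longrightarrow> finite_energy (n i)" and d: "\<And>i. i \<in> I \<Longrightarrow> 0 \<le> d i"
  shows "K (lincomb J c m) (lincomb I d n) = (\<Sum>j\<in>J. \<Sum>i\<in>I. c j * d i * K (m j) (n i))"
proof -
  have fL: "finite_energy (lincomb I d n)" by (rule finite_energy_lincomb[OF I]) (rule n)
  have "K (m j) (lincomb I d n) = (\<Sum>i\<in>I. d i * K (m j) (n i))" if "j \<in> J" for j
  proof -
    have "K (m j) (lincomb I d n) = K (lincomb I d n) (m j)"
      by (rule K_sym[OF finite_energyD(1)[OF m[OF that]] finite_energyD(1)[OF fL]])
    also have "\<dots> = (\<Sum>i\<in>I. d i * K (n i) (m j))"
      by (rule K_lincomb_left[OF I _ m[OF that]]) (simp_all add: n d)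
    also have "\<dots> = (\<Sum>i\<in>I. d i * K (m j) (n i))"
      using K_sym[OF finite_energyD(1)[OF n] finite_energyD(1)[OF m[OF that]]] by (intro sum.cong refl) simp
    finally show ?thesis .
  qed
  moreover have "K (lincomb J c m) (lincomb I d n) = (\<Sum>j\<in>J. c j * K (m j) (lincomb I d n))"
    by (rule K_lincomb_left[OF J _ fL]) (simp_all add: m c)
  ultimately show ?thesis by (simp add: sum_distrib_left mult.assoc)
qed

text \<open>Collecting the terms with positive and those with negative coefficients turns the sum into
\<open>\<kappa>(P, P) + \<kappa>(N, N) - 2 \<kappa>(P, N)\<close> for two positive measures of finite energy.\<close>

lemma gram_nonneg:
  assumes J: "finite J" and m: "\<And>j. j \<in> J \<Longrightarrow> finite_energy (m j)"
  shows "0 \<le> (\<Sum>i\<in>J. \<Sum>j\<in>J. c i * c j * K (m i) (m j))"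
proof -
  define p where "p j = max (c j) 0" for j
  define n where "n j = max (- c j) 0" for j
  have pn: "0 \<le> p j" "0 \<le> n j" "c j = p j - n j" for j by (auto simp: p_def n_def)
  have exp: "K (lincomb J u m) (lincomb J v m) = (\<Sum>i\<in>J. \<Sum>j\<in>J. u i * v j * K (m i) (m j))"
    if "\<And>j. 0 \<le> u j" "\<And>j. 0 \<le> v j" for u v
    by (rule K_lincomb) (simp_all add: J m that)
  have "(\<Sum>i\<in>J. \<Sum>j\<in>J. n i * p j * K (m i) (m j)) = (\<Sum>j\<in>J. \<Sum>i\<in>J. n i * p j * K (m i) (m j))"
    by (rule sum.swap)
  also have "\<dots> = (\<Sum>i\<in>J. \<Sum>j\<in>J. p i * n j * K (m i) (m j))"
    by (intro sum.cong refl) (simp add: K_sym[OF finite_energyD(1)[OF m] finite_energyD(1)[OF m]] mult.commute)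
  finally have sw: "(\<Sum>i\<in>J. \<Sum>j\<in>J. n i * p j * K (m i) (m j)) = (\<Sum>i\<in>J. \<Sum>j\<in>J. p i * n j * K (m i) (m j))" .
  have "(\<Sum>i\<in>J. \<Sum>j\<in>J. c i * c j * K (m i) (m j))
      = (\<Sum>i\<in>J. \<Sum>j\<in>J. p i * p j * K (m i) (m j)) + (\<Sum>i\<in>J. \<Sum>j\<in>J. n i * n j * K (m i) (m j))
        - (\<Sum>i\<in>J. \<Sum>j\<in>J. p i * n j * K (m i) (m j)) - (\<Sum>i\<in>J. \<Sum>j\<in>J. n i * p j * K (m i) (m j))"
    unfolding pn(3) sum.distrib[symmetric] sum_subtractf[symmetric]
    by (intro sum.cong refl) (simp add: algebra_simps)
  also have "\<dots> = K (lincomb J p m) (lincomb J p m) + K (lincomb J n m) (lincomb J n m)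
      - 2 * K (lincomb J p m) (lincomb J n m)"
    unfolding sw exp[OF pn(1) pn(1)] exp[OF pn(2) pn(2)] exp[OF pn(1) pn(2)] by simp
  finally show ?thesis
    using pair_energy(2)[OF finite_energy_lincomb[of J m p] finite_energy_lincomb[of J m n]] J m by simp
qed

text \<open>The common parts of \<open>M, N\<close> and of \<open>M', N'\<close> cancel in the bilinear expansion.\<close>

lemma signed_mutual_radon_diff:
  assumes M: "finite_energy M" and N: "finite_energy N" and M': "finite_energy M'" and N': "finite_energy N'"
  shows "signed_mutual \<kappa> (radon_diff M N) (radon_diff M' N')
    = ereal (K M M' - K M N' - K N M' + K N N')"
proof -
  obtain P Q C where d: "radon_diff M N = (P, Q)"
    and P: "moderate P" and Q: "moderate Q" and C: "moderate C"
    and MPC: "M = msum P C" and NQC: "N = msum Q C"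
    by (rule radon_diff_Jordan[OF finite_energyD(1)[OF M] finite_energyD(1)[OF N]])
  obtain P' Q' C' where d': "radon_diff M' N' = (P', Q')"
    and P': "moderate P'" and Q': "moderate Q'" and C': "moderate C'"
    and MPC': "M' = msum P' C'" and NQC': "N' = msum Q' C'"
    by (rule radon_diff_Jordan[OF finite_energyD(1)[OF M'] finite_energyD(1)[OF N']])
  note f = finite_energy_msumD(1,2)[OF P C M[unfolded MPC]] finite_energy_msumD(1)[OF Q C N[unfolded NQC]]
    finite_energy_msumD(1,2)[OF P' C' M'[unfolded MPC']] finite_energy_msumD(1)[OF Q' C' N'[unfolded NQC']]
  have l: "K (msum X Y) Z = K X Z + K Y Z" if "finite_energy X" "finite_energy Y" "finite_energy Z" for X Y Z
    by (rule K_msum[OF finite_energyD(1)[OF that(1)] finite_energyD(1)[OF that(2)] finite_energyD(1)[OF that(3)]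
        pair_energy(1)[OF that(1,3)] pair_energy(1)[OF that(2,3)]])
  have fm: "finite_energy (msum X Y)" if "finite_energy X" "finite_energy Y" for X Y using that by (intro finite_energy_lincomb) auto
  have r: "K Z (msum X Y) = K Z X + K Z Y" if "finite_energy X" "finite_energy Y" "finite_energy Z" for X Y Z
    using l[OF that] K_sym[OF finite_energyD(1)[OF that(3)] finite_energyD(1)[OF fm[OF that(1,2)]]]
      K_sym[OF finite_energyD(1)[OF that(3)] finite_energyD(1)[OF that(1)]] K_sym[OF finite_energyD(1)[OF that(3)] finite_energyD(1)[OF that(2)]] by simp
  have m: "mutual \<kappa> X Y = ereal (K X Y)" if "finite_energy X" "finite_energy Y" for X Y
    by (rule mutual_eq_K[OF finite_energyD(1)[OF that(1)] finite_energyD(1)[OF that(2)] pair_energy(1)[OF that]])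
  have "signed_mutual \<kappa> (P, Q) (P', Q') = ereal (K P P' + K Q Q' - (K P Q' + K Q P'))"
    unfolding signed_mutual_def fst_conv snd_conv using f by (simp add: m)
  also have "K P P' + K Q Q' - (K P Q' + K Q P') = K M M' - K M N' - K N M' + K N N'"
    unfolding MPC NQC MPC' NQC' using f by (simp add: l r fm)
  finally show ?thesis unfolding d d' .
qed

lemma finite_energy_submeasure:
  assumes M: "finite_energy M" and Q: "sets Q = sets borel" and le: "\<And>E. E \<in> sets borel \<Longrightarrow> emeasure Q E \<le> emeasure M E"
  shows "finite_energy Q"
proof -
  have mod: "moderate Q" by (rule moderate_submeasure[OF finite_energyD(1)[OF M] Q le])
  have sets: "sets Q = sets M" using Q finite_energyD(1)[OF M] by simp
  have "Q \<le> M" using le Q sets by (intro le_measure[THEN iffD2]) (auto simp: le_fun_def)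
  then have "iter kpos Q Q \<le> iter kpos M M" by (intro iter_mono_measure sets)
  then show ?thesis using finite_energyD(2)[OF M] mod unfolding finite_energy_def by (auto intro: le_less_trans)
qed

lemma finite_energy_null: "finite_energy (null_measure borel)"
  and K_null: "K (null_measure borel) N = 0" "K N (null_measure borel) = 0"
  by (simp_all add: finite_energy_def K_def iter_def moderate_null_measure nn_integral_null_measure_borel)

end

section \<open>Families of measures and their quadratic form\<close>

lemma filterlim_square_finite_subsets:
  "filterlim (\<lambda>G. G \<times> G) (finite_subsets_at_top (I \<times> I)) (finite_subsets_at_top I)"
  unfolding filterlim_def le_filter_def eventually_filtermap
proof (intro allI impI)
  fix P assume "eventually P (finite_subsets_at_top (I \<times> I))"
  then obtain X where "finite X \<and> X \<subseteq> I \<times> I \<and> (\<forall>Y. finite Y \<and> X \<subseteq> Y \<and> Y \<subseteq> I \<times> I \<longrightarrow> P Y)"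
    unfolding eventually_finite_subsets_at_top ..
  then have X: "finite X" "X \<subseteq> I \<times> I"
    and XP: "\<forall>Y. finite Y \<and> X \<subseteq> Y \<and> Y \<subseteq> I \<times> I \<longrightarrow> P Y" by simp_all
  have "P (Y \<times> Y)" if "finite Y" "fst ` X \<union> snd ` X \<subseteq> Y" "Y \<subseteq> I" for Y
  proof (rule XP[rule_format], intro conjI)
    show "finite (Y \<times> Y)" using that(1) by simp
    have "X \<subseteq> fst ` X \<times> snd ` X" by (rule subset_fst_snd)
    also have "\<dots> \<subseteq> Y \<times> Y" using that(2) by (intro Sigma_mono) simp_all
    finally show "X \<subseteq> Y \<times> Y" .
    show "Y \<times> Y \<subseteq> I \<times> I" using that(3) by (intro Sigma_mono)
  qed
  moreover have "finite (fst ` X \<union> snd ` X)" using X(1) by simp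
  moreover have "fst ` X \<union> snd ` X \<subseteq> I" using X(2) by auto
  ultimately show "eventually (\<lambda>G. P (G \<times> G)) (finite_subsets_at_top I)"
    unfolding eventually_finite_subsets_at_top by (intro exI[of _ "fst ` X \<union> snd ` X"] conjI allI impI) simp_all
qed

text \<open>Unconditional double sums are limits along finite squares, on which Gram inequalities hold.\<close>

lemma tendsto_sum_squares:
  fixes f :: "'i \<times> 'i \<Rightarrow> real"
  assumes "f summable_on I \<times> I"
  shows "((\<lambda>G. sum f (G \<times> G)) \<longlongrightarrow> infsum f (I \<times> I)) (finite_subsets_at_top I)"
proof -
  have "(f has_sum infsum f (I \<times> I)) (I \<times> I)" using assms by (rule has_sum_infsum)
  then have "(sum f \<longlongrightarrow> infsum f (I \<times> I)) (finite_subsets_at_top (I \<times> I))"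
    unfolding has_sum_def .
  then show ?thesis by (rule filterlim_compose[OF _ filterlim_square_finite_subsets])
qed

lemma summable_on_real_bound:
  fixes f g :: "'i \<Rightarrow> real"
  assumes "g summable_on S" "\<And>x. x \<in> S \<Longrightarrow> \<bar>f x\<bar> \<le> \<bar>g x\<bar>"
  shows "f summable_on S"
  using assms(1) unfolding summable_on_iff_integrable_count_space
  by (rule Bochner_Integration.integrable_bound) (use assms(2) in \<open>auto simp: AE_count_space\<close>)

lemma infsum_eq_integral_count_space:
  fixes f :: "'i \<Rightarrow> real"
  assumes "f summable_on S"
  shows "infsum f S = (\<integral>x. f x \<partial>count_space S)"
proof -
  have "Infinite_Set_Sum.abs_summable_on f S"
    using assms unfolding summable_on_iff_integrable_count_space Infinite_Set_Sum.abs_summable_on_def .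
  then show ?thesis using infsetsum_infsum[of f S] unfolding infsetsum_def by simp
qed

text \<open>The first order condition at a minimum: for small \<open>t\<close> of the sign opposite to \<open>b\<close> the linear term would
dominate.\<close>

lemma linear_coeff_zero:
  fixes b c :: real
  assumes "\<And>t. 0 \<le> 2 * t * b + t\<^sup>2 * c"
  shows "b = 0"
proof (rule ccontr)
  assume "b \<noteq> 0"
  define d where "d = \<bar>c\<bar> + 1"
  have d: "0 < d" "c < d" by (auto simp: d_def)
  have "0 \<le> 2 * (- b / d) * b + (- b / d)\<^sup>2 * c" by (rule assms)
  also have "2 * (- b / d) * b + (- b / d)\<^sup>2 * c = (b\<^sup>2 / d\<^sup>2) * (c - 2 * d)"
    using d by (simp add: field_simps power2_eq_square)
  finally have "0 \<le> (b\<^sup>2 / d\<^sup>2) * (c - 2 * d)" .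
  moreover have "0 < b\<^sup>2 / d\<^sup>2" using \<open>b \<noteq> 0\<close> d by simp
  ultimately have "0 \<le> c - 2 * d" using mult_pos_neg[of "b\<^sup>2 / d\<^sup>2" "c - 2 * d"] by linarith
  with d show False by simp
qed

context lc_kernel
begin

lemma K_nonneg: "(\<And>z. 0 \<le> \<kappa> z) \<Longrightarrow> 0 \<le> K M N"
  by (simp add: K_def iter_kneg_nonneg)

text \<open>For real series unconditional and absolute summability coincide, so this is the finiteness condition that
defines the space of vector measures of finite energy.\<close>

definition energy_family :: "'i set \<Rightarrow> ('i \<Rightarrow> 'x measure) \<Rightarrow> bool" where
  "energy_family I \<rho> \<longleftrightarrow> (\<forall>i\<in>I. finite_energy (\<rho> i)) \<and> (\<lambda>(i, j). K (\<rho> i) (\<rho> j)) summable_on I \<times> I"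

lemma energy_family_fe: "energy_family I \<rho> \<Longrightarrow> i \<in> I \<Longrightarrow> finite_energy (\<rho> i)"
  by (simp add: energy_family_def)

text \<open>For a nonnegative kernel, the Gram inequality for the sums of \<open>\<rho>\<close> and \<open>\<sigma>\<close> over a finite index set
bounds the mixed sum by the two energies.\<close>

lemma energy_family_cross:
  assumes H: "(\<forall>z. 0 \<le> \<kappa> z) \<or> finite I" and \<rho>: "energy_family I \<rho>" and \<sigma>: "energy_family I \<sigma>"
  shows "(\<lambda>(i, j). K (\<rho> i) (\<sigma> j)) summable_on I \<times> I"
proof (cases "finite I")
  case True
  then show ?thesis by (intro summable_on_finite) simp
next
  case False
  with H have pos: "\<And>z. 0 \<le> \<kappa> z" by blast
  define t where "t \<tau> \<upsilon> = (\<lambda>(i, j). K (\<tau> i) (\<upsilon> j))" for \<tau> \<upsilon> :: "'a \<Rightarrow> 'x measure"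
  have nn: "0 \<le> t \<tau> \<upsilon> x" for \<tau> \<upsilon> x by (cases x) (simp add: t_def K_nonneg[OF pos])
  have s: "t \<rho> \<rho> summable_on I \<times> I" "t \<sigma> \<sigma> summable_on I \<times> I"
    using \<rho> \<sigma> unfolding energy_family_def t_def by blast+
  define C where "C = infsum (t \<rho> \<rho>) (I \<times> I) + infsum (t \<sigma> \<sigma>) (I \<times> I)"
  have "sum (t \<rho> \<sigma>) F \<le> C" if F: "F \<subseteq> I \<times> I" "finite F" for F
  proof -
    define G where "G = fst ` F \<union> snd ` F"
    have G: "finite G" "G \<subseteq> I" using F by (auto simp: G_def)
    have "F \<subseteq> fst ` F \<times> snd ` F" by (rule subset_fst_snd)
    also have "\<dots> \<subseteq> G \<times> G" unfolding G_def by (intro Sigma_mono) simp_all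
    finally have FG: "F \<subseteq> G \<times> G" .
    have fr: "finite_energy (\<rho> i)" "finite_energy (\<sigma> i)" if "i \<in> G" for i
      using energy_family_fe[OF \<rho> subsetD[OF G(2) that]] energy_family_fe[OF \<sigma> subsetD[OF G(2) that]] .
    have L: "K (lincomb G (\<lambda>_. 1) \<tau>) (lincomb G (\<lambda>_. 1) \<upsilon>) = sum (t \<tau> \<upsilon>) (G \<times> G)"
      if "\<And>i. i \<in> G \<Longrightarrow> finite_energy (\<tau> i)" "\<And>i. i \<in> G \<Longrightarrow> finite_energy (\<upsilon> i)" for \<tau> \<upsilon>
      using K_lincomb[of G \<tau> "\<lambda>_. 1" G \<upsilon> "\<lambda>_. 1"] G(1) that
      by (simp add: sum.cartesian_product t_def)
    have "sum (t \<rho> \<sigma>) F \<le> sum (t \<rho> \<sigma>) (G \<times> G)"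
      using G(1) FG nn by (intro sum_mono2) auto
    also have "2 * sum (t \<rho> \<sigma>) (G \<times> G) \<le> sum (t \<rho> \<rho>) (G \<times> G) + sum (t \<sigma> \<sigma>) (G \<times> G)"
      using pair_energy(2)[OF finite_energy_lincomb[of G \<rho> "\<lambda>_. 1"] finite_energy_lincomb[of G \<sigma> "\<lambda>_. 1"]] G(1) fr
      by (simp add: L)
    moreover have "sum (t \<tau> \<tau>) (G \<times> G) \<le> infsum (t \<tau> \<tau>) (I \<times> I)" if "t \<tau> \<tau> summable_on I \<times> I" for \<tau>
      using that G nn by (intro finite_sum_le_infsum) auto
    then have "sum (t \<rho> \<rho>) (G \<times> G) + sum (t \<sigma> \<sigma>) (G \<times> G) \<le> C" unfolding C_def using s by (intro add_mono)
    moreover have "0 \<le> sum (t \<rho> \<sigma>) F" using nn by (rule sum_nonneg)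
    ultimately show ?thesis by linarith
  qed
  then have "t \<rho> \<sigma> summable_on I \<times> I"
    by (intro nonneg_bdd_above_summable_on bdd_aboveI[of _ C] nn) auto
  then show ?thesis unfolding t_def .
qed

definition energy_form :: "'i set \<Rightarrow> ('i \<Rightarrow> real) \<Rightarrow> ('i \<Rightarrow> 'x measure) \<Rightarrow> ('i \<Rightarrow> 'x measure) \<Rightarrow> real" where
  "energy_form I \<alpha> \<rho> \<sigma> = infsum (\<lambda>(i, j). \<alpha> i * \<alpha> j * K (\<rho> i) (\<sigma> j)) (I \<times> I)"

lemma energy_form_summable:
  assumes H: "(\<forall>z. 0 \<le> \<kappa> z) \<or> finite I" and \<alpha>: "\<And>i. \<bar>\<alpha> i\<bar> = 1" and \<rho>: "energy_family I \<rho>" and \<sigma>: "energy_family I \<sigma>"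
  shows "(\<lambda>(i, j). \<alpha> i * \<alpha> j * K (\<rho> i) (\<sigma> j)) summable_on I \<times> I"
  by (rule summable_on_real_bound[OF energy_family_cross[OF H \<rho> \<sigma>]]) (auto simp: abs_mult \<alpha>)

lemma energy_form_sym:
  assumes \<rho>: "energy_family I \<rho>" and \<sigma>: "energy_family I \<sigma>"
  shows "energy_form I \<alpha> \<rho> \<sigma> = energy_form I \<alpha> \<sigma> \<rho>"
proof -
  have "bij_betw prod.swap (I \<times> I) (I \<times> I)"
    by (rule bij_betwI[of _ _ _ prod.swap]) auto
  then have "infsum (\<lambda>z. (\<lambda>(i, j). \<alpha> i * \<alpha> j * K (\<sigma> i) (\<rho> j)) (prod.swap z)) (I \<times> I) = energy_form I \<alpha> \<sigma> \<rho>"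
    unfolding energy_form_def by (rule infsum_reindex_bij_betw)
  also have "infsum (\<lambda>z. (\<lambda>(i, j). \<alpha> i * \<alpha> j * K (\<sigma> i) (\<rho> j)) (prod.swap z)) (I \<times> I) = energy_form I \<alpha> \<rho> \<sigma>"
    unfolding energy_form_def using K_sym[OF finite_energyD(1)[OF energy_family_fe[OF \<sigma>]] finite_energyD(1)[OF energy_family_fe[OF \<rho>]]]
    by (intro infsum_cong) auto
  finally show ?thesis .
qed

text \<open>The limit of Gram inequalities over finite squares of indices, with coefficients \<open>c a * \<alpha> i\<close>.\<close>

lemma energy_family_psd:
  assumes H: "(\<forall>z. 0 \<le> \<kappa> z) \<or> finite I" and \<alpha>: "\<And>i. \<bar>\<alpha> i\<bar> = 1"
    and T: "finite T" and \<rho>: "\<And>a. a \<in> T \<Longrightarrow> energy_family I (\<rho> a)"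
  shows "0 \<le> (\<Sum>a\<in>T. \<Sum>b\<in>T. c a * c b * energy_form I \<alpha> (\<rho> a) (\<rho> b))"
proof (rule tendsto_lowerbound)
  define f where "f a b = (\<lambda>(i, j). \<alpha> i * \<alpha> j * K (\<rho> a i) (\<rho> b j))" for a b
  show "((\<lambda>G. \<Sum>a\<in>T. \<Sum>b\<in>T. c a * c b * sum (f a b) (G \<times> G))
      \<longlongrightarrow> (\<Sum>a\<in>T. \<Sum>b\<in>T. c a * c b * energy_form I \<alpha> (\<rho> a) (\<rho> b))) (finite_subsets_at_top I)"
    unfolding energy_form_def f_def
    by (intro tendsto_sum tendsto_mult tendsto_const tendsto_sum_squares energy_form_summable[OF H \<alpha>] \<rho>)
  have "0 \<le> (\<Sum>a\<in>T. \<Sum>b\<in>T. c a * c b * sum (f a b) (G \<times> G))" if G: "finite G" "G \<subseteq> I" for G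
  proof -
    have SP: "(\<Sum>p\<in>T \<times> G. h p) = (\<Sum>a\<in>T. \<Sum>i\<in>G. h (a, i))" for h :: "'b \<times> 'a \<Rightarrow> real"
      by (simp add: sum.cartesian_product)
    have "0 \<le> (\<Sum>p\<in>T \<times> G. \<Sum>q\<in>T \<times> G. (c (fst p) * \<alpha> (snd p)) * (c (fst q) * \<alpha> (snd q))
        * K (\<rho> (fst p) (snd p)) (\<rho> (fst q) (snd q)))"
      using T G by (intro gram_nonneg) (auto intro!: energy_family_fe[OF \<rho>])
    also have "\<dots> = (\<Sum>a\<in>T. \<Sum>i\<in>G. \<Sum>b\<in>T. \<Sum>j\<in>G. (c a * \<alpha> i) * (c b * \<alpha> j) * K (\<rho> a i) (\<rho> b j))"
      unfolding SP fst_conv snd_conv ..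
    also have "\<dots> = (\<Sum>a\<in>T. \<Sum>b\<in>T. \<Sum>i\<in>G. \<Sum>j\<in>G. (c a * \<alpha> i) * (c b * \<alpha> j) * K (\<rho> a i) (\<rho> b j))"
      by (intro sum.cong refl sum.swap)
    also have "\<dots> = (\<Sum>a\<in>T. \<Sum>b\<in>T. c a * c b * sum (f a b) (G \<times> G))"
      unfolding f_def sum.cartesian_product[symmetric] sum_distrib_left
      by (intro sum.cong refl) (simp add: ac_simps)
    finally show ?thesis .
  qed
  then show "eventually (\<lambda>G. 0 \<le> (\<Sum>a\<in>T. \<Sum>b\<in>T. c a * c b * sum (f a b) (G \<times> G))) (finite_subsets_at_top I)"
    unfolding eventually_finite_subsets_at_top by (intro exI[of _ "{}"]) auto
qed simp

text \<open>The case of two families, as a quadratic form in \<open>(s, t)\<close>.\<close>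

lemma energy_family_psd2:
  assumes "(\<forall>z. 0 \<le> \<kappa> z) \<or> finite I" "\<And>i. \<bar>\<alpha> i\<bar> = 1" "energy_family I \<rho>" "energy_family I \<sigma>"
  shows "0 \<le> s\<^sup>2 * energy_form I \<alpha> \<rho> \<rho> + 2 * s * t * energy_form I \<alpha> \<rho> \<sigma> + t\<^sup>2 * energy_form I \<alpha> \<sigma> \<sigma>"
proof -
  have "0 \<le> (\<Sum>a\<in>UNIV. \<Sum>b\<in>UNIV. (if a then s else t) * (if b then s else t)
      * energy_form I \<alpha> (if a then \<rho> else \<sigma>) (if b then \<rho> else \<sigma>))"
    using assms by (intro energy_family_psd) simp_all
  also have "\<dots> = s * s * energy_form I \<alpha> \<rho> \<rho> + s * t * energy_form I \<alpha> \<rho> \<sigma> + t * s * energy_form I \<alpha> \<sigma> \<rho> + t * t * energy_form I \<alpha> \<sigma> \<sigma>"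
    by (simp add: UNIV_bool)
  also have "\<dots> = s\<^sup>2 * energy_form I \<alpha> \<rho> \<rho> + 2 * s * t * energy_form I \<alpha> \<rho> \<sigma> + t\<^sup>2 * energy_form I \<alpha> \<sigma> \<sigma>"
    unfolding energy_form_sym[OF assms(4,3), of \<alpha>] by (simp add: power2_eq_square)
  finally show ?thesis .
qed

text \<open>The quadratic function \<open>\<parallel>(1 + t) \<rho> - \<sigma>\<parallel>\<^sup>2\<close> has the minimum \<open>0\<close> at \<open>t = 0\<close>, so its
linear coefficient vanishes.\<close>

lemma zero_distance_imp_equal_energies:
  assumes H: "(\<forall>z. 0 \<le> \<kappa> z) \<or> finite I" "\<And>i. \<bar>\<alpha> i\<bar> = 1" "energy_family I \<rho>" "energy_family I \<sigma>"
    and zero: "energy_form I \<alpha> \<rho> \<rho> - 2 * energy_form I \<alpha> \<rho> \<sigma> + energy_form I \<alpha> \<sigma> \<sigma> = 0"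
  shows "energy_form I \<alpha> \<rho> \<rho> = energy_form I \<alpha> \<rho> \<sigma>" "energy_form I \<alpha> \<sigma> \<sigma> = energy_form I \<alpha> \<rho> \<sigma>"
proof -
  have "0 \<le> 2 * t * (energy_form I \<alpha> \<rho> \<rho> - energy_form I \<alpha> \<rho> \<sigma>) + t\<^sup>2 * energy_form I \<alpha> \<rho> \<rho>" for t
  proof -
    have "(1 + t)\<^sup>2 * a + 2 * (1 + t) * (- 1) * b + (- 1)\<^sup>2 * c = (a - 2 * b + c) + (2 * t * (a - b) + t\<^sup>2 * a)"
      for a b c :: real by (simp add: power2_eq_square algebra_simps)
    then show ?thesis using energy_family_psd2[where \<alpha> = \<alpha> and s = "1 + t" and t = "- 1", OF H] zero by simp
  qed
  then have "energy_form I \<alpha> \<rho> \<rho> - energy_form I \<alpha> \<rho> \<sigma> = 0" by (rule linear_coeff_zero)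
  then show "energy_form I \<alpha> \<rho> \<rho> = energy_form I \<alpha> \<rho> \<sigma>" by simp
  with zero show "energy_form I \<alpha> \<sigma> \<sigma> = energy_form I \<alpha> \<rho> \<sigma>" by simp
qed

text \<open>The degenerate case of the Cauchy-Schwarz inequality, read off from the minimum of
\<open>\<parallel>\<rho> - \<sigma> + t \<tau>\<parallel>\<^sup>2\<close> at \<open>t = 0\<close>.\<close>

lemma zero_distance_imp_equal_mutual:
  assumes H: "(\<forall>z. 0 \<le> \<kappa> z) \<or> finite I" "\<And>i. \<bar>\<alpha> i\<bar> = 1"
    and f: "energy_family I \<rho>" "energy_family I \<sigma>" "energy_family I \<tau>"
    and zero: "energy_form I \<alpha> \<rho> \<rho> - 2 * energy_form I \<alpha> \<rho> \<sigma> + energy_form I \<alpha> \<sigma> \<sigma> = 0"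
  shows "energy_form I \<alpha> \<rho> \<tau> = energy_form I \<alpha> \<sigma> \<tau>"
proof -
  have "0 \<le> 2 * t * (energy_form I \<alpha> \<rho> \<tau> - energy_form I \<alpha> \<sigma> \<tau>) + t\<^sup>2 * energy_form I \<alpha> \<tau> \<tau>" for t
  proof -
    define c where "c n = (if n = 0 then 1 else if n = 1 then - 1 else t)" for n :: nat
    define r where "r n = (if n = 0 then \<rho> else if n = 1 then \<sigma> else \<tau>)" for n :: nat
    have S: "sum h {0,1,2} = h 0 + h 1 + h 2" for h :: "nat \<Rightarrow> real" by (simp add: add.assoc)
    have "0 \<le> (\<Sum>a\<in>{0,1,2}. \<Sum>b\<in>{0,1,2}. c a * c b * energy_form I \<alpha> (r a) (r b))"
      by (rule energy_family_psd[OF H]) (auto simp: r_def f)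
    also have "\<dots> = energy_form I \<alpha> \<rho> \<rho> - energy_form I \<alpha> \<rho> \<sigma> + t * energy_form I \<alpha> \<rho> \<tau> - energy_form I \<alpha> \<sigma> \<rho> + energy_form I \<alpha> \<sigma> \<sigma> - t * energy_form I \<alpha> \<sigma> \<tau>
        + t * energy_form I \<alpha> \<tau> \<rho> - t * energy_form I \<alpha> \<tau> \<sigma> + t * t * energy_form I \<alpha> \<tau> \<tau>"
      unfolding S by (simp add: c_def r_def)
    also have "\<dots> = (energy_form I \<alpha> \<rho> \<rho> - 2 * energy_form I \<alpha> \<rho> \<sigma> + energy_form I \<alpha> \<sigma> \<sigma>)
        + (2 * t * (energy_form I \<alpha> \<rho> \<tau> - energy_form I \<alpha> \<sigma> \<tau>) + t\<^sup>2 * energy_form I \<alpha> \<tau> \<tau>)"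
      unfolding energy_form_sym[OF f(2,1), of \<alpha>] energy_form_sym[OF f(3,1), of \<alpha>] energy_form_sym[OF f(3,2), of \<alpha>]
      by (simp add: power2_eq_square algebra_simps)
    finally show ?thesis unfolding zero by simp
  qed
  then have "energy_form I \<alpha> \<rho> \<tau> - energy_form I \<alpha> \<sigma> \<tau> = 0" by (rule linear_coeff_zero)
  then show ?thesis by simp
qed

text \<open>A single measure as a family, so that \<open>zero_distance_imp_equal_mutual\<close> yields statements about mutual
energies with one test measure.\<close>

definition single :: "'i \<Rightarrow> 'x measure \<Rightarrow> 'i \<Rightarrow> 'x measure" where
  "single i0 M i = (if i = i0 then M else null_measure borel)"

lemma K_single_zero: "i \<noteq> i0 \<Longrightarrow> K (single i0 M i) N = 0" "i \<noteq> i0 \<Longrightarrow> K N (single i0 M i) = 0"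
  by (simp_all add: single_def K_null)

lemma energy_family_single:
  assumes M: "finite_energy M"
  shows "energy_family I (single i0 M)"
proof -
  have "(\<lambda>(i, j). K (single i0 M i) (single i0 M j)) summable_on I \<times> I
      \<longleftrightarrow> (\<lambda>(i, j). K (single i0 M i) (single i0 M j)) summable_on (I \<times> I \<inter> {(i0, i0)})"
    by (rule summable_on_cong_neutral) (auto, (metis K_single_zero)+)
  moreover have "(\<lambda>(i, j). K (single i0 M i) (single i0 M j)) summable_on (I \<times> I \<inter> {(i0, i0)})"
    by (rule summable_on_finite) simp
  ultimately show ?thesis using M finite_energy_null by (simp add: energy_family_def single_def)
qed

lemma energy_form_single:
  assumes i0: "i0 \<in> I" and \<rho>: "energy_family I \<rho>" and M: "finite_energy M"
  shows "energy_form I \<alpha> \<rho> (single i0 M) = \<alpha> i0 * infsum (\<lambda>i. \<alpha> i * K M (\<rho> i)) I"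
proof -
  let ?f = "\<lambda>(i, j). \<alpha> i * \<alpha> j * K (\<rho> i) (single i0 M j)"
  have "energy_form I \<alpha> \<rho> (single i0 M) = infsum ?f ((\<lambda>i. (i, i0)) ` I)"
    unfolding energy_form_def
  proof (rule infsum_cong_neutral)
    show "?f z = 0" if "z \<in> I \<times> I - (\<lambda>i. (i, i0)) ` I" for z
    proof -
      obtain i j where z: "z = (i, j)" by (cases z)
      then have "j \<noteq> i0" using that by auto
      then show ?thesis by (simp add: z K_single_zero)
    qed
  qed (use i0 in auto)
  also have "\<dots> = infsum (?f \<circ> (\<lambda>i. (i, i0))) I"
    by (rule infsum_reindex) (simp add: inj_on_def)
  also have "\<dots> = infsum (\<lambda>i. \<alpha> i0 * (\<alpha> i * K M (\<rho> i))) I"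
    using K_sym[OF finite_energyD(1)[OF energy_family_fe[OF \<rho>]] finite_energyD(1)[OF M]]
    by (intro infsum_cong) (simp add: single_def)
  also have "\<dots> = \<alpha> i0 * infsum (\<lambda>i. \<alpha> i * K M (\<rho> i)) I" by (rule infsum_cmult_right')
  finally show ?thesis .
qed

text \<open>The bound that makes the potentials of a family summable almost everywhere. For a nonnegative kernel it is the
mixed sum of the family with the one-element family of \<open>M\<close>.\<close>

lemma potential_bounds_summable:
  assumes H: "(\<forall>z. 0 \<le> \<kappa> z) \<or> finite I" and \<rho>: "energy_family I \<rho>" and M: "finite_energy M"
  shows "(\<lambda>i. enn2real (iter kpos M (\<rho> i)) + enn2real (iter kneg M (\<rho> i))) summable_on I"
proof (cases "finite I")
  case True
  then show ?thesis by (rule summable_on_finite)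
next
  case False
  with H have pos: "\<And>z. 0 \<le> \<kappa> z" by blast
  from False obtain i0 where i0: "i0 \<in> I" by (metis finite.emptyI all_not_in_conv)
  have "(\<lambda>(i, j). K (\<rho> i) (single i0 M j)) summable_on I \<times> I"
    by (rule energy_family_cross[OF H \<rho> energy_family_single[OF M]])
  then have "(\<lambda>(i, j). K (\<rho> i) (single i0 M j)) summable_on ((\<lambda>i. (i, i0)) ` I)"
    by (rule summable_on_subset_banach) (use i0 in auto)
  then have "((\<lambda>(i, j). K (\<rho> i) (single i0 M j)) \<circ> (\<lambda>i. (i, i0))) summable_on I"
    by (subst (asm) summable_on_reindex) (simp_all add: inj_on_def)
  then show ?thesis
    by (rule summable_on_cong[THEN iffD1, rotated])
      (simp add: single_def K_def iter_kneg_nonneg[OF pos] iter_sym(1)[OF finite_energyD(1)[OF energy_family_fe[OF \<rho>]] finite_energyD(1)[OF M]])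
qed

section \<open>Potentials of families\<close>

definition pot_pos :: "'x measure \<Rightarrow> 'x \<Rightarrow> ennreal" where "pot_pos N x = (\<integral>\<^sup>+y. kpos (x, y) \<partial>N)"
definition pot_neg :: "'x measure \<Rightarrow> 'x \<Rightarrow> ennreal" where "pot_neg N x = (\<integral>\<^sup>+y. kneg (x, y) \<partial>N)"

text \<open>The value is the potential of \<open>N\<close> at \<open>x\<close> wherever both parts are finite.\<close>

definition pot :: "'x measure \<Rightarrow> 'x \<Rightarrow> real" where "pot N x = enn2real (pot_pos N x) - enn2real (pot_neg N x)"

lemma pot_pos_meas:
  assumes "moderate N" "moderate M"
  shows "pot_pos N \<in> borel_measurable M" "pot_neg N \<in> borel_measurable M"
  using nn_integral_prodm(1)[OF moderate_sets[OF assms(2)] assms(1) kpos_meas]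
    nn_integral_prodm(1)[OF moderate_sets[OF assms(2)] assms(1) kneg_meas]
    measurable_cong_sets[OF moderate_sets[OF assms(2)] refl]
  unfolding pot_pos_def pot_neg_def by blast+

lemma integral_pot:
  assumes M: "finite_energy M" and N: "finite_energy N"
  shows "AE x in M. pot_pos N x < \<infinity> \<and> pot_neg N x < \<infinity>"
    and "integrable M (pot N)" "(\<integral>x. pot N x \<partial>M) = K M N"
    and "(\<integral>x. \<bar>pot N x\<bar> \<partial>M) \<le> enn2real (iter kpos M N) + enn2real (iter kneg M N)"
proof -
  note m = pot_pos_meas[OF finite_energyD(1)[OF N] finite_energyD(1)[OF M]]
  have fin: "(\<integral>\<^sup>+x. pot_pos N x \<partial>M) < \<infinity>" "(\<integral>\<^sup>+x. pot_neg N x \<partial>M) < \<infinity>"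
    using pair_energy(1)[OF M N] iter_kneg_finite[OF finite_energyD(1)[OF M] finite_energyD(1)[OF N]]
    unfolding iter_def pot_pos_def pot_neg_def by simp_all
  have ae: "AE x in M. pot_pos N x \<noteq> \<infinity>" "AE x in M. pot_neg N x \<noteq> \<infinity>"
    using nn_integral_PInf_AE[OF m(1)] nn_integral_PInf_AE[OF m(2)] fin by simp_all
  then show "AE x in M. pot_pos N x < \<infinity> \<and> pot_neg N x < \<infinity>"
    by eventually_elim (simp add: less_top)
  have real: "integrable M (\<lambda>x. enn2real (w x))" "(\<integral>x. enn2real (w x) \<partial>M) = enn2real (\<integral>\<^sup>+x. w x \<partial>M)"
    if w: "w \<in> borel_measurable M" "(\<integral>\<^sup>+x. w x \<partial>M) < \<infinity>" "AE x in M. w x \<noteq> \<infinity>" for w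
  proof -
    have eq: "(\<integral>\<^sup>+x. ennreal (enn2real (w x)) \<partial>M) = (\<integral>\<^sup>+x. w x \<partial>M)"
      using w(3) by (intro nn_integral_cong_AE) (auto simp: less_top)
    have m': "(\<lambda>x. enn2real (w x)) \<in> borel_measurable M" using w(1) by simp
    show "integrable M (\<lambda>x. enn2real (w x))"
      using m' w(2) by (intro integrableI_nonneg) (simp_all add: eq)
    show "(\<integral>x. enn2real (w x) \<partial>M) = enn2real (\<integral>\<^sup>+x. w x \<partial>M)"
      using m' by (subst integral_eq_nn_integral) (simp_all add: eq)
  qed
  note P = real[OF m(1) fin(1) ae(1)] and Q = real[OF m(2) fin(2) ae(2)]
  show "integrable M (pot N)" unfolding pot_def by (rule Bochner_Integration.integrable_diff[OF P(1) Q(1)])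
  have iters: "(\<integral>\<^sup>+x. pot_pos N x \<partial>M) = iter kpos M N" "(\<integral>\<^sup>+x. pot_neg N x \<partial>M) = iter kneg M N"
    unfolding pot_pos_def pot_neg_def iter_def by simp_all
  show "(\<integral>x. pot N x \<partial>M) = K M N"
    unfolding pot_def Bochner_Integration.integral_diff[OF P(1) Q(1)] P(2) Q(2) iters K_def ..
  have "(\<integral>x. \<bar>pot N x\<bar> \<partial>M) \<le> (\<integral>x. enn2real (pot_pos N x) + enn2real (pot_neg N x) \<partial>M)"
  proof (rule integral_mono)
    show "integrable M (\<lambda>x. \<bar>pot N x\<bar>)"
      unfolding pot_def by (intro integrable_abs Bochner_Integration.integrable_diff P(1) Q(1))
    show "integrable M (\<lambda>x. enn2real (pot_pos N x) + enn2real (pot_neg N x))"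
      by (rule Bochner_Integration.integrable_add[OF P(1) Q(1)])
    show "\<bar>pot N x\<bar> \<le> enn2real (pot_pos N x) + enn2real (pot_neg N x)" for x
      unfolding pot_def using enn2real_nonneg[of "pot_pos N x"] enn2real_nonneg[of "pot_neg N x"] by linarith
  qed
  also have "\<dots> = enn2real (iter kpos M N) + enn2real (iter kneg M N)"
    unfolding Bochner_Integration.integral_add[OF P(1) Q(1)] P(2) Q(2) iters ..
  finally show "(\<integral>x. \<bar>pot N x\<bar> \<partial>M) \<le> enn2real (iter kpos M N) + enn2real (iter kneg M N)" .
qed

text \<open>Fubini's theorem for \<open>M\<close> and the counting measure on the indices.\<close>

lemma potential_integral:
  fixes I :: "nat set"
  assumes H: "(\<forall>z. 0 \<le> \<kappa> z) \<or> finite I" and \<alpha>: "\<And>i. \<bar>\<alpha> i\<bar> = 1" and \<rho>: "energy_family I \<rho>" and M: "finite_energy M"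
  shows "AE x in M. integrable (count_space I) (\<lambda>j. \<alpha> j * pot (\<rho> j) x)"
    and "integrable M (\<lambda>x. \<integral>j. \<alpha> j * pot (\<rho> j) x \<partial>count_space I)"
    and "(\<integral>x. (\<integral>j. \<alpha> j * pot (\<rho> j) x \<partial>count_space I) \<partial>M) = infsum (\<lambda>j. \<alpha> j * K M (\<rho> j)) I"
proof -
  define F where "F j x = \<alpha> j * pot (\<rho> j) x" for j x
  interpret M: sigma_finite_measure M by (rule sigma_finite_moderate[OF finite_energyD(1)[OF M]])
  interpret C: sigma_finite_measure "count_space I" by (rule sigma_finite_measure_count_space_countable) simp
  interpret pair_sigma_finite "count_space I" M ..
  have int: "integrable M (F j)" if "j \<in> I" for j
    unfolding F_def using integral_pot(2)[OF M energy_family_fe[OF \<rho> that]] by (rule integrable_mult_right)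
  have nrm: "(\<integral>x. norm (F j x) \<partial>M) \<le> enn2real (iter kpos M (\<rho> j)) + enn2real (iter kneg M (\<rho> j))" if "j \<in> I" for j
    using integral_pot(4)[OF M energy_family_fe[OF \<rho> that]] by (simp add: F_def abs_mult \<alpha>)
  have "(\<lambda>j. \<integral>x. norm (F j x) \<partial>M) summable_on I"
  proof (rule summable_on_real_bound[OF potential_bounds_summable[OF H \<rho> M]])
    fix j assume "j \<in> I"
    have "0 \<le> (\<integral>x. norm (F j x) \<partial>M)" by simp
    then show "\<bar>\<integral>x. norm (F j x) \<partial>M\<bar> \<le> \<bar>enn2real (iter kpos M (\<rho> j)) + enn2real (iter kneg M (\<rho> j))\<bar>"
      using nrm[OF \<open>j \<in> I\<close>] by linarith
  qed
  then have s: "integrable (count_space I) (\<lambda>j. \<integral>x. norm (F j x) \<partial>M)"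
    by (simp only: summable_on_iff_integrable_count_space)
  have prod: "integrable (count_space I \<Otimes>\<^sub>M M) (case_prod F)"
  proof (rule Fubini_integrable)
    show "case_prod F \<in> borel_measurable (count_space I \<Otimes>\<^sub>M M)"
      using int by (intro measurable_pair_measure_countable1) (auto dest: borel_measurable_integrable)
    show "integrable (count_space I) (\<lambda>j. \<integral>x. norm (case (j, x) of (j, x) \<Rightarrow> F j x) \<partial>M)" using s by simp
    show "AE j in count_space I. integrable M (\<lambda>x. case (j, x) of (j, x) \<Rightarrow> F j x)"
      using int by (simp add: AE_count_space)
  qed
  show "AE x in M. integrable (count_space I) (\<lambda>j. \<alpha> j * pot (\<rho> j) x)"
    using AE_integrable_snd[OF prod] unfolding F_def .
  show "integrable M (\<lambda>x. \<integral>j. \<alpha> j * pot (\<rho> j) x \<partial>count_space I)"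
    using integrable_snd[OF prod] unfolding F_def .
  have eq: "(\<integral>x. F j x \<partial>M) = \<alpha> j * K M (\<rho> j)" if "j \<in> I" for j
    unfolding F_def using integral_pot(2,3)[OF M energy_family_fe[OF \<rho> that]] by simp
  have "integrable (count_space I) (\<lambda>j. \<integral>x. F j x \<partial>M)"
    using integrable_fst[OF prod] .
  then have sm: "(\<lambda>j. \<integral>x. F j x \<partial>M) summable_on I"
    by (simp only: summable_on_iff_integrable_count_space)
  have "(\<integral>x. (\<integral>j. F j x \<partial>count_space I) \<partial>M) = (\<integral>j. (\<integral>x. F j x \<partial>M) \<partial>count_space I)"
    by (rule Fubini_integral[OF prod])
  also have "\<dots> = infsum (\<lambda>j. \<integral>x. F j x \<partial>M) I" by (rule infsum_eq_integral_count_space[OF sm, symmetric])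
  also have "\<dots> = infsum (\<lambda>j. \<alpha> j * K M (\<rho> j)) I" by (rule infsum_cong) (rule eq)
  finally show "(\<integral>x. (\<integral>j. \<alpha> j * pot (\<rho> j) x \<partial>count_space I) \<partial>M) = infsum (\<lambda>j. \<alpha> j * K M (\<rho> j)) I"
    unfolding F_def .
qed

lemma finite_energy_density_indicator:
  assumes M: "finite_energy M" and A: "A \<in> sets borel"
  shows "finite_energy (density M (indicator A))"
proof (rule finite_energy_submeasure[OF M])
  have sM: "sets M = sets borel" using finite_energyD(1)[OF M] by simp
  show "sets (density M (indicator A)) = sets borel" using sM by simp
  fix E :: "'x set" assume E: "E \<in> sets borel"
  have "emeasure (density M (indicator A)) E = emeasure M (A \<inter> E)"
    using E A sM by (intro emeasure_restricted) simp_all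
  also have "\<dots> \<le> emeasure M E" using E sM by (intro emeasure_mono) auto
  finally show "emeasure (density M (indicator A)) E \<le> emeasure M E" .
qed

text \<open>For every Borel set \<open>A\<close> the restriction of \<open>M\<close> to \<open>A\<close> has finite energy, and its mutual energies
with the two families coincide. Hence the two potentials have the same integral over \<open>A\<close>.\<close>

lemma potentials_AE_equal:
  fixes I :: "nat set"
  assumes H: "(\<forall>z. 0 \<le> \<kappa> z) \<or> finite I" and \<alpha>: "\<And>i. \<bar>\<alpha> i\<bar> = 1"
    and f: "energy_family I \<rho>" "energy_family I \<sigma>" and M: "finite_energy M" and i0: "i0 \<in> I"
    and zero: "energy_form I \<alpha> \<rho> \<rho> - 2 * energy_form I \<alpha> \<rho> \<sigma> + energy_form I \<alpha> \<sigma> \<sigma> = 0"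
  shows "AE x in M. (\<integral>j. \<alpha> j * pot (\<rho> j) x \<partial>count_space I) = (\<integral>j. \<alpha> j * pot (\<sigma> j) x \<partial>count_space I)"
proof (rule density_unique_real)
  show "integrable M (\<lambda>x. \<integral>j. \<alpha> j * pot (\<rho> j) x \<partial>count_space I)"
    "integrable M (\<lambda>x. \<integral>j. \<alpha> j * pot (\<sigma> j) x \<partial>count_space I)"
    using potential_integral(2)[OF H \<alpha> f(1) M] potential_integral(2)[OF H \<alpha> f(2) M] .
  fix A assume A: "A \<in> sets M"
  then have AB: "A \<in> sets borel" using finite_energyD(1)[OF M] by simp
  note MA = finite_energy_density_indicator[OF M AB]
  have "energy_form I \<alpha> \<rho> (single i0 (density M (indicator A))) = energy_form I \<alpha> \<sigma> (single i0 (density M (indicator A)))"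
    by (rule zero_distance_imp_equal_mutual[OF H \<alpha> f energy_family_single[OF MA] zero])
  then have eq: "infsum (\<lambda>j. \<alpha> j * K (density M (indicator A)) (\<rho> j)) I
      = infsum (\<lambda>j. \<alpha> j * K (density M (indicator A)) (\<sigma> j)) I"
    using \<alpha>[of i0] unfolding energy_form_single[OF i0 f(1) MA] energy_form_single[OF i0 f(2) MA] by auto
  have set: "(\<integral>x\<in>A. h x \<partial>M) = (\<integral>x. h x \<partial>density M (indicator A))"
    if "integrable M h" for h :: "'x \<Rightarrow> real"
  proof -
    have "(\<integral>x. h x \<partial>density M (\<lambda>x. ennreal (indicator A x))) = (\<integral>x. indicator A x *\<^sub>R h x \<partial>M)"
      using A that by (intro integral_density) auto
    then show ?thesis unfolding set_lebesgue_integral_def ennreal_indicator by simp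
  qed
  show "(\<integral>x\<in>A. (\<integral>j. \<alpha> j * pot (\<rho> j) x \<partial>count_space I) \<partial>M)
      = (\<integral>x\<in>A. (\<integral>j. \<alpha> j * pot (\<sigma> j) x \<partial>count_space I) \<partial>M)"
    unfolding set[OF potential_integral(2)[OF H \<alpha> f(1) M]] set[OF potential_integral(2)[OF H \<alpha> f(2) M]]
      potential_integral(3)[OF H \<alpha> f(1) MA] potential_integral(3)[OF H \<alpha> f(2) MA] by (rule eq)
qed

end

section \<open>Supports and weights\<close>

lemma open_Compl_msupp: "open (- msupp M)"
  unfolding msupp_def double_complement by (intro open_Union) simp

lemma closed_msupp: "closed (msupp M)"
  using open_Compl_msupp by (simp only: open_closed double_complement)

lemma msupp_subset: "open U \<Longrightarrow> emeasure M U = 0 \<Longrightarrow> msupp M \<subseteq> - U"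
  unfolding msupp_def by blast

text \<open>A compact set in the complement of the support is covered by finitely many open null sets; inner regularity
extends this to the whole complement, although it may be an uncountable union of null sets.\<close>

lemma emeasure_Compl_msupp:
  assumes M: "radon (M :: 'b::t2_space measure)"
  shows "emeasure M (- msupp M) = 0"
proof -
  let ?T = "{U. open U \<and> emeasure M U = 0}"
  have "emeasure M (- msupp M) = (SUP K\<in>{K. compact K \<and> K \<subseteq> - msupp M}. emeasure M K)"
    by (rule radon_inner[OF M open_Compl_msupp])
  also have "\<dots> \<le> 0"
  proof (rule SUP_least)
    fix K assume "K \<in> {K. compact K \<and> K \<subseteq> - msupp M}"
    then have K: "compact K" "K \<subseteq> \<Union>?T" by (simp_all add: msupp_def)
    obtain D where D: "D \<subseteq> ?T" "finite D" "K \<subseteq> \<Union>D"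
      by (rule compactE[OF K]) auto
    have "(\<Union>U\<in>D. U) \<in> null_sets M"
    proof (rule null_sets_UN')
      show "countable D" using D(2) by (rule countable_finite)
      fix U assume "U \<in> D"
      then have "open U" "emeasure M U = 0" using D(1) by auto
      then show "U \<in> null_sets M" using radon_sets[OF M] by (intro null_setsI) simp_all
    qed
    then have "\<Union>D \<in> null_sets M" by simp
    then have "emeasure M K \<le> emeasure M (\<Union>D)" "emeasure M (\<Union>D) = 0"
      using D(3) by (auto intro: emeasure_mono)
    then show "emeasure M K \<le> 0" by simp
  qed
  finally show ?thesis by simp
qed

lemma emeasure_null_of_msupp:
  fixes M :: "'b::t2_space measure"
  assumes M: "radon M" and supp: "msupp M \<subseteq> A"
  shows "emeasure M (- A) = 0"
proof -
  have "emeasure M (- A) \<le> emeasure M (- msupp M)"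
  proof (rule emeasure_mono)
    show "- A \<subseteq> - msupp M" using supp by (rule Compl_anti_mono)
    show "- msupp M \<in> sets M" unfolding radon_sets[OF M] by (rule borel_open[OF open_Compl_msupp])
  qed
  then show ?thesis unfolding emeasure_Compl_msupp[OF M] by simp
qed

text \<open>The closed sets \<open>F n = {x \<in> A. 1/(n+1) \<le> g x}\<close> exhaust \<open>A\<close> and have finite measure by Markov's
inequality. Outer regularity encloses each in an open set of finite measure, and the complement of \<open>A\<close> is
an open null set.\<close>

lemma moderate_of_finite_weight:
  fixes M :: "'b::t2_space measure" and g :: "'b \<Rightarrow> real"
  assumes M: "radon M" and supp: "msupp M \<subseteq> A" and A: "closed A"
    and g: "continuous_on A g" "\<And>x. x \<in> A \<Longrightarrow> 0 < g x"
    and fin: "(\<integral>\<^sup>+x\<in>A. ennreal (g x) \<partial>M) < \<infinity>"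
  shows "moderate M"
proof -
  have sM: "sets M = sets borel" by (rule radon_sets[OF M])
  define F where "F n = A \<inter> g -` {1 / real (Suc n)..}" for n
  have clF: "closed (F n)" for n
    unfolding F_def by (rule continuous_closed_preimage[OF g(1) A closed_atLeast])
  have Ffin: "emeasure M (F n) < \<infinity>" for n
  proof -
    have "ennreal (1 / real (Suc n)) * emeasure M (F n) = (\<integral>\<^sup>+x. ennreal (1 / real (Suc n)) * indicator (F n) x \<partial>M)"
      using clF[of n] sM by (intro nn_integral_cmult_indicator[symmetric]) simp
    also have "\<dots> \<le> (\<integral>\<^sup>+x\<in>A. ennreal (g x) \<partial>M)"
    proof (rule nn_integral_mono)
      fix x show "ennreal (1 / real (Suc n)) * indicator (F n) x \<le> ennreal (g x) * indicator A x"
        by (cases "x \<in> F n") (auto simp: F_def intro: ennreal_leI)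
    qed
    also note fin
    finally show ?thesis by (auto simp: ennreal_mult_less_top)
  qed
  have "\<exists>U. open U \<and> F n \<subseteq> U \<and> emeasure M U < \<infinity>" for n
    using Ffin[of n] unfolding radon_outer[OF M borel_closed[OF clF[of n]]] INF_less_iff by auto
  then obtain U where "\<And>n. open (U n) \<and> F n \<subseteq> U n \<and> emeasure M (U n) < \<infinity>" by metis
  then have U: "\<And>n. open (U n)" "\<And>n. F n \<subseteq> U n" "\<And>n. emeasure M (U n) < \<infinity>" by simp_all
  have nullA: "emeasure M (- A) = 0"
    by (rule emeasure_null_of_msupp[OF M supp])
  define V where "V n = - A \<union> (\<Union>k\<le>n. U k)" for n :: nat
  show ?thesis
    unfolding moderate_def
  proof (intro conjI exI[of _ V] allI M)
    show "incseq V"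
    proof (rule incseq_SucI)
      fix n show "V n \<subseteq> V (Suc n)" unfolding V_def by (intro Un_mono UN_mono subset_refl) simp
    qed
    show "open (V n)" for n unfolding V_def using A U(1) by (intro open_Un open_UN open_Compl ballI)
    show "emeasure M (V n) < \<infinity>" for n
    proof -
      have "emeasure M (V n) \<le> emeasure M (- A) + emeasure M (\<Union>k\<le>n. U k)"
        unfolding V_def using A U(1) sM by (intro emeasure_subadditive) auto
      also have "emeasure M (\<Union>k\<le>n. U k) \<le> (\<Sum>k\<le>n. emeasure M (U k))"
        using U(1) sM by (intro emeasure_subadditive_finite) auto
      finally have "emeasure M (V n) \<le> emeasure M (- A) + (\<Sum>k\<le>n. emeasure M (U k))"
        by (simp add: add_left_mono)
      also have "\<dots> < \<infinity>" using U(3) by (simp add: nullA)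
      finally show ?thesis .
    qed
    show "(\<Union>n. V n) = UNIV"
    proof -
      have "\<exists>n. x \<in> V n" for x :: 'b
      proof (cases "x \<in> A")
        case True
        obtain n where "inverse (real (Suc n)) < g x" using reals_Archimedean[OF g(2)[OF True]] by blast
        then have "x \<in> F n" using True by (simp add: F_def inverse_eq_divide)
        then have "x \<in> V n" using U(2)[of n] by (auto simp: V_def)
        then show ?thesis ..
      qed (auto simp: V_def)
      then show ?thesis by auto
    qed
  qed
qed

section \<open>Linear combinations in extended integrals\<close>

lemma eint_lincomb:
  assumes J: "finite J" and m: "\<And>j. j \<in> J \<Longrightarrow> sets (m j) = sets borel"
    and f: "f \<in> borel_measurable borel" and c: "\<And>j. j \<in> J \<Longrightarrow> 0 \<le> c j"
    and r: "\<And>j. j \<in> J \<Longrightarrow> eint (m j) f = ereal (r j)"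
  shows "eint (lincomb J c m) f = ereal (\<Sum>j\<in>J. c j * r j)"
proof -
  define p where "p j = (\<integral>\<^sup>+x. e2ennreal (f x) \<partial>m j)" for j
  define n where "n j = (\<integral>\<^sup>+x. e2ennreal (- f x) \<partial>m j)" for j
  have fin: "p j < \<infinity>" "n j < \<infinity>" if "j \<in> J" for j
    using eint_finite_parts[of "m j" f] r[OF that] by (simp_all add: p_def n_def)
  have rj: "r j = enn2real (p j) - enn2real (n j)" if "j \<in> J" for j
    using eint_eq_diff(1)[OF fin[OF that, unfolded p_def n_def]] r[OF that] by (simp add: p_def n_def)
  have P: "(\<integral>\<^sup>+x. e2ennreal (f x) \<partial>lincomb J c m) = (\<Sum>j\<in>J. ennreal (c j) * p j)"
    unfolding p_def using f by (intro nn_integral_lincomb m) simp_all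
  have N: "(\<integral>\<^sup>+x. e2ennreal (- f x) \<partial>lincomb J c m) = (\<Sum>j\<in>J. ennreal (c j) * n j)"
    unfolding n_def using f by (intro nn_integral_lincomb m) simp_all
  have e: "(\<Sum>j\<in>J. ennreal (c j) * u j) < \<infinity>"
    "enn2real (\<Sum>j\<in>J. ennreal (c j) * u j) = (\<Sum>j\<in>J. c j * enn2real (u j))"
    if u: "\<And>j. j \<in> J \<Longrightarrow> u j < \<infinity>" for u
  proof -
    have l: "ennreal (c j) * u j < top" if "j \<in> J" for j
      using u[OF that] by (simp add: ennreal_mult_less_top)
    then show "(\<Sum>j\<in>J. ennreal (c j) * u j) < \<infinity>" using J by simp
    have "enn2real (\<Sum>j\<in>J. ennreal (c j) * u j) = (\<Sum>j\<in>J. enn2real (ennreal (c j) * u j))"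
      by (simp add: enn2real_sum l)
    then show "enn2real (\<Sum>j\<in>J. ennreal (c j) * u j) = (\<Sum>j\<in>J. c j * enn2real (u j))"
      using c by (simp add: enn2real_mult)
  qed
  have ep: "(\<Sum>j\<in>J. ennreal (c j) * p j) < \<infinity>"
    "enn2real (\<Sum>j\<in>J. ennreal (c j) * p j) = (\<Sum>j\<in>J. c j * enn2real (p j))"
    by (rule e, erule fin)+
  have en: "(\<Sum>j\<in>J. ennreal (c j) * n j) < \<infinity>"
    "enn2real (\<Sum>j\<in>J. ennreal (c j) * n j) = (\<Sum>j\<in>J. c j * enn2real (n j))"
    by (rule e, erule fin)+
  have "eint (lincomb J c m) f = ereal ((\<Sum>j\<in>J. c j * enn2real (p j)) - (\<Sum>j\<in>J. c j * enn2real (n j)))"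
    using eint_eq_diff(1)[of "lincomb J c m" f, unfolded P N, OF ep(1) en(1)] unfolding ep(2) en(2) .
  also have "(\<Sum>j\<in>J. c j * enn2real (p j)) - (\<Sum>j\<in>J. c j * enn2real (n j)) = (\<Sum>j\<in>J. c j * r j)"
    by (simp add: rj right_diff_distrib sum_subtractf)
  finally show ?thesis .
qed

lemma finite_of_finite_sign_mult:
  assumes "\<bar>ereal c * m\<bar> \<noteq> \<infinity>" "c = 1 \<or> c = - 1"
  shows "\<bar>m\<bar> \<noteq> \<infinity>"
  using assms(2)
proof
  assume "c = 1" then show ?thesis using assms(1) by (cases m) simp_all
next
  assume "c = - 1" then show ?thesis using assms(1) by (cases m) simp_all
qed

lemma ennreal_half_add_half:
  assumes "0 \<le> c"
  shows "ennreal (1/2) * ennreal c + ennreal (1/2) * ennreal c = ennreal c"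
proof -
  have "ennreal (1/2) * ennreal c = ennreal (1/2 * c)" by (rule ennreal_mult[symmetric]) (use assms in simp_all)
  moreover have "ennreal (1/2 * c) + ennreal (1/2 * c) = ennreal (1/2 * c + 1/2 * c)"
    by (rule ennreal_plus[symmetric]) (use assms in simp_all)
  ultimately show ?thesis by simp
qed

lemma abs_alpha: "\<bar>alpha Ip i\<bar> = 1"
  by (simp add: alpha_def)

context lc_kernel
begin

section \<open>Sets of capacity zero\<close>

lemma finite_energy_Eplus:
  assumes "M \<in> Eplus \<kappa>" "emeasure M UNIV = 1"
  shows "finite_energy M"
proof -
  have r: "radon M" and fin: "\<bar>mutual \<kappa> M M\<bar> \<noteq> \<infinity>" using assms(1) by (auto simp: Eplus_def)
  have m: "moderate M" using assms(2) by (intro moderate_finite[OF r]) simp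
  then show ?thesis using iter_kpos_finite_iff[OF m m] fin by (simp add: finite_energy_def)
qed

text \<open>Energies are nonnegative, so an admissible measure makes the infimum finite and nonnegative and its inverse
positive or infinite.\<close>

lemma capacity_zeroD:
  assumes cap: "capacity \<kappa> S = 0" and M: "finite_energy M" "emeasure M UNIV = 1" "compact (msupp M)" "msupp M \<subseteq> S"
  shows False
proof -
  let ?T = "{M\<in>Eplus \<kappa>. emeasure M UNIV = 1 \<and> compact (msupp M) \<and> msupp M \<subseteq> S}"
  have mut: "mutual \<kappa> N N = ereal (K N N)" if "finite_energy N" for N
    using that by (intro mutual_eq_K finite_energyD)
  have MT: "M \<in> ?T" using M finite_energyD(1)[OF M(1)] mut[OF M(1)] by (simp add: Eplus_def)
  have "0 \<le> (INF M\<in>?T. mutual \<kappa> M M)"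
  proof (rule INF_greatest)
    fix N assume "N \<in> ?T"
    then have N: "finite_energy N" using finite_energy_Eplus by simp
    have "0 \<le> K N N" using pair_energy(2)[OF N finite_energy_null] by (simp add: K_null)
    then show "0 \<le> mutual \<kappa> N N" using mut[OF N] by simp
  qed
  moreover have "(INF M\<in>?T. mutual \<kappa> M M) \<le> ereal (K M M)"
    using INF_lower[OF MT, of "\<lambda>M. mutual \<kappa> M M"] unfolding mut[OF M(1)] .
  moreover have "inverse (INF M\<in>?T. mutual \<kappa> M M) = 0" using cap unfolding capacity_def .
  ultimately show False by (cases "INF M\<in>?T. mutual \<kappa> M M") (auto split: if_splits)
qed

text \<open>If \<open>M\<close> charged \<open>E\<close>, it would charge a closed subset \<open>F\<close> of \<open>E\<close>; the normalised restriction
of \<open>M\<close> to \<open>F\<close> would then be a unit measure of finite energy with compact support in \<open>E\<close>.\<close>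

lemma AE_not_in_capacity_zero:
  assumes M: "finite_energy M" "emeasure M UNIV = 1" and cm: "compact (msupp M)"
    and E: "E \<in> sets borel" and cap: "capacity \<kappa> E = 0"
  shows "AE x in M. x \<notin> E"
proof (rule ccontr)
  note mM = finite_energyD(1)[OF M(1)]
  have sM: "sets M = sets borel" using mM by simp
  assume "\<not> (AE x in M. x \<notin> E)"
  then have "emeasure M E \<noteq> 0"
    using AE_iff_measurable[of E M "\<lambda>x. x \<notin> E"] E sM by auto
  moreover have "emeasure M E \<le> emeasure M UNIV" using E sM by (intro emeasure_mono) auto
  then have "emeasure M E \<le> 1" unfolding M(2) .
  ultimately obtain e where e: "emeasure M E = ennreal e" "0 < e"
    by (cases "emeasure M E") (auto simp: top_unique)
  have "\<exists>F U. closed F \<and> open U \<and> F \<subseteq> E \<and> E \<subseteq> U \<and> emeasure M (UNIV \<inter> (U - F)) \<le> ennreal (e/2)"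
  proof (rule borel_closed_open_approx[OF sM open_UNIV _ _ E])
    show "emeasure M UNIV < \<infinity>" unfolding M(2) by simp
    show "0 < e/2" using e by simp
    fix O' :: "'x set" and d :: real assume "open O'" "0 < d"
    moreover have "emeasure M O' \<le> emeasure M UNIV" using sM by (intro emeasure_mono) auto
    then have "emeasure M O' < \<infinity>" unfolding M(2) by (rule le_less_trans) simp
    ultimately show "\<exists>K. compact K \<and> K \<subseteq> O' \<and> emeasure M (O' - K) \<le> ennreal d"
      by (intro radon_inner_approx moderate_radon[OF mM])
  qed
  then obtain F U where F: "closed F" "F \<subseteq> E" and U: "open U" "E \<subseteq> U"
    and UF: "emeasure M (U - F) \<le> ennreal (e/2)" by auto
  have FB: "F \<in> sets borel" "U \<in> sets borel" using F(1) U(1) by simp_all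
  have "emeasure M F \<noteq> 0"
  proof
    assume z: "emeasure M F = 0"
    have "emeasure M E \<le> emeasure M (F \<union> (U - F))"
      using U(2) FB sM by (intro emeasure_mono) auto
    also have "\<dots> \<le> emeasure M F + emeasure M (U - F)"
      using FB sM by (intro emeasure_subadditive) auto
    also have "\<dots> \<le> ennreal (e/2)" using UF z by simp
    finally show False using e by simp
  qed
  moreover have "emeasure M F \<le> emeasure M UNIV" using sM by (intro emeasure_mono) auto
  then have "emeasure M F \<le> 1" unfolding M(2) .
  ultimately obtain r where r: "emeasure M F = ennreal r" "0 < r"
    by (cases "emeasure M F") (auto simp: top_unique)
  define Q where "Q = lincomb {()} (\<lambda>_. 1 / r) (\<lambda>_. density M (indicator F))"
  have fQ: "finite_energy Q" unfolding Q_def using finite_energy_density_indicator[OF M(1) FB(1)] by (intro finite_energy_lincomb) simp_all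
  have eQ: "emeasure Q X = ennreal (1 / r) * emeasure M (F \<inter> X)" if "X \<in> sets borel" for X
  proof -
    have "emeasure Q X = (\<Sum>u\<in>{()}. ennreal (1 / r) * emeasure (density M (indicator F)) X)"
      unfolding Q_def using sM that by (intro emeasure_lincomb) simp_all
    moreover have "emeasure (density M (indicator F)) X = emeasure M (F \<inter> X)"
      using FB(1) that sM by (intro emeasure_restricted) simp_all
    ultimately show ?thesis by simp
  qed
  have "emeasure Q UNIV = ennreal (1 / r) * ennreal r" using eQ[of UNIV] r by simp
  also have "\<dots> = 1" using r(2) by (simp add: ennreal_mult[symmetric])
  finally have Q1: "emeasure Q UNIV = 1" .
  have "emeasure Q (- F) = 0" using eQ[of "- F"] FB(1) by simp
  then have QF: "msupp Q \<subseteq> F" using msupp_subset[of "- F" Q] F(1) by auto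
  have "emeasure M (F \<inter> - msupp M) \<le> emeasure M (- msupp M)"
    using open_Compl_msupp[of M] sM by (intro emeasure_mono) auto
  then have "emeasure M (F \<inter> - msupp M) = 0" using emeasure_Compl_msupp[OF moderate_radon[OF mM]] by simp
  then have "emeasure Q (- msupp M) = 0" using eQ[OF borel_open[OF open_Compl_msupp]] by simp
  then have "msupp Q \<subseteq> msupp M" using msupp_subset[OF open_Compl_msupp] by auto
  then have "compact (msupp Q)"
    using compact_Int_closed[OF cm closed_msupp[of Q]] by (simp add: inf.absorb2)
  moreover have "msupp Q \<subseteq> E" using QF F(2) by (rule subset_trans)
  ultimately show False by (rule capacity_zeroD[OF cap fQ Q1])
qed

text \<open>Capacity tests a set only by the supports contained in it. A unit measure for which \<open>P\<close> holds almost
everywhere has a point with \<open>P\<close> in its support, so it is not admissible for the exceptional set.\<close>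

lemma nearly_everywhereI:
  assumes "\<And>M. finite_energy M \<Longrightarrow> emeasure M UNIV = 1 \<Longrightarrow> compact (msupp M) \<Longrightarrow> AE x in M. P x"
  shows "nearly_everywhere \<kappa> UNIV P"
  unfolding nearly_everywhere_def capacity_def
proof -
  have "{M\<in>Eplus \<kappa>. emeasure M UNIV = 1 \<and> compact (msupp M) \<and> msupp M \<subseteq> {x\<in>UNIV. \<not> P x}} = {}"
  proof (rule ccontr)
    assume "\<not> ?thesis"
    then obtain M where M: "M \<in> Eplus \<kappa>" "emeasure M UNIV = 1" "compact (msupp M)" "msupp M \<subseteq> {x\<in>UNIV. \<not> P x}"
      by blast
    note f = finite_energy_Eplus[OF M(1,2)]
    note mM = finite_energyD(1)[OF f]
    have sM: "sets M = sets borel" using mM by simp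
    have "AE x in M. x \<in> msupp M"
      using emeasure_Compl_msupp[OF moderate_radon[OF mM]] open_Compl_msupp[of M] sM
      by (intro AE_I[of _ _ "- msupp M"]) auto
    then have "AE x in M. False" using assms[OF f M(2,3)]
      by eventually_elim (use M(4) in auto)
    then have "emeasure M (space M) = 0" by (simp add: AE_iff_measurable[OF sets.top])
    then show False using M(2) sM by simp
  qed
  then show "inverse (INF M\<in>{M\<in>Eplus \<kappa>. emeasure M UNIV = 1 \<and> compact (msupp M) \<and>
      msupp M \<subseteq> {x\<in>UNIV. \<not> P x}}. mutual \<kappa> M M) = 0"
    by (simp only: image_empty Inf_empty top_ereal_def) simp
qed

section \<open>Energies, distances and midpoints of vector measures\<close>

lemma vmutual_finite_imp_energy_family:
  assumes mod: "\<And>i. i \<in> Ip \<union> In \<Longrightarrow> moderate (\<mu> i)"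
    and fin: "\<bar>vmutual Ip In \<kappa> \<mu> \<mu>\<bar> \<noteq> \<infinity>"
  shows "energy_family (Ip \<union> In) \<mu>"
proof -
  let ?I = "Ip \<union> In"
  let ?t = "\<lambda>(i, j). ereal (alpha Ip i * alpha Ip j) * mutual \<kappa> (\<mu> i) (\<mu> j)"
  note D = esum_finiteD[OF fin[unfolded vmutual_def]]
  have kpos: "iter kpos (\<mu> i) (\<mu> j) < \<infinity>" if "i \<in> ?I" "j \<in> ?I" for i j
  proof -
    have "\<bar>ereal (alpha Ip i * alpha Ip j) * mutual \<kappa> (\<mu> i) (\<mu> j)\<bar> \<noteq> \<infinity>"
      using D(1)[of "(i, j)"] that by simp
    moreover have "alpha Ip i * alpha Ip j = 1 \<or> alpha Ip i * alpha Ip j = - 1" by (simp add: alpha_def)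
    ultimately have "\<bar>mutual \<kappa> (\<mu> i) (\<mu> j)\<bar> \<noteq> \<infinity>"
      by (rule finite_of_finite_sign_mult)
    then show ?thesis by (rule iter_kpos_finite_iff[OF mod[OF that(1)] mod[OF that(2)], THEN iffD2])
  qed
  have "(\<lambda>(i, j). K (\<mu> i) (\<mu> j)) summable_on ?I \<times> ?I"
  proof (rule summable_on_real_bound[OF D(2)])
    fix z assume "z \<in> ?I \<times> ?I"
    then obtain i j where z: "z = (i, j)" "i \<in> ?I" "j \<in> ?I" by auto
    show "\<bar>case z of (i, j) \<Rightarrow> K (\<mu> i) (\<mu> j)\<bar> \<le> \<bar>real_of_ereal (?t z)\<bar>"
      using mutual_eq_K[OF mod[OF z(2)] mod[OF z(3)] kpos[OF z(2,3)]]
      by (simp add: z(1) abs_mult abs_alpha)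
  qed
  then show ?thesis unfolding energy_family_def finite_energy_def using mod kpos by (intro conjI ballI)
qed

lemma mutual_finite_energy: "finite_energy M \<Longrightarrow> finite_energy N \<Longrightarrow> mutual \<kappa> M N = ereal (K M N)"
  by (intro mutual_eq_K finite_energyD pair_energy)

lemma vmutual_eq_energy_form:
  assumes H: "(\<forall>z. 0 \<le> \<kappa> z) \<or> finite (Ip \<union> In)" and \<mu>: "energy_family (Ip \<union> In) \<mu>"
  shows "vmutual Ip In \<kappa> \<mu> \<mu> = ereal (energy_form (Ip \<union> In) (alpha Ip) \<mu> \<mu>)"
  unfolding vmutual_def energy_form_def
proof (rule esum_ereal(1))
  show "(\<lambda>(i, j). alpha Ip i * alpha Ip j * K (\<mu> i) (\<mu> j)) summable_on (Ip \<union> In) \<times> (Ip \<union> In)"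
    by (rule energy_form_summable[OF H _ \<mu> \<mu>]) (rule abs_alpha)
  show "(case z of (i, j) \<Rightarrow> ereal (alpha Ip i * alpha Ip j) * mutual \<kappa> (\<mu> i) (\<mu> j))
      = ereal (case z of (i, j) \<Rightarrow> alpha Ip i * alpha Ip j * K (\<mu> i) (\<mu> j))"
    if "z \<in> (Ip \<union> In) \<times> (Ip \<union> In)" for z
    using that mutual_finite_energy[OF energy_family_fe[OF \<mu>] energy_family_fe[OF \<mu>]] by auto
qed

text \<open>By bilinearity in each entry, the distance is the quadratic form evaluated at the difference.\<close>

lemma EA_dist_eq:
  assumes H: "(\<forall>z. 0 \<le> \<kappa> z) \<or> finite (Ip \<union> In)" and \<mu>: "energy_family (Ip \<union> In) \<mu>" and \<nu>: "energy_family (Ip \<union> In) \<nu>"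
  shows "EA_dist Ip In \<kappa> \<mu> \<nu> = esqrt (ereal (energy_form (Ip \<union> In) (alpha Ip) \<mu> \<mu>
      - 2 * energy_form (Ip \<union> In) (alpha Ip) \<mu> \<nu> + energy_form (Ip \<union> In) (alpha Ip) \<nu> \<nu>))"
proof -
  let ?I = "Ip \<union> In"
  define t where "t \<rho> \<sigma> = (\<lambda>(i, j). alpha Ip i * alpha Ip j * K (\<rho> i) (\<sigma> j))" for \<rho> \<sigma>
  have s: "t \<rho> \<sigma> summable_on ?I \<times> ?I" if "energy_family ?I \<rho>" "energy_family ?I \<sigma>" for \<rho> \<sigma>
    unfolding t_def by (rule energy_form_summable[OF H _ that]) (rule abs_alpha)
  have Bt: "infsum (t \<rho> \<sigma>) (?I \<times> ?I) = energy_form ?I (alpha Ip) \<rho> \<sigma>" for \<rho> \<sigma> unfolding t_def energy_form_def ..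
  define r where "r z = (t \<mu> \<mu> z + t \<nu> \<nu> z) + (- 1) * (t \<mu> \<nu> z + t \<nu> \<mu> z)" for z
  note s1 = summable_on_add[OF s[OF \<mu> \<mu>] s[OF \<nu> \<nu>]] and s2 = summable_on_add[OF s[OF \<mu> \<nu>] s[OF \<nu> \<mu>]]
  note s3 = summable_on_cmult_right[OF s2, of "- 1"]
  have sr: "r summable_on ?I \<times> ?I" unfolding r_def by (rule summable_on_add[OF s1 s3])
  have "infsum r (?I \<times> ?I) = (energy_form ?I (alpha Ip) \<mu> \<mu> + energy_form ?I (alpha Ip) \<nu> \<nu>)
      + (- 1) * (energy_form ?I (alpha Ip) \<mu> \<nu> + energy_form ?I (alpha Ip) \<nu> \<mu>)"
    unfolding r_def infsum_add[OF s1 s3] infsum_cmult_right' infsum_add[OF s[OF \<mu> \<mu>] s[OF \<nu> \<nu>]]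
      infsum_add[OF s[OF \<mu> \<nu>] s[OF \<nu> \<mu>]] Bt ..
  then have ir: "infsum r (?I \<times> ?I) = energy_form ?I (alpha Ip) \<mu> \<mu> - 2 * energy_form ?I (alpha Ip) \<mu> \<nu> + energy_form ?I (alpha Ip) \<nu> \<nu>"
    using energy_form_sym[OF \<mu> \<nu>, of "alpha Ip"] by simp
  have "esum (?I \<times> ?I) (\<lambda>(i, j). ereal (alpha Ip i * alpha Ip j) *
      signed_mutual \<kappa> (radon_diff (\<mu> i) (\<nu> i)) (radon_diff (\<mu> j) (\<nu> j))) = ereal (infsum r (?I \<times> ?I))"
  proof (rule esum_ereal(1)[OF sr])
    fix z assume "z \<in> ?I \<times> ?I"
    then obtain i j where z: "z = (i, j)" "i \<in> ?I" "j \<in> ?I" by auto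
    note sm = signed_mutual_radon_diff[OF energy_family_fe[OF \<mu> z(2)] energy_family_fe[OF \<nu> z(2)] energy_family_fe[OF \<mu> z(3)] energy_family_fe[OF \<nu> z(3)]]
    show "(case z of (i, j) \<Rightarrow> ereal (alpha Ip i * alpha Ip j) *
        signed_mutual \<kappa> (radon_diff (\<mu> i) (\<nu> i)) (radon_diff (\<mu> j) (\<nu> j))) = ereal (r z)"
      unfolding z(1) case_prod_conv sm by (simp add: r_def t_def algebra_simps)
  qed
  then show ?thesis unfolding EA_dist_def ir by simp
qed

definition mid :: "('i \<Rightarrow> 'x measure) \<Rightarrow> ('i \<Rightarrow> 'x measure) \<Rightarrow> 'i \<Rightarrow> 'x measure" where
  "mid \<mu> \<nu> i = lincomb UNIV (\<lambda>_. 1/2) (\<lambda>b. if b then \<mu> i else \<nu> i)"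

lemma K_mid:
  assumes "finite_energy (\<mu> i)" "finite_energy (\<nu> i)" "finite_energy (\<mu> j)" "finite_energy (\<nu> j)"
  shows "K (mid \<mu> \<nu> i) (mid \<mu> \<nu> j)
    = (K (\<mu> i) (\<mu> j) + K (\<mu> i) (\<nu> j) + K (\<nu> i) (\<mu> j) + K (\<nu> i) (\<nu> j)) / 4"
proof -
  have "K (mid \<mu> \<nu> i) (mid \<mu> \<nu> j) = (\<Sum>a\<in>UNIV. \<Sum>b\<in>UNIV. (1/2) * (1/2) *
      K (if a then \<mu> i else \<nu> i) (if b then \<mu> j else \<nu> j))"
    unfolding mid_def using assms by (intro K_lincomb) simp_all
  then show ?thesis by (simp add: UNIV_bool field_simps)
qed

lemma energy_family_mid:
  assumes H: "(\<forall>z. 0 \<le> \<kappa> z) \<or> finite I" and \<mu>: "energy_family I \<mu>" and \<nu>: "energy_family I \<nu>"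
  shows "energy_family I (mid \<mu> \<nu>)"
    and "(\<And>i. \<bar>\<alpha> i\<bar> = 1) \<Longrightarrow> energy_form I \<alpha> (mid \<mu> \<nu>) (mid \<mu> \<nu>) = (energy_form I \<alpha> \<mu> \<mu> + 2 * energy_form I \<alpha> \<mu> \<nu> + energy_form I \<alpha> \<nu> \<nu>) / 4"
proof -
  have Km: "K (mid \<mu> \<nu> i) (mid \<mu> \<nu> j)
    = (1/4) * ((K (\<mu> i) (\<mu> j) + K (\<nu> i) (\<nu> j)) + (K (\<mu> i) (\<nu> j) + K (\<nu> i) (\<mu> j)))" if "i \<in> I" "j \<in> I" for i j
    using K_mid[of \<mu> i \<nu> j] energy_family_fe[OF \<mu>] energy_family_fe[OF \<nu>] that by simp
  have both: "(\<lambda>(i, j). \<beta> i * \<beta> j * K (mid \<mu> \<nu> i) (mid \<mu> \<nu> j)) summable_on I \<times> I"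
    "energy_form I \<beta> (mid \<mu> \<nu>) (mid \<mu> \<nu>) = (energy_form I \<beta> \<mu> \<mu> + 2 * energy_form I \<beta> \<mu> \<nu> + energy_form I \<beta> \<nu> \<nu>) / 4"
    if \<beta>: "\<And>i. \<bar>\<beta> i\<bar> = 1" for \<beta>
  proof -
    define t where "t \<rho> \<sigma> = (\<lambda>(i, j). \<beta> i * \<beta> j * K (\<rho> i) (\<sigma> j))" for \<rho> \<sigma>
    have s: "t \<rho> \<sigma> summable_on I \<times> I" if "energy_family I \<rho>" "energy_family I \<sigma>" for \<rho> \<sigma>
      unfolding t_def by (rule energy_form_summable[OF H _ that]) (rule \<beta>)
    have Bt: "infsum (t \<rho> \<sigma>) (I \<times> I) = energy_form I \<beta> \<rho> \<sigma>" for \<rho> \<sigma> unfolding t_def energy_form_def ..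
    note s1 = summable_on_add[OF s[OF \<mu> \<mu>] s[OF \<nu> \<nu>]] and s2 = summable_on_add[OF s[OF \<mu> \<nu>] s[OF \<nu> \<mu>]]
    note s3 = summable_on_cmult_right[OF summable_on_add[OF s1 s2], of "1/4"]
    have eq: "t (mid \<mu> \<nu>) (mid \<mu> \<nu>) z = (1/4) * ((t \<mu> \<mu> z + t \<nu> \<nu> z) + (t \<mu> \<nu> z + t \<nu> \<mu> z))"
      if zI: "z \<in> I \<times> I" for z
    proof -
      obtain i j where z: "z = (i, j)" "i \<in> I" "j \<in> I" using zI by auto
      show ?thesis unfolding z(1) t_def case_prod_conv Km[OF z(2,3)] by (simp add: algebra_simps)
    qed
    show "(\<lambda>(i, j). \<beta> i * \<beta> j * K (mid \<mu> \<nu> i) (mid \<mu> \<nu> j)) summable_on I \<times> I"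
      unfolding t_def[symmetric] using s3 by (rule summable_on_cong[THEN iffD2, rotated]) (rule eq)
    have "infsum (t (mid \<mu> \<nu>) (mid \<mu> \<nu>)) (I \<times> I)
        = infsum (\<lambda>z. (1/4) * ((t \<mu> \<mu> z + t \<nu> \<nu> z) + (t \<mu> \<nu> z + t \<nu> \<mu> z))) (I \<times> I)"
      by (rule infsum_cong) (rule eq)
    then show "energy_form I \<beta> (mid \<mu> \<nu>) (mid \<mu> \<nu>) = (energy_form I \<beta> \<mu> \<mu> + 2 * energy_form I \<beta> \<mu> \<nu> + energy_form I \<beta> \<nu> \<nu>) / 4"
      unfolding infsum_cmult_right' infsum_add[OF s1 s2] infsum_add[OF s[OF \<mu> \<mu>] s[OF \<nu> \<nu>]]
        infsum_add[OF s[OF \<mu> \<nu>] s[OF \<nu> \<mu>]] Bt energy_form_sym[OF \<nu> \<mu>, of \<beta>] by simp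
  qed
  have "finite_energy (mid \<mu> \<nu> i)" if "i \<in> I" for i
    unfolding mid_def using energy_family_fe[OF \<mu> that] energy_family_fe[OF \<nu> that] by (intro finite_energy_lincomb) simp_all
  then show "energy_family I (mid \<mu> \<nu>)" using both(1)[of "\<lambda>_. 1"] by (simp add: energy_family_def)
  show "(\<And>i. \<bar>\<alpha> i\<bar> = 1) \<Longrightarrow> energy_form I \<alpha> (mid \<mu> \<nu>) (mid \<mu> \<nu>) = (energy_form I \<alpha> \<mu> \<mu> + 2 * energy_form I \<alpha> \<mu> \<nu> + energy_form I \<alpha> \<nu> \<nu>) / 4"
    by (rule both(2))
qed

lemma Mplus_mid:
  assumes A: "closed A" and \<mu>: "moderate (\<mu> i)" "msupp (\<mu> i) \<subseteq> A" and \<nu>: "moderate (\<nu> i)" "msupp (\<nu> i) \<subseteq> A"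
  shows "mid \<mu> \<nu> i \<in> Mplus A"
proof -
  note null = emeasure_null_of_msupp[OF moderate_radon]
  have "emeasure (mid \<mu> \<nu> i) (- A) = (\<Sum>b\<in>UNIV. ennreal (1/2) * emeasure (if b then \<mu> i else \<nu> i) (- A))"
    unfolding mid_def using \<mu>(1) \<nu>(1) A by (intro emeasure_lincomb) auto
  also have "\<dots> = 0" using null[OF \<mu>] null[OF \<nu>] by (simp add: UNIV_bool)
  finally have "msupp (mid \<mu> \<nu> i) \<subseteq> A" using msupp_subset[of "- A"] A by auto
  moreover have "moderate (mid \<mu> \<nu> i)"
    unfolding mid_def using \<mu>(1) \<nu>(1) by (intro moderate_lincomb) simp_all
  ultimately show ?thesis by (simp add: Mplus_def)
qed

lemma nn_integral_mid:
  assumes "f \<in> borel_measurable borel" "moderate (\<mu> i)" "moderate (\<nu> i)"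
  shows "(\<integral>\<^sup>+x. f x \<partial>mid \<mu> \<nu> i) = ennreal (1/2) * (\<integral>\<^sup>+x. f x \<partial>\<mu> i) + ennreal (1/2) * (\<integral>\<^sup>+x. f x \<partial>\<nu> i)"
proof -
  have "(\<integral>\<^sup>+x. f x \<partial>mid \<mu> \<nu> i) = (\<Sum>b\<in>UNIV. ennreal (1/2) * (\<integral>\<^sup>+x. f x \<partial>(if b then \<mu> i else \<nu> i)))"
    unfolding mid_def using assms by (intro nn_integral_lincomb) auto
  then show ?thesis by (simp add: UNIV_bool add.commute)
qed

lemma field_int_finiteD:
  assumes "\<bar>field_int Ip In f1 f2 \<mu>\<bar> \<noteq> \<infinity>"
  obtains r where "\<And>i. i \<in> Ip \<union> In \<Longrightarrow> eint (\<mu> i) (efield f1 f2 i) = ereal (r i)" "r summable_on Ip \<union> In"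
    "field_int Ip In f1 f2 \<mu> = ereal (infsum r (Ip \<union> In))"
proof -
  note D = esum_finiteD[OF assms[unfolded field_int_def]]
  define r where "r i = real_of_ereal (eint (\<mu> i) (efield f1 f2 i))" for i
  have e: "eint (\<mu> i) (efield f1 f2 i) = ereal (r i)" if "i \<in> Ip \<union> In" for i
    unfolding r_def using D(1)[OF that] by (simp add: ereal_real')
  have s: "r summable_on Ip \<union> In" unfolding r_def by (rule D(2))
  show ?thesis
    by (rule that[of r]) (use e s esum_ereal(1)[OF s e] in \<open>simp_all add: field_int_def\<close>)
qed

lemma field_int_mid:
  assumes mod: "\<And>i. i \<in> Ip \<union> In \<Longrightarrow> moderate (\<mu> i)" "\<And>i. i \<in> Ip \<union> In \<Longrightarrow> moderate (\<nu> i)"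
    and meas: "\<And>i. i \<in> Ip \<union> In \<Longrightarrow> efield f1 f2 i \<in> borel_measurable borel"
    and x: "field_int Ip In f1 f2 \<mu> = ereal x" and y: "field_int Ip In f1 f2 \<nu> = ereal y"
  shows "field_int Ip In f1 f2 (mid \<mu> \<nu>) = ereal ((x + y) / 2)"
proof -
  let ?I = "Ip \<union> In"
  obtain r where r: "\<And>i. i \<in> ?I \<Longrightarrow> eint (\<mu> i) (efield f1 f2 i) = ereal (r i)" "r summable_on ?I"
    "field_int Ip In f1 f2 \<mu> = ereal (infsum r ?I)"
    by (rule field_int_finiteD[of Ip In f1 f2 \<mu>]) (auto simp: x)
  obtain s where s: "\<And>i. i \<in> ?I \<Longrightarrow> eint (\<nu> i) (efield f1 f2 i) = ereal (s i)" "s summable_on ?I"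
    "field_int Ip In f1 f2 \<nu> = ereal (infsum s ?I)"
    by (rule field_int_finiteD[of Ip In f1 f2 \<nu>]) (auto simp: y)
  note sa = summable_on_add[OF r(2) s(2)]
  have e: "eint (mid \<mu> \<nu> i) (efield f1 f2 i) = ereal ((1/2) * (r i + s i))" if i: "i \<in> ?I" for i
  proof -
    have "eint (mid \<mu> \<nu> i) (efield f1 f2 i) = ereal (\<Sum>b\<in>UNIV. (1/2) * (if b then r i else s i))"
      unfolding mid_def
      by (rule eint_lincomb[where r = "\<lambda>b. if b then r i else s i"]) (simp_all add: mod[OF i] meas[OF i] r(1)[OF i] s(1)[OF i])
    then show ?thesis by (simp add: UNIV_bool)
  qed
  have "field_int Ip In f1 f2 (mid \<mu> \<nu>) = ereal (infsum (\<lambda>i. (1/2) * (r i + s i)) ?I)"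
    unfolding field_int_def by (rule esum_ereal(1)[OF summable_on_cmult_right[OF sa] e])
  also have "infsum (\<lambda>i. (1/2) * (r i + s i)) ?I = (1/2) * (infsum r ?I + infsum s ?I)"
    unfolding infsum_cmult_right' infsum_add[OF r(2) s(2)] ..
  finally show ?thesis using r(3) s(3) x y by simp
qed

text \<open>At points where all components and their sum converge, the vector potential is defined and equals a real
integral over the indices.\<close>

lemma vpot_eq:
  assumes fin: "\<forall>j\<in>Ip \<union> In. pot_pos (\<mu> j) x < \<infinity> \<and> pot_neg (\<mu> j) x < \<infinity>"
    and int: "integrable (count_space (Ip \<union> In)) (\<lambda>j. alpha Ip j * pot (\<mu> j) x)"
  shows "vpot_defined Ip In \<kappa> \<mu> i x"
    and "vpot Ip In \<kappa> \<mu> i x = ereal (alpha Ip i * (\<integral>j. alpha Ip j * pot (\<mu> j) x \<partial>count_space (Ip \<union> In)))"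
proof -
  let ?I = "Ip \<union> In"
  have e: "eint (\<mu> j) (\<lambda>y. \<kappa> (x, y)) = ereal (pot (\<mu> j) x)" "int_defined (\<mu> j) (\<lambda>y. \<kappa> (x, y))" if "j \<in> ?I" for j
    using eint_eq_diff[of "\<mu> j" "\<lambda>y. \<kappa> (x, y)"] bspec[OF fin that] by (simp_all add: pot_def pot_pos_def pot_neg_def kpos_def kneg_def)
  have int': "integrable (count_space ?I) (\<lambda>j. alpha Ip i * (alpha Ip j * pot (\<mu> j) x))"
    using int by (rule integrable_mult_right)
  have eq: "AE j in count_space ?I. ereal (alpha Ip i * alpha Ip j) * eint (\<mu> j) (\<lambda>y. \<kappa> (x, y))
      = ereal (alpha Ip i * (alpha Ip j * pot (\<mu> j) x))"
    using e(1) by (simp add: AE_count_space mult.assoc)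
  show "vpot_defined Ip In \<kappa> \<mu> i x"
    unfolding vpot_defined_def using e(2) int_defined_integrable(1)[OF int'] eint_cong_AE(2)[OF eq] by simp
  show "vpot Ip In \<kappa> \<mu> i x = ereal (alpha Ip i * (\<integral>j. alpha Ip j * pot (\<mu> j) x \<partial>count_space ?I))"
    unfolding vpot_def eint_cong_AE(1)[OF eq] int_defined_integrable(2)[OF int'] by simp
qed

end

section \<open>Uniqueness of equilibrium measures\<close>

theorem lemma5p1:
  fixes \<kappa> :: "'x::t2_space \<times> 'x \<Rightarrow> ereal"
    and Ip In :: "nat set"
    and A :: "nat \<Rightarrow> 'x set"
    and f1 f2 :: "nat \<Rightarrow> 'x \<Rightarrow> ereal"
    and a :: "nat \<Rightarrow> real"
    and g :: "nat \<Rightarrow> 'x \<Rightarrow> real"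
    and \<mu> \<nu> :: "nat \<Rightarrow> 'x measure"
  assumes "locally_compact_space (euclidean :: 'x topology)"
    and "is_kernel \<kappa>"
    and "positive_definite \<kappa>"
    and "condenser Ip In A"
    and "external_field Ip In \<kappa> f1 f2"
    and "\<And>i. i \<in> Ip \<union> In \<Longrightarrow> a i > 0"
    and "\<And>i. i \<in> Ip \<union> In \<Longrightarrow> continuous_on (A i) (g i)"
    and "\<And>i x. i \<in> Ip \<union> In \<Longrightarrow> x \<in> A i \<Longrightarrow> g i x > 0"
    and "\<mu> \<in> equilibrium Ip In \<kappa> f1 f2 A a g"
    and "\<nu> \<in> equilibrium Ip In \<kappa> f1 f2 A a g"
  shows "EA_dist Ip In \<kappa> \<mu> \<nu> = 0 \<and>
         field_int Ip In f1 f2 \<mu> = field_int Ip In f1 f2 \<nu> \<and>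
         (\<forall>i\<in>Ip \<union> In. nearly_everywhere \<kappa> UNIV
           (\<lambda>x. W_defined Ip In \<kappa> f1 f2 \<mu> i x \<and> W_defined Ip In \<kappa> f1 f2 \<nu> i x \<and>
                W Ip In \<kappa> f1 f2 \<mu> i x = W Ip In \<kappa> f1 f2 \<nu> i x))"
proof -
  interpret lc_kernel \<kappa> by (rule lc_kernel.intro[OF assms(1-3)])
  let ?I = "Ip \<union> In" and ?\<alpha> = "alpha Ip"
  note aa = abs_alpha[of Ip]
  note cond = assms(4)[unfolded condenser_def]
  have clA: "closed (A i)" and neA: "A i \<noteq> {}" if "i \<in> ?I" for i
    using cond[THEN conjunct2, THEN conjunct1, rule_format, OF that] by simp_all
  \<comment> \<open>If the whole space is compact, it meets only finitely many plates, and no plate is empty.\<close>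
  have H: "(\<forall>z. 0 \<le> \<kappa> z) \<or> finite ?I"
  proof (cases "\<forall>z. 0 \<le> \<kappa> z")
    case False
    then have "compact (UNIV :: 'x set)" using kernel_nonneg_or_compact by blast
    then have "finite {i\<in>?I. A i \<inter> UNIV \<noteq> {}}"
      by (rule cond[THEN conjunct2, THEN conjunct2, THEN conjunct1, rule_format])
    moreover have "{i\<in>?I. A i \<inter> UNIV \<noteq> {}} = ?I" using neA by auto
    ultimately show ?thesis by simp
  qed simp
  have Ef_props: "(\<forall>i\<in>?I. moderate (\<tau> i) \<and> msupp (\<tau> i) \<subseteq> A i) \<and> energy_family ?I \<tau> \<and>
      \<bar>field_int Ip In f1 f2 \<tau>\<bar> \<noteq> \<infinity>" if \<tau>: "\<tau> \<in> Ef Ip In \<kappa> f1 f2 A a g" for \<tau>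
  proof -
    have EA: "\<tau> \<in> EA Ip In \<kappa> A" using \<tau> by (simp add: Ef_def)
    have M: "radon (\<tau> i)" "msupp (\<tau> i) \<subseteq> A i" if "i \<in> ?I" for i
      using EA that by (auto simp: EA_def MA_def Mplus_def Pi_iff)
    have mod: "moderate (\<tau> i)" if i: "i \<in> ?I" for i
    proof (rule moderate_of_finite_weight[OF M[OF i] clA[OF i] assms(7)[OF i] assms(8)[OF i]])
      have "(\<integral>\<^sup>+x\<in>A i. ennreal (g i x) \<partial>\<tau> i) = ennreal (a i)" using \<tau> i by (simp add: Ef_def)
      then show "(\<integral>\<^sup>+x\<in>A i. ennreal (g i x) \<partial>\<tau> i) < \<infinity>" by simp
    qed
    have fin: "\<bar>vmutual Ip In \<kappa> \<tau> \<tau>\<bar> \<noteq> \<infinity>" using EA by (simp add: EA_def)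
    have "energy_family ?I \<tau>" by (rule vmutual_finite_imp_energy_family[OF _ fin]) (rule mod)
    moreover have "\<bar>field_int Ip In f1 f2 \<tau>\<bar> \<noteq> \<infinity>" using \<tau> by (simp add: Ef_def)
    ultimately show ?thesis using mod M(2) by simp
  qed
  have \<mu>E: "\<mu> \<in> Ef Ip In \<kappa> f1 f2 A a g" and \<nu>E: "\<nu> \<in> Ef Ip In \<kappa> f1 f2 A a g"
    using assms(9,10) by (simp_all add: equilibrium_def)
  note P\<mu> = Ef_props[OF \<mu>E] and P\<nu> = Ef_props[OF \<nu>E]
  have energy_family: "energy_family ?I \<mu>" "energy_family ?I \<nu>" using P\<mu> P\<nu> by simp_all
  obtain x where x: "field_int Ip In f1 f2 \<mu> = ereal x" using P\<mu> by (cases "field_int Ip In f1 f2 \<mu>") auto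
  obtain y where y: "field_int Ip In f1 f2 \<nu> = ereal y" using P\<nu> by (cases "field_int Ip In f1 f2 \<nu>") auto
  have f2m: "f2 i \<in> borel_measurable borel" and fm: "efield f1 f2 i \<in> borel_measurable borel" if "i \<in> ?I" for i
  proof -
    have "f1 i \<in> Phi" "f2 i \<in> Phi"
      using assms(5)[unfolded external_field_def, rule_format, OF that] by simp_all
    then have "lsc (f1 i)" "lsc (f2 i)" unfolding Phi_def by simp_all
    then have m: "f1 i \<in> borel_measurable borel" "f2 i \<in> borel_measurable borel" by (simp_all add: lsc_borel_measurable)
    show "f2 i \<in> borel_measurable borel" by (rule m(2))
    have "efield f1 f2 i = (\<lambda>x. f1 i x - f2 i x)" by (simp add: fun_eq_iff efield_def)
    then show "efield f1 f2 i \<in> borel_measurable borel" using m by simp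
  qed
  have field_mid: "field_int Ip In f1 f2 (mid \<mu> \<nu>) = ereal ((x + y) / 2)"
    by (rule field_int_mid[OF _ _ _ x y]) (simp_all add: fm P\<mu>[THEN conjunct1, rule_format] P\<nu>[THEN conjunct1, rule_format])
  have energy_family_m: "energy_family ?I (mid \<mu> \<nu>)" by (rule energy_family_mid(1)[OF H energy_family])
  have vm: "vmutual Ip In \<kappa> (mid \<mu> \<nu>) (mid \<mu> \<nu>) = ereal ((energy_form ?I ?\<alpha> \<mu> \<mu> + 2 * energy_form ?I ?\<alpha> \<mu> \<nu> + energy_form ?I ?\<alpha> \<nu> \<nu>) / 4)"
    using vmutual_eq_energy_form[OF H energy_family_m] energy_family_mid(2)[OF H energy_family aa] by simp
  have midE: "mid \<mu> \<nu> \<in> Ef Ip In \<kappa> f1 f2 A a g"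
  proof -
    have "mid \<mu> \<nu> i \<in> Mplus (A i)" if "i \<in> ?I" for i
      by (rule Mplus_mid[OF clA[OF that]]) (simp_all add: P\<mu>[THEN conjunct1, rule_format, OF that] P\<nu>[THEN conjunct1, rule_format, OF that])
    then have "mid \<mu> \<nu> \<in> EA Ip In \<kappa> A" using vm by (simp add: EA_def MA_def Pi_iff)
    moreover have "(\<integral>\<^sup>+x\<in>A i. ennreal (g i x) \<partial>mid \<mu> \<nu> i) = ennreal (a i)" if i: "i \<in> ?I" for i
    proof -
      have "(\<lambda>x. indicator (A i) x *\<^sub>R g i x) \<in> borel_measurable borel"
        using clA[OF i] assms(7)[OF i] by (intro borel_measurable_continuous_on_indicator) simp_all
      then have "(\<lambda>x. ennreal (indicator (A i) x *\<^sub>R g i x)) \<in> borel_measurable borel" by simp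
      moreover have "(\<lambda>x. ennreal (indicator (A i) x *\<^sub>R g i x)) = (\<lambda>x. ennreal (g i x) * indicator (A i) x)"
        by (auto simp: indicator_def)
      ultimately have m: "(\<lambda>x. ennreal (g i x) * indicator (A i) x) \<in> borel_measurable borel" by simp
      have eqs: "(\<integral>\<^sup>+x\<in>A i. ennreal (g i x) \<partial>\<mu> i) = ennreal (a i)" "(\<integral>\<^sup>+x\<in>A i. ennreal (g i x) \<partial>\<nu> i) = ennreal (a i)"
        using \<mu>E \<nu>E i by (simp_all add: Ef_def)
      have "(\<integral>\<^sup>+x\<in>A i. ennreal (g i x) \<partial>mid \<mu> \<nu> i) = ennreal (1/2) * ennreal (a i) + ennreal (1/2) * ennreal (a i)"
        using nn_integral_mid[OF m, of \<mu> i \<nu>] P\<mu>[THEN conjunct1, rule_format, OF i]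
          P\<nu>[THEN conjunct1, rule_format, OF i] unfolding eqs by simp
      also have "\<dots> = ennreal (a i)"
        by (rule ennreal_half_add_half) (use assms(6)[OF i] in simp)
      finally show ?thesis .
    qed
    ultimately show ?thesis using field_mid by (simp add: Ef_def)
  qed
  have "(2::ereal) = ereal 2" by simp
  then have two: "(2::ereal) * ereal z = ereal (2 * z)" for z by (simp only: times_ereal.simps)
  have G: "Gf Ip In \<kappa> f1 f2 \<tau> = ereal (b + 2 * z)"
    if "vmutual Ip In \<kappa> \<tau> \<tau> = ereal b" "field_int Ip In f1 f2 \<tau> = ereal z" for \<tau> b z
    unfolding Gf_def that two by simp
  note G\<mu> = G[OF vmutual_eq_energy_form[OF H energy_family(1)] x] and G\<nu> = G[OF vmutual_eq_energy_form[OF H energy_family(2)] y] and Gm = G[OF vm field_mid]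
  have min: "Gf_inf Ip In \<kappa> f1 f2 A a g \<le> Gf Ip In \<kappa> f1 f2 (mid \<mu> \<nu>)"
    unfolding Gf_inf_def by (rule INF_lower[OF midE])
  have inf: "Gf Ip In \<kappa> f1 f2 \<mu> = Gf_inf Ip In \<kappa> f1 f2 A a g" "Gf Ip In \<kappa> f1 f2 \<nu> = Gf_inf Ip In \<kappa> f1 f2 A a g"
    using assms(9,10) by (simp_all add: equilibrium_def)
  \<comment> \<open>Both minimisers are compared with their midpoint; adding the two inequalities bounds the squared distance by zero.\<close>
  have le: "energy_form ?I ?\<alpha> \<mu> \<mu> + 2 * x \<le> (energy_form ?I ?\<alpha> \<mu> \<mu> + 2 * energy_form ?I ?\<alpha> \<mu> \<nu> + energy_form ?I ?\<alpha> \<nu> \<nu>) / 4 + 2 * ((x + y) / 2)"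
    "energy_form ?I ?\<alpha> \<nu> \<nu> + 2 * y \<le> (energy_form ?I ?\<alpha> \<mu> \<mu> + 2 * energy_form ?I ?\<alpha> \<mu> \<nu> + energy_form ?I ?\<alpha> \<nu> \<nu>) / 4 + 2 * ((x + y) / 2)"
    using min[folded inf(1)] min[folded inf(2)] by (simp_all only: G\<mu> G\<nu> Gm ereal_less_eq(3))
  have Geq: "energy_form ?I ?\<alpha> \<mu> \<mu> + 2 * x = energy_form ?I ?\<alpha> \<nu> \<nu> + 2 * y"
    using inf(1)[folded inf(2)] by (simp only: G\<mu> G\<nu> ereal.inject)
  have "0 \<le> energy_form ?I ?\<alpha> \<mu> \<mu> - 2 * energy_form ?I ?\<alpha> \<mu> \<nu> + energy_form ?I ?\<alpha> \<nu> \<nu>"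
    using energy_family_psd2[where \<alpha> = ?\<alpha> and s = 1 and t = "- 1", OF H aa energy_family] by simp
  with le have zero: "energy_form ?I ?\<alpha> \<mu> \<mu> - 2 * energy_form ?I ?\<alpha> \<mu> \<nu> + energy_form ?I ?\<alpha> \<nu> \<nu> = 0" by (simp add: field_simps)
  have "EA_dist Ip In \<kappa> \<mu> \<nu> = 0"
    unfolding EA_dist_eq[OF H energy_family] zero by (simp add: esqrt_def zero_ereal_def)
  moreover have "x = y"
    using zero_distance_imp_equal_energies[where \<alpha> = ?\<alpha>, OF H aa energy_family zero] Geq by simp
  then have "field_int Ip In f1 f2 \<mu> = field_int Ip In f1 f2 \<nu>" using x y by simp
  moreover have "nearly_everywhere \<kappa> UNIV
       (\<lambda>x. W_defined Ip In \<kappa> f1 f2 \<mu> i x \<and> W_defined Ip In \<kappa> f1 f2 \<nu> i x \<and>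
            W Ip In \<kappa> f1 f2 \<mu> i x = W Ip In \<kappa> f1 f2 \<nu> i x)" if i: "i \<in> ?I" for i
  proof (rule nearly_everywhereI)
    fix M :: "'x measure" assume M: "finite_energy M" "emeasure M UNIV = 1" "compact (msupp M)"
    have pot_fin: "AE x in M. \<forall>j\<in>?I. pot_pos (\<tau> j) x < \<infinity> \<and> pot_neg (\<tau> j) x < \<infinity>" if "energy_family ?I \<tau>" for \<tau>
      unfolding AE_ball_countable[OF countableI_type] using integral_pot(1)[OF M(1) energy_family_fe[OF that]] by blast
    have "f2 i -` {\<infinity>} \<in> sets borel" using measurable_sets[OF f2m[OF i], of "{\<infinity>}"] by simp
    moreover have "f2 i -` {\<infinity>} = {x\<in>UNIV. \<not> f2 i x \<noteq> \<infinity>}" by auto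
    then have "capacity \<kappa> (f2 i -` {\<infinity>}) = 0"
      using assms(5)[unfolded external_field_def, rule_format, OF i] by (simp add: nearly_everywhere_def)
    ultimately have "AE x in M. x \<notin> f2 i -` {\<infinity>}" by (rule AE_not_in_capacity_zero[OF M])
    moreover have "AE x in M. \<forall>j\<in>?I. pot_pos (\<mu> j) x < \<infinity> \<and> pot_neg (\<mu> j) x < \<infinity>" by (rule pot_fin[OF energy_family(1)])
    moreover have "AE x in M. \<forall>j\<in>?I. pot_pos (\<nu> j) x < \<infinity> \<and> pot_neg (\<nu> j) x < \<infinity>" by (rule pot_fin[OF energy_family(2)])
    moreover have "AE x in M. integrable (count_space ?I) (\<lambda>j. ?\<alpha> j * pot (\<mu> j) x)"
      by (rule potential_integral(1)[OF H aa energy_family(1) M(1)])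
    moreover have "AE x in M. integrable (count_space ?I) (\<lambda>j. ?\<alpha> j * pot (\<nu> j) x)"
      by (rule potential_integral(1)[OF H aa energy_family(2) M(1)])
    moreover have "AE x in M. (\<integral>j. ?\<alpha> j * pot (\<mu> j) x \<partial>count_space ?I) = (\<integral>j. ?\<alpha> j * pot (\<nu> j) x \<partial>count_space ?I)"
      by (rule potentials_AE_equal[OF H aa energy_family M(1) i zero])
    ultimately show "AE x in M. W_defined Ip In \<kappa> f1 f2 \<mu> i x \<and> W_defined Ip In \<kappa> f1 f2 \<nu> i x \<and>
            W Ip In \<kappa> f1 f2 \<mu> i x = W Ip In \<kappa> f1 f2 \<nu> i x"
    proof eventually_elim
      case (elim z)
      have f2: "f2 i z \<noteq> \<infinity>" using elim(1) by simp
      note e\<mu> = vpot_eq[of Ip In \<mu> z i, OF elim(2) elim(4)]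
      note e\<nu> = vpot_eq[of Ip In \<nu> z i, OF elim(3) elim(5)]
      have eq: "vpot Ip In \<kappa> \<mu> i z = vpot Ip In \<kappa> \<nu> i z" unfolding e\<mu>(2) e\<nu>(2) elim(6) ..
      show ?case
        unfolding W_defined_def W_def eq field_defined_def using e\<mu>(1) e\<nu>(1) e\<nu>(2) f2 by simp
    qed
  qed
  ultimately show ?thesis by blast
qed

end
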